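(* Let $r,N\in\mathbb{N}_{>0}$, let $\gamma\subset\mathbb{C}$ be a finite union of piecewise smooth, oriented curves, and let $W$ be a rational $r\times r$ matrix weight with no pole on $\gamma$ such that $W(z)$ is diagonalizable for all but finitely many $z\in\mathbb{C}$. Suppose that the Christoffel--Darboux kernel $\mathcal{R}_N^W$ exists. Let $\mathcal{M}$ be an $r$-sheeted Riemann surface such that the functions $\lambda$, $\mathfrak{e}$, $\widehat{\mathfrak{e}}$ (see context) are meromorphic on $\mathcal{M}$, and assume that $\mathcal{M}$ is connected and of genus $0$. Let $\varphi,\phi,h,\widehat{h},\mathfrak{R}_{rN}^{\mathcal{W}},\mathcal{W},\gamma_{\mathbb{C}},\mathcal{V}$ and the matrix orthogonal polynomials $P_N^{\mathrm{L}},P_N^{\mathrm{R}},Q_{N-1}^{\mathrm{L}},Q_{N-1}^{\mathrm{R}}$ be as defined in the context. If $\mathcal{V}=\mathcal{P}_{rN-1}$, then $$\mathfrak{R}_{rN}^{\mathcal{W}}(\omega,\zeta)=\widehat{h}(\omega)\widehat{\mathfrak{e}}(\varphi(\omega))\frac{Q_{N-1}^{\mathrm{R}}(\phi(\omega))P_N^{\mathrm{L}}(\phi(\zeta))-P_N^{\mathrm{R}}(\phi(\omega))Q_{N-1}^{\mathrm{L}}(\phi(\zeta))}{\phi(\zeta)-\phi(\omega)}\mathfrak{e}(\varphi(\zeta))h(\zeta)$$ $$=\frac{1}{\zeta-\omega}\Big(q_{rN-1}(\omega)p_{rN}(\zeta)-p_{rN}(\omega)q_{rN-1}(\zeta)\Big)=\mathcal{R}_{rN}^{\mathcal{W}}(\omega,\zeta),$$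 where $\mathcal{R}_{rN}^{\mathcal{W}}$ is the scalar CD kernel associated to $\mathcal{W}$ on $\gamma_{\mathbb{C}}$, $p_{rN}(\zeta)=\zeta^{rN}+\dots$ is the monic scalar polynomial of degree $rN$ defined by $$\int_{\gamma_{\mathbb{C}}}p_{rN}(\zeta)\mathcal{W}(\zeta)\zeta^k\,d\zeta=0,\qquad k=0,\dots,rN-1,$$ and $q_{rN-1}$ is the scalar polynomial of degree $\le rN-1$ satisfying $$\int_{\gamma_{\mathbb{C}}}q_{rN-1}(\zeta)\mathcal{W}(\zeta)\zeta^k\,d\zeta=\delta_{k,rN-1},\qquad k=0,\dots,rN-1.$$
   Context: **Polynomial spaces.** $\mathcal{P}_{n}^{j\times k}$ is the vector space of all $j\times k$ matrix polynomials $\sum_{\ell=0}^{n}C_\ell z^\ell$, and $\mathcal{P}_n=\mathcal{P}_n^{1\times1}$. **CD kernel.** Given $\gamma$, $W$, $N$, the Christoffel--Darboux (CD) kernel $\mathcal{R}_N^W(w,z)$ is the unique (when it exists) bivariate $r\times r$ matrix polynomial of degree $\le N-1$ in both $w$ and $z$ satisfying either of the following two properties (each one alone determines it, and they are equivalent): $\int_\gamma P(w)W(w)\mathcal{R}_N^W(w,z)dw=P(z)$ for every $P\in\mathcal{P}_{N-1}^{r\times r}$, $z\in\mathbb{C}$; or $\int_\gamma\mathcal{R}_N^W(w,z)W(z)P(z)dz=P(w)$ for every $P\in\mathcal{P}_{N-1}^{r\times r}$, $w\in\mathbb{C}$. If $\gamma$ is unbounded, existence includes the requirement $W(z)=\mathcal{O}(z^{-2N})$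 as $z\to\infty$. The scalar CD kernel $\mathcal{R}_{rN}^{\mathcal{W}}$ is the same notion with matrix size $1$, weight $\mathcal{W}$, contour $\gamma_{\mathbb{C}}$ and $rN$ in place of $N$. All integrals defining the orthogonal polynomials below are assumed to converge. **Matrix orthogonal polynomials.** With $\langle P,Q\rangle=\int_\gamma P(z)W(z)Q(z)dz$, $I_r$ and $0_r$ the identity and zero matrices, $P_N^{\mathrm{L}}(z)=z^NI_r+\dots$ and $P_N^{\mathrm{R}}(z)=z^NI_r+\dots$ are the monic $r\times r$ matrix polynomials of degree $N$ with $\langle P_N^{\mathrm{L}},z^kI_r\rangle=0_r$ and $\langle z^kI_r,P_N^{\mathrm{R}}\rangle=0_r$ for $k=0,\dots,N-1$; $Q_{N-1}^{\mathrm{L}},Q_{N-1}^{\mathrm{R}}$ are the $r\times r$ matrix polynomials of degree $\le N-1$ with $\langle Q_{N-1}^{\mathrm{L}},z^kI_r\rangle=\delta_{k,N-1}I_r$ and $\langle z^kI_r,Q_{N-1}^{\mathrm{R}}\rangle=\delta_{k,N-1}I_r$ for $k=0,\dots,N-1$. **Riemann surface and the functions $\lambda,\mathfrak{e},\widehat{\mathfrak{e}}$.** For all but finitely many $z\in\mathbb{C}$ write $W(z)=E(z)\Lambda(z)E(z)^{-1}$ with $\Lambda(z)=\mathrm{diag}(\lambda_1(z),\dots,\lambda_r(z))$ and $E(z)$ an invertible matrix of eigenvectors. $\mathcal{M}$ is a compact Riemann surface represented as an $r$-sheeted branched covering of $\widehat{\mathbb{C}}=\mathbb{C}\cup\{\infty\}$.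 Points of $\mathcal{M}$ are denoted $\mathrm{z},\mathrm{w}$, and $z,w$ denote their projections on $\widehat{\mathbb{C}}$; $z^{(k)}$ is the point on the $k$-th sheet that projects to $z$; in particular $\infty^{(j)}$ is the point at infinity on the $j$-th sheet (the $\infty^{(j)}$ need not be distinct). With $e_k$ the $k$-th column of the identity matrix, for $\mathrm{z}$ on the $k$-th sheet $$\lambda(\mathrm{z})=\lambda_k(z),\qquad \mathfrak{e}(\mathrm{z})=E(z)e_k,\qquad \widehat{\mathfrak{e}}(\mathrm{z})=e_k^TE(z)^{-1}.$$ $\mathcal{M}$, the numbering of its sheets, and $E$ are chosen so that these functions are (entrywise) meromorphic on $\mathcal{M}$. **Zeros and poles.** For a vector valued meromorphic function $F$ on $\mathcal{M}$, $\mathrm{z}$ is a zero of order $m$ if it is a common zero of all entries, of order $\ge m$ for each entry and exactly $m$ for at least one; $\mathrm{z}$ is a pole of order $m$ if it is a pole of order $m$ of at least one entry and no entry has a pole of larger order there. $\mathcal{Z},\mathcal{Q}$ are the sets of zeros and poles of $\mathfrak{e}$ on $\mathcal{M}$ (points at infinity included), $\widehat{\mathcal{Z}},\widehat{\mathcal{Q}}$ those of $\widehat{\mathfrak{e}}$. For $\mathrm{z}\in\mathcal{Z}$, $n_{\mathrm{z}}>0$ is the order of the zero; for $\mathrm{z}\in\mathcal{Q}$, $-n_{\mathrm{z}}>0$ is the order of the pole; $\widehat{n}_{\mathrm{z}}$ is defined in the same way for $\widehat{\mathfrak{e}}$. **Genus 0 objects.** $\varphi:\widehat{\mathbb{C}}\to\mathcal{M}$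 is a conformal bijection and $\phi(\zeta)$ is the projection of $\varphi(\zeta)$ on $\widehat{\mathbb{C}}$. Define $$h(\zeta)=\prod_{\substack{1\le j\le r\\ \infty^{(j)}\ne\varphi(\infty)}}(\zeta-\varphi^{-1}(\infty^{(j)}))^{N-1}\prod_{\mathrm{z}\in(\mathcal{Z}\cup\mathcal{Q})\setminus\{\varphi(\infty)\}}(\zeta-\varphi^{-1}(\mathrm{z}))^{-n_{\mathrm{z}}},$$ $$\widehat{h}(\zeta)=\prod_{\substack{1\le j\le r\\ \infty^{(j)}\ne\varphi(\infty)}}(\zeta-\varphi^{-1}(\infty^{(j)}))^{N-1}\prod_{\mathrm{z}\in(\widehat{\mathcal{Z}}\cup\widehat{\mathcal{Q}})\setminus\{\varphi(\infty)\}}(\zeta-\varphi^{-1}(\mathrm{z}))^{-\widehat{n}_{\mathrm{z}}},$$ $$\mathfrak{R}_{rN}^{\mathcal{W}}(\omega,\zeta)=\widehat{h}(\omega)\,\widehat{\mathfrak{e}}(\varphi(\omega))\,\mathcal{R}_N^W(\phi(\omega),\phi(\zeta))\,\mathfrak{e}(\varphi(\zeta))\,h(\zeta),\quad\zeta,\omega\in\mathbb{C},$$ $$\mathcal{W}(\omega)=\frac{\lambda(\varphi(\omega))}{h(\omega)\widehat{h}(\omega)}\phi'(\omega),\qquad \gamma_{\mathbb{C}}=\varphi^{-1}\Big(\bigcup_{j=1}^r\gamma^{(j)}\Big),$$ where $\gamma^{(j)}$ is the copy of $\gamma$ on the $j$-th sheet; $\gamma_{\mathbb{C}}$ carries the induced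 orientation, and $\int_{\gamma_{\mathbb{C}}}G(\omega)d\omega=\int_\gamma\sum_{j=1}^r\frac{G(\varphi^{-1}(w^{(j)}))}{\phi'(\varphi^{-1}(w^{(j)}))}\,dw$. With $L_N=\{\mathrm{z}\mapsto P(z)\mathfrak{e}(\mathrm{z}):P\in\mathcal{P}_{N-1}^{1\times r}\}$, set $\mathcal{V}=\{\zeta\mapsto f(\varphi(\zeta))h(\zeta):f\in L_N\}$, which is a space of polynomials. Identities between kernels are understood with removable singularities (e.g. at $\zeta=\omega$) filled in by continuity. *)

theory Defs
  imports "HOL-Complex_Analysis.Complex_Analysis" "HOL-Homology.Homology"
begin

section \<open>Oriented curves and integrals along them\<close>

text \<open>A contour is a finite list of parametrised pieces \<open>(I, g)\<close>. The parameter interval is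
  closed but may be unbounded; at an infinite end the curve has to run off to infinity.\<close>

type_synonym curve = "real set \<times> (real \<Rightarrow> complex)"

definition piecewise_smooth_curve :: "curve \<Rightarrow> bool" where
  "piecewise_smooth_curve C \<longleftrightarrow> (case C of (I, g) \<Rightarrow>
     is_interval I \<and> closed I \<and> g piecewise_C1_differentiable_on I \<and>
     (\<not> bdd_above I \<longrightarrow> filterlim g at_infinity at_top) \<and>
     (\<not> bdd_below I \<longrightarrow> filterlim g at_infinity at_bot))"

definition curve_image :: "curve list \<Rightarrow> complex set" where
  "curve_image \<gamma> = (\<Union>(I, g)\<in>set \<gamma>. g ` I)"

text \<open>Convergence of the integral is part of the predicate; the Henstock--Kurzweil integral
  includes improper integrals over unbounded parameter intervals.\<close>

definition has_curve_integral :: "curve list \<Rightarrow> (complex \<Rightarrow> complex) \<Rightarrow> complex \<Rightarrow> bool" where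
  "has_curve_integral \<gamma> f v \<longleftrightarrow>
     (\<forall>(I, g)\<in>set \<gamma>. (\<lambda>t. f (g t) * vector_derivative g (at t)) integrable_on I) \<and>
     v = (\<Sum>(I, g)\<leftarrow>\<gamma>. integral I (\<lambda>t. f (g t) * vector_derivative g (at t)))"


section \<open>Matrix polynomials and the Christoffel--Darboux kernel\<close>

definition smult_mat :: "complex \<Rightarrow> complex^'k^'j \<Rightarrow> complex^'k^'j" where
  "smult_mat c A = (\<chi> i j. c * A $ i $ j)"

definition diag_mat :: "complex^'r \<Rightarrow> complex^'r^'r" where
  "diag_mat d = (\<chi> i j. if i = j then d $ i else 0)"

definition row_mat_col :: "complex^'r \<Rightarrow> complex^'r^'r \<Rightarrow> complex^'r \<Rightarrow> complex" where
  "row_mat_col u A v = (\<Sum>i\<in>UNIV. \<Sum>j\<in>UNIV. u $ i * A $ i $ j * v $ j)"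

definition mat_polys :: "nat \<Rightarrow> (complex \<Rightarrow> complex^'k^'j) set" where
  "mat_polys n = {P. \<exists>C. P = (\<lambda>z. \<Sum>l\<le>n. smult_mat (z ^ l) (C l))}"

definition monic_mat_polys :: "nat \<Rightarrow> (complex \<Rightarrow> complex^'r^'r) set" where
  "monic_mat_polys n = {P. \<exists>C. C n = mat 1 \<and> P = (\<lambda>z. \<Sum>l\<le>n. smult_mat (z ^ l) (C l))}"

definition bivariate_mat_polys :: "nat \<Rightarrow> (complex \<Rightarrow> complex \<Rightarrow> complex^'r^'r) set" where
  "bivariate_mat_polys n =
     {R. \<exists>C. R = (\<lambda>w z. \<Sum>k\<le>n. \<Sum>l\<le>n. smult_mat (w ^ k * z ^ l) (C k l))}"

text \<open>Numerator and denominator are coprime, so the poles are exactly the zeros of the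
  denominator (where the quotient has the conventional value \<open>0\<close>).\<close>

definition rational_matrix :: "(complex \<Rightarrow> complex^'r^'r) \<Rightarrow> bool" where
  "rational_matrix W \<longleftrightarrow>
     (\<forall>i j. \<exists>p q :: complex poly. q \<noteq> 0 \<and> coprime p q \<and> (\<forall>z. W z $ i $ j = poly p z / poly q z))"

text \<open>Below, \<open>J f v\<close> stands for a scalar integral: the integral of \<open>f\<close> converges and has value \<open>v\<close>.
  Matrices are integrated entrywise.\<close>

type_synonym integral_pred = "(complex \<Rightarrow> complex) \<Rightarrow> complex \<Rightarrow> bool"

definition mat_integral ::
    "integral_pred \<Rightarrow> (complex \<Rightarrow> complex^'r^'r) \<Rightarrow> complex^'r^'r \<Rightarrow> bool" where
  "mat_integral J F V \<longleftrightarrow> (\<forall>i j. J (\<lambda>z. F z $ i $ j) (V $ i $ j))"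

definition pairing ::
    "integral_pred \<Rightarrow> (complex \<Rightarrow> complex^'r^'r) \<Rightarrow> (complex \<Rightarrow> complex^'r^'r) \<Rightarrow>
     (complex \<Rightarrow> complex^'r^'r) \<Rightarrow> complex^'r^'r \<Rightarrow> bool" where
  "pairing J W P Q V \<longleftrightarrow> mat_integral J (\<lambda>z. P z ** W z ** Q z) V"

definition CD_kernel ::
    "integral_pred \<Rightarrow> complex set \<Rightarrow> (complex \<Rightarrow> complex^'r^'r) \<Rightarrow> nat \<Rightarrow>
     (complex \<Rightarrow> complex \<Rightarrow> complex^'r^'r) \<Rightarrow> bool" where
  "CD_kernel J \<Gamma> W N R \<longleftrightarrow>
     R \<in> bivariate_mat_polys (N - 1) \<and>
     ((\<forall>P\<in>mat_polys (N - 1). \<forall>z. mat_integral J (\<lambda>w. P w ** W w ** R w z) (P z)) \<or>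
      (\<forall>P\<in>mat_polys (N - 1). \<forall>w. mat_integral J (\<lambda>z. R w z ** W z ** P z) (P w))) \<and>
     (\<not> bounded \<Gamma> \<longrightarrow> (\<forall>i j. (\<lambda>z. W z $ i $ j) \<in> O[at_infinity](\<lambda>z. 1 / z ^ (2 * N))))"

definition is_PL :: "integral_pred \<Rightarrow> (complex \<Rightarrow> complex^'r^'r) \<Rightarrow> nat \<Rightarrow> (complex \<Rightarrow> complex^'r^'r) \<Rightarrow> bool"
  where "is_PL J W N P \<longleftrightarrow>
    P \<in> monic_mat_polys N \<and> (\<forall>k<N. pairing J W P (\<lambda>z. mat (z ^ k)) 0)"

definition is_PR :: "integral_pred \<Rightarrow> (complex \<Rightarrow> complex^'r^'r) \<Rightarrow> nat \<Rightarrow> (complex \<Rightarrow> complex^'r^'r) \<Rightarrow> bool"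
  where "is_PR J W N P \<longleftrightarrow>
    P \<in> monic_mat_polys N \<and> (\<forall>k<N. pairing J W (\<lambda>z. mat (z ^ k)) P 0)"

definition is_QL :: "integral_pred \<Rightarrow> (complex \<Rightarrow> complex^'r^'r) \<Rightarrow> nat \<Rightarrow> (complex \<Rightarrow> complex^'r^'r) \<Rightarrow> bool"
  where "is_QL J W N Q \<longleftrightarrow>
    Q \<in> mat_polys (N - 1) \<and>
    (\<forall>k<N. pairing J W Q (\<lambda>z. mat (z ^ k)) (if k = N - 1 then mat 1 else 0))"

definition is_QR :: "integral_pred \<Rightarrow> (complex \<Rightarrow> complex^'r^'r) \<Rightarrow> nat \<Rightarrow> (complex \<Rightarrow> complex^'r^'r) \<Rightarrow> bool"
  where "is_QR J W N Q \<longleftrightarrow>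
    Q \<in> mat_polys (N - 1) \<and>
    (\<forall>k<N. pairing J W (\<lambda>z. mat (z ^ k)) Q (if k = N - 1 then mat 1 else 0))"

text \<open>The scalar kernel is the case of \<open>1 \<times> 1\<close> matrices.\<close>

definition scalar_CD_kernel ::
    "integral_pred \<Rightarrow> complex set \<Rightarrow> (complex \<Rightarrow> complex) \<Rightarrow> nat \<Rightarrow>
     (complex \<Rightarrow> complex \<Rightarrow> complex) \<Rightarrow> bool" where
  "scalar_CD_kernel J \<Gamma> w n K \<longleftrightarrow>
     CD_kernel J \<Gamma> (\<lambda>\<omega>. mat (w \<omega>) :: complex^1^1) n (\<lambda>\<omega> \<zeta>. mat (K \<omega> \<zeta>))"

definition is_scalar_p :: "integral_pred \<Rightarrow> (complex \<Rightarrow> complex) \<Rightarrow> nat \<Rightarrow> complex poly \<Rightarrow> bool" where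
  "is_scalar_p J w n p \<longleftrightarrow>
     degree p = n \<and> lead_coeff p = 1 \<and> (\<forall>k<n. J (\<lambda>\<zeta>. poly p \<zeta> * w \<zeta> * \<zeta> ^ k) 0)"

definition is_scalar_q :: "integral_pred \<Rightarrow> (complex \<Rightarrow> complex) \<Rightarrow> nat \<Rightarrow> complex poly \<Rightarrow> bool" where
  "is_scalar_q J w n q \<longleftrightarrow>
     degree q \<le> n - 1 \<and>
     (\<forall>k<n. J (\<lambda>\<zeta>. poly q \<zeta> * w \<zeta> * \<zeta> ^ k) (if k = n - 1 then 1 else 0))"


section \<open>Riemann surfaces\<close>

text \<open>A chart is an open set together with a coordinate, whose values outside the open set
  are irrelevant.\<close>

record 'm surface =
  space :: "'m topology"
  atlas :: "('m set \<times> ('m \<Rightarrow> complex)) set"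

definition riemann_surface :: "('m, 'x) surface_scheme \<Rightarrow> bool" where
  "riemann_surface S \<longleftrightarrow>
     Hausdorff_space (space S) \<and>
     second_countable (space S) \<and>
     (\<Union>(U, c)\<in>atlas S. U) = topspace (space S) \<and>
     (\<forall>(U, c)\<in>atlas S. openin (space S) U \<and> open (c ` U) \<and>
        homeomorphic_map (subtopology (space S) U) (top_of_set (c ` U)) c) \<and>
     (\<forall>(U, c)\<in>atlas S. \<forall>(V, d)\<in>atlas S. (d \<circ> inv_into U c) holomorphic_on c ` (U \<inter> V))"

definition riemann_sphere :: "complex option surface" where
  "riemann_sphere =
     \<lparr>space = Alexandroff_compactification euclidean,
      atlas = {(- {None}, the), (- {Some 0}, case_option 0 inverse)}\<rparr>"

definition holomorphic_map ::
    "('m, 'x) surface_scheme \<Rightarrow> ('n, 'y) surface_scheme \<Rightarrow> ('m \<Rightarrow> 'n) \<Rightarrow> bool" where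
  "holomorphic_map S T f \<longleftrightarrow>
     continuous_map (space S) (space T) f \<and>
     (\<forall>(U, c)\<in>atlas S. \<forall>(V, d)\<in>atlas T. (d \<circ> f \<circ> inv_into U c) holomorphic_on c ` (U \<inter> f -` V))"

definition conformal_bijection ::
    "('m, 'x) surface_scheme \<Rightarrow> ('n, 'y) surface_scheme \<Rightarrow> ('m \<Rightarrow> 'n) \<Rightarrow> bool" where
  "conformal_bijection S T f \<longleftrightarrow>
     bij_betw f (topspace (space S)) (topspace (space T)) \<and>
     holomorphic_map S T f \<and>
     holomorphic_map T S (inv_into (topspace (space S)) f)"

text \<open>The first homology group of a compact connected surface of genus \<open>g\<close> is free abelian of
  rank \<open>2 g\<close>.\<close>

definition has_genus :: "('m, 'x) surface_scheme \<Rightarrow> nat \<Rightarrow> bool" where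
  "has_genus S g \<longleftrightarrow> homology_group 1 (space S) \<cong> free_Abelian_group {..<2 * g}"

text \<open>Orders and multiplicities are read off in some chart around the point; on a Riemann
  surface they do not depend on its choice.\<close>

definition chart_at :: "('m, 'x) surface_scheme \<Rightarrow> 'm \<Rightarrow> 'm set \<times> ('m \<Rightarrow> complex)" where
  "chart_at S p = (SOME C. C \<in> atlas S \<and> p \<in> fst C)"

definition coord :: "('m, 'x) surface_scheme \<Rightarrow> 'm \<Rightarrow> 'm \<Rightarrow> complex" where
  "coord S p = snd (chart_at S p)"

definition local_rep :: "('m, 'x) surface_scheme \<Rightarrow> 'm \<Rightarrow> ('m \<Rightarrow> 'a) \<Rightarrow> complex \<Rightarrow> 'a" where
  "local_rep S p f = f \<circ> inv_into (fst (chart_at S p)) (coord S p)"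

definition map_multiplicity ::
    "('m, 'x) surface_scheme \<Rightarrow> ('n, 'y) surface_scheme \<Rightarrow> ('m \<Rightarrow> 'n) \<Rightarrow> 'm \<Rightarrow> int" where
  "map_multiplicity S T f p =
     zorder (\<lambda>t. coord T (f p) (local_rep S p f t) - coord T (f p) (f p)) (coord S p p)"

text \<open>Meromorphic functions are represented by complex valued functions that are analytic away
  from their poles and have, by convention, the value \<open>0\<close> at the poles.\<close>

definition meromorphic_fun :: "('m, 'x) surface_scheme \<Rightarrow> ('m \<Rightarrow> complex) \<Rightarrow> bool" where
  "meromorphic_fun S f \<longleftrightarrow> (\<forall>(U, c)\<in>atlas S. (f \<circ> inv_into U c) nicely_meromorphic_on c ` U)"

definition meromorphic_vec :: "('m, 'x) surface_scheme \<Rightarrow> ('m \<Rightarrow> complex^'r) \<Rightarrow> bool" where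
  "meromorphic_vec S F \<longleftrightarrow> (\<forall>i. meromorphic_fun S (\<lambda>p. F p $ i))"

text \<open>The constant \<open>zorder\<close> is unspecified for a function vanishing identically near the point;
  such an entry vanishes to every order.\<close>

definition zero_of_order :: "('m, 'x) surface_scheme \<Rightarrow> ('m \<Rightarrow> complex^'r) \<Rightarrow> 'm \<Rightarrow> nat \<Rightarrow> bool" where
  "zero_of_order S F p m \<longleftrightarrow> m > 0 \<and>
     (\<forall>i. let f = local_rep S p (\<lambda>x. F x $ i); a = coord S p p in
        (\<forall>\<^sub>F t in at a. f t = 0) \<or> zorder f a \<ge> int m) \<and>
     (\<exists>i. let f = local_rep S p (\<lambda>x. F x $ i); a = coord S p p in
        (\<exists>\<^sub>F t in at a. f t \<noteq> 0) \<and> zorder f a = int m)"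

definition pole_of_order :: "('m, 'x) surface_scheme \<Rightarrow> ('m \<Rightarrow> complex^'r) \<Rightarrow> 'm \<Rightarrow> nat \<Rightarrow> bool" where
  "pole_of_order S F p m \<longleftrightarrow> m > 0 \<and>
     (\<exists>i. let f = local_rep S p (\<lambda>x. F x $ i); a = coord S p p in
        is_pole f a \<and> - zorder f a = int m) \<and>
     (\<forall>i. let f = local_rep S p (\<lambda>x. F x $ i); a = coord S p p in
        is_pole f a \<longrightarrow> - zorder f a \<le> int m)"

definition zeros_of :: "('m, 'x) surface_scheme \<Rightarrow> ('m \<Rightarrow> complex^'r) \<Rightarrow> 'm set" where
  "zeros_of S F = {p \<in> topspace (space S). \<exists>m. zero_of_order S F p m}"

definition poles_of :: "('m, 'x) surface_scheme \<Rightarrow> ('m \<Rightarrow> complex^'r) \<Rightarrow> 'm set" where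
  "poles_of S F = {p \<in> topspace (space S). \<exists>m. pole_of_order S F p m}"

definition vec_order :: "('m, 'x) surface_scheme \<Rightarrow> ('m \<Rightarrow> complex^'r) \<Rightarrow> 'm \<Rightarrow> int" where
  "vec_order S F p =
     (THE n. (\<exists>m. zero_of_order S F p m \<and> n = int m) \<or> (\<exists>m. pole_of_order S F p m \<and> n = - int m))"


section \<open>Branched coverings of the sphere\<close>

text \<open>\<open>sheet M k z\<close> is the point on the \<open>k\<close>-th sheet above \<open>z\<close>; the sheets are indexed by the same
  finite type as the rows and columns of the weight.\<close>

record ('m, 'r) covering = "'m surface" +
  proj :: "'m \<Rightarrow> complex option"
  sheet :: "'r \<Rightarrow> complex option \<Rightarrow> 'm"

definition branched_covering :: "('m, 'r::finite) covering \<Rightarrow> bool" where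
  "branched_covering M \<longleftrightarrow>
     holomorphic_map M riemann_sphere (proj M) \<and>
     (\<forall>z. {p \<in> topspace (space M). proj M p = z} = range (\<lambda>k. sheet M k z)) \<and>
     (\<forall>p\<in>topspace (space M).
        int (card {k. sheet M k (proj M p) = p}) = map_multiplicity M riemann_sphere (proj M) p)"


section \<open>Objects in genus zero\<close>

text \<open>In the following, \<open>\<phi>\<close> is the conformal bijection from the sphere to \<open>M\<close>.\<close>

definition phi_inv :: "(complex option \<Rightarrow> 'm) \<Rightarrow> 'm \<Rightarrow> complex" where
  "phi_inv \<phi> p = the (inv_into UNIV \<phi> p)"

text \<open>The projection of \<open>\<phi>(\<zeta>)\<close>, with the conventional value \<open>0\<close> at its poles.\<close>

definition phi_proj :: "('m, 'r) covering \<Rightarrow> (complex option \<Rightarrow> 'm) \<Rightarrow> complex \<Rightarrow> complex" where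
  "phi_proj M \<phi> \<zeta> = (case proj M (\<phi> (Some \<zeta>)) of None \<Rightarrow> 0 | Some z \<Rightarrow> z)"

text \<open>\<open>h_fun M \<phi> N F\<close> is \<open>h\<close> for \<open>F\<close> the column eigenvector, and \<open>h\<close> with a hat for \<open>F\<close> the row eigenvector.
  Points at infinity are counted with multiplicity, since the product is over the sheets.\<close>

definition h_fun ::
    "('m, 'r::finite) covering \<Rightarrow> (complex option \<Rightarrow> 'm) \<Rightarrow> nat \<Rightarrow> ('m \<Rightarrow> complex^'r) \<Rightarrow> complex \<Rightarrow> complex" where
  "h_fun M \<phi> N F \<zeta> =
     (\<Prod>j | sheet M j None \<noteq> \<phi> None. (\<zeta> - phi_inv \<phi> (sheet M j None)) ^ (N - 1)) *
     (\<Prod>p\<in>(zeros_of M F \<union> poles_of M F) - {\<phi> None}. (\<zeta> - phi_inv \<phi> p) powi (- vec_order M F p))"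

definition scalar_weight ::
    "('m, 'r::finite) covering \<Rightarrow> (complex option \<Rightarrow> 'm) \<Rightarrow> nat \<Rightarrow> ('m \<Rightarrow> complex) \<Rightarrow>
     ('m \<Rightarrow> complex^'r) \<Rightarrow> ('m \<Rightarrow> complex^'r) \<Rightarrow> complex \<Rightarrow> complex" where
  "scalar_weight M \<phi> N lam e eh \<omega> =
     lam (\<phi> (Some \<omega>)) / (h_fun M \<phi> N e \<omega> * h_fun M \<phi> N eh \<omega>) * deriv (phi_proj M \<phi>) \<omega>"

definition lifted_curve ::
    "('m, 'r::finite) covering \<Rightarrow> (complex option \<Rightarrow> 'm) \<Rightarrow> curve list \<Rightarrow> complex set" where
  "lifted_curve M \<phi> \<gamma> = {\<omega>. \<phi> (Some \<omega>) \<in> (\<Union>j. (\<lambda>w. sheet M j (Some w)) ` curve_image \<gamma>)}"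

definition has_lifted_integral ::
    "('m, 'r::finite) covering \<Rightarrow> (complex option \<Rightarrow> 'm) \<Rightarrow> curve list \<Rightarrow>
     (complex \<Rightarrow> complex) \<Rightarrow> complex \<Rightarrow> bool" where
  "has_lifted_integral M \<phi> \<gamma> G v \<longleftrightarrow>
     has_curve_integral \<gamma>
       (\<lambda>w. \<Sum>j\<in>UNIV. G (phi_inv \<phi> (sheet M j (Some w))) /
                     deriv (phi_proj M \<phi>) (phi_inv \<phi> (sheet M j (Some w)))) v"

text \<open>The functions in this space are only given off a finite set; \<open>remove_sings\<close> fills in their
  removable singularities.\<close>

definition V_space ::
    "('m, 'r::finite) covering \<Rightarrow> (complex option \<Rightarrow> 'm) \<Rightarrow> nat \<Rightarrow> ('m \<Rightarrow> complex^'r) \<Rightarrow>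
     (complex \<Rightarrow> complex) set" where
  "V_space M \<phi> N e =
     {remove_sings (\<lambda>\<zeta>. (P (phi_proj M \<phi> \<zeta>) *v e (\<phi> (Some \<zeta>))) $ 1 * h_fun M \<phi> N e \<zeta>) | P.
        P \<in> (mat_polys (N - 1) :: (complex \<Rightarrow> complex^'r^1) set)}"

definition regular_point ::
    "('m, 'r::finite) covering \<Rightarrow> (complex option \<Rightarrow> 'm) \<Rightarrow> ('m \<Rightarrow> complex^'r) \<Rightarrow> complex \<Rightarrow> bool" where
  "regular_point M \<phi> F \<zeta> \<longleftrightarrow>
     proj M (\<phi> (Some \<zeta>)) \<noteq> None \<and> \<phi> (Some \<zeta>) \<notin> zeros_of M F \<union> poles_of M F"

text \<open>\<open>G\<close> is the function obtained from the expression \<open>F\<close>, which is meaningful on \<open>D\<close>, by filling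
  in removable singularities by continuity.\<close>

definition fills_in ::
    "(complex \<times> complex) set \<Rightarrow> (complex \<Rightarrow> complex \<Rightarrow> complex) \<Rightarrow> (complex \<Rightarrow> complex \<Rightarrow> complex) \<Rightarrow> bool" where
  "fills_in D F G \<longleftrightarrow>
     closure D = UNIV \<and> continuous_on UNIV (\<lambda>(\<omega>, \<zeta>). G \<omega> \<zeta>) \<and>
     (\<forall>(\<omega>, \<zeta>)\<in>D. F \<omega> \<zeta> = G \<omega> \<zeta>)"

end

theory Submission
  imports Defs "HOL-Computational_Algebra.Polynomial_Factorial" "HOL-Computational_Algebra.Field_as_Ring"
    "HOL-Computational_Algebra.Fundamental_Theorem_Algebra"
begin

text \<open>Composed with the conformal bijection \<open>\<phi>\<close>, a meromorphic function on the surface becomes meromorphic on the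
  whole sphere, hence rational (\<open>meromorphic_fun_rational\<close>). The theorem thereby turns into a statement about
  polynomials. Write \<open>r\<close> for the number of sheets. The projection is \<open>f = A / D\<close> with \<open>A\<close>, \<open>D\<close> coprime and
  \<open>max (degree A) (degree D) = r\<close>, since generic fibres have \<open>r\<close> points. The eigenvectors are \<open>e = (g / q) u\<close> and
  \<open>eh = (gh / qh) v\<close>, where \<open>u\<close> and \<open>v\<close> are vectors of polynomials without common zeros. The products \<open>h\<close> and \<open>hh\<close>
  cancel the scalar factors and the poles of powers of \<open>f\<close>: \<open>h e\<close> is a constant times \<open>D^(N-1) u\<close>, so
  \<open>h f^l e\<close> is a constant times \<open>A^l D^(N-1-l) u\<close> for \<open>l < N\<close>. The hypothesis on the space \<open>V\<close> says that the
  entries of these vectors span the polynomials of degree less than \<open>rN\<close>. In particular the entries of \<open>u\<close> have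
  degree less than \<open>r\<close>.

  The row eigenvector inherits all this by duality (\<open>bezoutian_duality\<close>). On a generic fibre the rows \<open>eh\<close> are dual
  to the columns \<open>e\<close>, so \<open>\<Sum>i. u_i(x) v_i(y)\<close> vanishes whenever \<open>x\<close> and \<open>y\<close> are different points with
  \<open>f x = f y\<close>. A degree argument shows that it is a constant multiple of the Bezoutian
  \<open>(A(x) D(y) - A(y) D(x)) / (x - y)\<close>. As the Bezoutian is symmetric, \<open>v\<close> spans the same polynomials as \<open>u\<close>. On the
  diagonal it equals \<open>f' D^2\<close>, and therefore the scalar weight is a constant times \<open>\<lambda> / D^(2N)\<close>
  (\<open>weight_eq\<close>). This gives the decay of the scalar weight at infinity that the scalar kernel requires.

  Since \<open>W\<close> is the sum over the sheets of \<open>e \<lambda> eh\<close>, summing \<open>p w p' / f'\<close> over a fibre, for polynomials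
  \<open>p = h P(f) e\<close> and \<open>p' = hh eh P'(f)\<close>, gives \<open>P W P'\<close>. So the scalar pairing of polynomials of degree less than
  \<open>rN\<close> is the matrix pairing (\<open>lifted_integral_iff\<close>). The finitely many exceptional points do not influence the
  integrals, even if the curves pass through them (\<open>has_curve_integral_cong_off_finite\<close>).
  The matrix kernel pulls back to a scalar polynomial of degree less than \<open>rN\<close> in each variable, and a reproducing
  property on one side pulls back with it. For a scalar kernel such a property says that its coefficient
  matrix inverts the Hankel matrix of moments. The inverse of a symmetric matrix is two-sided and symmetric, so the
  kernel reproduces from both sides and is the scalar Christoffel--Darboux kernel. Carried back to the matrices, this shows
  that the matrix kernel reproduces from both sides as well, whichever side was assumed.

  With both reproducing properties, each of the two Christoffel--Darboux formulas results from evaluating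
  the integral of \<open>s R(w,s) W(s) R(s,z)\<close> over \<open>s\<close> in two ways: the factor \<open>s R(w,s)\<close> is \<open>QR(w) PL(s)\<close> plus a polynomial of
  degree less than \<open>N\<close> in \<open>s\<close>, and \<open>s R(s,z)\<close> is \<open>PR(s) QL(z)\<close> plus such a polynomial.\<close>

(* The dollar sign denotes vector components only, not coefficients of power series. *)
no_notation fps_nth (infixl "$" 75)
hide_const (open) Coset.order UnivPoly.monom module.smult up_ring.coeff

section \<open>Rational functions on the sphere\<close>

text \<open>The first conjunct is essential: \<open>zorder\<close> is unspecified for a function that vanishes
  identically near the point.\<close>

lemma is_pole_iff_zorder_neg:
  assumes "f meromorphic_on {z}"
  shows "is_pole f z \<longleftrightarrow> (\<exists>\<^sub>F w in at z. f w \<noteq> 0) \<and> zorder f z < 0"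
proof
  assume p: "is_pole f z"
  have "\<forall>\<^sub>F w in at z. f w \<noteq> 0" using p by (simp add: non_zero_neighbour_pole)
  then show "(\<exists>\<^sub>F w in at z. f w \<noteq> 0) \<and> zorder f z < 0"
    using p assms by (auto simp: meromorphic_at_iff intro!: isolated_pole_imp_neg_zorder eventually_frequently)
next
  assume a: "(\<exists>\<^sub>F w in at z. f w \<noteq> 0) \<and> zorder f z < 0"
  then have "\<forall>\<^sub>F w in at z. f w \<noteq> 0"
    using assms by (simp add: meromorphic_at_iff non_zero_neighbour)
  then show "is_pole f z" using a assms zorder_neg_imp_is_pole by blast
qed

lemma zorder_poly:
  assumes "p \<noteq> (0 :: complex poly)"
  shows "zorder (poly p) a = int (order a p)"
proof -
  obtain q where q: "p = [:- a, 1:] ^ order a p * q" and nd: "\<not> [:- a, 1:] dvd q"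
    using order_decomp[OF assms] by blast
  show ?thesis
  proof (rule zorder_eqI[where S = UNIV and g = "poly q"])
    show "poly q a \<noteq> 0" using nd by (simp add: poly_eq_0_iff_dvd)
    show "poly p w = poly q w * (w - a) powi int (order a p)" for w
      by (subst q) (simp add: algebra_simps power_int_def)
  qed (auto intro!: holomorphic_intros)
qed

lemma poly_frequently_nz:
  assumes "p \<noteq> (0 :: complex poly)"
  shows "\<forall>\<^sub>F w in at a. poly p w \<noteq> 0"
proof -
  have "finite {w. poly p w = 0}" using assms by (simp add: poly_roots_finite)
  from islimpt_finite[OF this, of a] show ?thesis
    by (simp add: islimpt_iff_eventually)
qed

lemma analytic_poly: "poly p analytic_on A" for p :: "complex poly"
  by (rule analytic_on_subset[of _ UNIV]) (auto simp: analytic_on_open intro!: holomorphic_intros)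

lemma meromorphic_poly: "poly p meromorphic_on A" for p :: "complex poly"
  by (rule analytic_on_imp_meromorphic_on[OF analytic_poly])

lemma zorder_rational:
  assumes "p \<noteq> (0 :: complex poly)" "q \<noteq> 0"
  shows "zorder (\<lambda>z. poly p z / poly q z) a = int (order a p) - int (order a q)"
  using assms
  by (subst zorder_divide) (auto simp: zorder_poly intro!: meromorphic_poly eventually_frequently poly_frequently_nz)

text \<open>By Liouville's theorem, a finite limit at infinity makes \<open>f\<close> constant, and a pole
  there makes it a polynomial.\<close>

lemma entire_meromorphic_at_infinity_imp_poly:
  assumes "f holomorphic_on UNIV" and "not_essential (\<lambda>t. f (inverse t)) 0"
  obtains p where "f = poly p"
proof -
  have lim: "(f \<longlongrightarrow> l) at_infinity" if "(\<lambda>t. f (inverse t)) \<midarrow>0\<rightarrow> l" for l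
    using that by (simp add: lim_at_infinity_0 o_def)
  consider l where "(\<lambda>t. f (inverse t)) \<midarrow>0\<rightarrow> l" | "is_pole (\<lambda>t. f (inverse t)) 0"
    using assms(2) by (auto simp: not_essential_def)
  then show thesis
  proof cases
    case 1
    have "f z = l" for z using Liouville_weak[OF assms(1) lim[OF 1]] by blast
    then have "f = poly [:l:]" by auto
    then show thesis by (rule that)
  next
    case 2
    then have "(\<lambda>t. inverse (f (inverse t))) \<midarrow>0\<rightarrow> 0"
      by (metis is_pole_def tendsto_inverse_0 filterlim_compose)
    then have "((inverse \<circ> f) \<longlongrightarrow> 0) at_infinity"
      by (simp add: lim_at_infinity_0 o_def)
    from pole_at_infinity[OF assms(1) this] obtain a n where *: "\<And>z. f z = (\<Sum>i\<le>n. a i * z^i)"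
      by blast
    have "f = poly (\<Sum>i\<le>n. monom (a i) i)"
      by (auto simp: * poly_sum poly_monom)
    then show thesis by (rule that)
  qed
qed

text \<open>The poles do not accumulate at infinity, so there are finitely many of them. A polynomial
  that cancels them turns \<open>G\<close> into an entire function that is at worst meromorphic at infinity. The values outside
  the zeros of the reduced denominator are correct everywhere, not only generically, because the function is nicely meromorphic.\<close>

lemma meromorphic_on_sphere_imp_rational:
  assumes G: "G nicely_meromorphic_on UNIV"
    and inf: "(\<lambda>t. G (inverse t)) meromorphic_on {0}"
  shows "\<exists>p q. q \<noteq> 0 \<and> coprime p q \<and> (\<forall>z. poly q z \<noteq> 0 \<longrightarrow> G z = poly p z / poly q z) \<and>
    (\<forall>z. poly q z = 0 \<longrightarrow> is_pole G z)"
proof -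
  have mero: "G meromorphic_on A" for A
    using G by (meson nicely_meromorphic_on_def meromorphic_on_subset subset_UNIV)
  define P where "P = {z. is_pole G z}"
  have "isolated_singularity_at (\<lambda>t. G (inverse t)) 0"
    using inf by (simp add: meromorphic_at_iff)
  then obtain r where r: "r > 0" "(\<lambda>t. G (inverse t)) analytic_on ball 0 r - {0}"
    by (auto simp: isolated_singularity_at_def)
  \<comment> \<open>Near infinity, but not at infinity itself, \<open>G\<close> is analytic, so the poles form a bounded set.\<close>
  have bdd: "P \<subseteq> cball 0 (2 / r)"
  proof
    fix z assume z: "z \<in> P"
    show "z \<in> cball 0 (2 / r)"
    proof (rule ccontr)
      assume "z \<notin> cball 0 (2 / r)"
      then have nz: "norm z > 2 / r" by auto
      then have z0: "z \<noteq> 0" and "inverse z \<in> ball 0 r - {0}"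
        using r(1) nz by (auto simp: norm_divide divide_simps inverse_eq_divide) (simp_all add: mult.commute)
      then have "(\<lambda>t. G (inverse t)) analytic_on {inverse z}" using r(2) by (meson analytic_on_subset empty_subsetI insert_subset)
      then have "((\<lambda>t. G (inverse t)) \<circ> inverse) analytic_on {z}"
        by (intro analytic_on_compose_gen[where T = "{inverse z}"] analytic_intros) (use z0 in auto)
      then have "G analytic_on {z}" by (simp add: o_def)
      then show False using z by (auto simp: P_def dest: analytic_at_imp_no_pole)
    qed
  qed
  have "P sparse_in (cball 0 (2/r))"
    using meromorphic_on_imp_not_pole_cosparse[OF mero] by (simp add: eventually_cosparse P_def)
  then have "finite (cball 0 (2/r) \<inter> P)"
    by (rule sparse_in_compact_finite) auto
  then have finP: "finite P" using bdd by (simp add: Int_absorb1)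
  define q where "q = (\<Prod>a\<in>P. [:-a, 1:] ^ nat (- zorder G a))"
  have q0: "q \<noteq> 0" using finP by (auto simp: q_def)
  define E where "E = remove_sings (\<lambda>z. G z * poly q z)"
  have nopole: "\<not> is_pole (\<lambda>z. G z * poly q z) z" for z
  proof
    assume a: "is_pole (\<lambda>z. G z * poly q z) z"
    have m: "(\<lambda>z. G z * poly q z) meromorphic_on {z}"
      by (intro meromorphic_intros mero meromorphic_poly)
    have fr: "\<exists>\<^sub>F w in at z. G w * poly q w \<noteq> 0" and neg: "zorder (\<lambda>z. G z * poly q z) z < 0"
      using a is_pole_iff_zorder_neg[OF m] by auto
    have frG: "\<exists>\<^sub>F w in at z. G w \<noteq> 0" using fr by (rule frequently_elim1) auto
    have zo: "zorder (\<lambda>z. G z * poly q z) z = zorder G z + int (order z q)"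
      using zorder_mult[OF mero[of "{z}"] frG meromorphic_poly[of q "{z}"]] q0
      by (simp add: zorder_poly eventually_frequently poly_frequently_nz)
    show False
    proof (cases "z \<in> P")
      case True
      have "[:-z, 1:] ^ nat (- zorder G z) dvd q"
        unfolding q_def using finP True by (rule dvd_prodI)
      then have "nat (- zorder G z) \<le> order z q" using q0 by (simp add: order_divides)
      then show False using neg zo by simp
    next
      case False
      then have "\<not> zorder G z < 0"
        using is_pole_iff_zorder_neg[OF mero[of "{z}"]] frG by (auto simp: P_def)
      then show False using neg zo by simp
    qed
  qed
  have mEq: "(\<lambda>z. G z * poly q z) meromorphic_on UNIV"
    by (intro meromorphic_intros mero meromorphic_poly)
  have Eni: "E nicely_meromorphic_on UNIV"
    unfolding E_def by (rule remove_sings_nicely_meromorphic[OF mEq])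
  have Ean: "E analytic_on UNIV"
  proof (rule nicely_meromorphic_without_singularities[OF Eni], safe)
    fix z assume "is_pole E z"
    moreover have "isolated_singularity_at (\<lambda>z. G z * poly q z) z"
      using mEq by (rule meromorphic_on_isolated_singularity[OF meromorphic_on_subset]) auto
    ultimately show False using nopole[of z] by (simp add: E_def)
  qed
  have Eeq: "E z = G z * poly q z" if "poly q z \<noteq> 0" for z
  proof -
    have "z \<notin> P"
    proof
      assume "z \<in> P"
      then have "zorder G z < 0" 
        using is_pole_iff_zorder_neg[OF mero[of "{z}"]] by (auto simp: P_def)
      have "[:-z, 1:] ^ nat (- zorder G z) dvd q"
        unfolding q_def using finP \<open>z \<in> P\<close> by (rule dvd_prodI)
      moreover have "[:-z, 1:] dvd [:-z, 1:] ^ nat (- zorder G z)"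
        using \<open>zorder G z < 0\<close> by (intro dvd_power) auto
      ultimately have "[:-z, 1:] dvd q" using dvd_trans by blast
      then show False using that by (simp add: poly_eq_0_iff_dvd)
    qed
    then have "G analytic_on {z}" using G nicely_meromorphic_on_imp_analytic_at by (auto simp: P_def)
    then have "(\<lambda>z. G z * poly q z) analytic_on {z}" by (intro analytic_intros analytic_poly)
    then show ?thesis unfolding E_def by simp
  qed
  have evq: "\<forall>\<^sub>F t in at 0. poly q (inverse t) \<noteq> 0"
  proof -
    have "\<forall>\<^sub>F z in at_infinity. poly q z \<noteq> 0"
    proof -
      have "bounded {z. poly q z = 0}" using q0 by (simp add: finite_imp_bounded poly_roots_finite)
      then obtain B where "\<forall>z. poly q z = 0 \<longrightarrow> norm z \<le> B" by (auto simp: bounded_iff)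
      then show ?thesis unfolding eventually_at_infinity
        by (intro exI[of _ "B + 1"]) force
    qed
    then show ?thesis
      by (subst at_to_infinity) (simp add: eventually_filtermap)
  qed
  have Einf: "not_essential (\<lambda>t. E (inverse t)) 0"
  proof -
    have "(\<lambda>t. G (inverse t) * poly q (inverse t)) meromorphic_on {0}"
    proof -
      have "(\<lambda>t. poly q (inverse t)) meromorphic_on {0}"
        unfolding poly_altdef by (intro meromorphic_intros)
      then show ?thesis by (intro meromorphic_on_mult inf)
    qed
    then have "not_essential (\<lambda>t. G (inverse t) * poly q (inverse t)) 0"
      by (simp add: meromorphic_at_iff)
    moreover have ev: "\<forall>\<^sub>F t in at 0. G (inverse t) * poly q (inverse t) = E (inverse t)"
      using evq by eventually_elim (simp add: Eeq)
    ultimately show ?thesis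
      using not_essential_cong[OF ev refl] by simp
  qed
  obtain p where p: "E = poly p"
    using entire_meromorphic_at_infinity_imp_poly[OF _ Einf] Ean analytic_imp_holomorphic by blast
  define g where "g = gcd p q"
  obtain p' q' where pq: "p = g * p'" "q = g * q'" "coprime p' q'"
    using q0 unfolding g_def by (metis gcd_coprime_exists gcd_eq_0_iff mult.commute)
  have q': "q' \<noteq> 0" and g0: "g \<noteq> 0" using pq q0 by auto
  have Gq: "G z = poly p' z / poly q' z" if "poly q z \<noteq> 0" for z
    using Eeq[OF that] that by (simp add: p pq field_simps)
  have evG: "\<forall>\<^sub>F w in at z. G w = poly p' w / poly q' w" for z
    using poly_frequently_nz[OF q0, of z] by eventually_elim (simp add: Gq)
  show ?thesis
  proof (rule exI[of _ p'], rule exI[of _ q'], intro conjI q' pq(3) allI impI)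
    fix z assume z: "poly q' z \<noteq> 0"
    have lim: "(\<lambda>w. poly p' w / poly q' w) \<midarrow>z\<rightarrow> poly p' z / poly q' z"
      using z by (intro tendsto_intros)
    then have "G \<midarrow>z\<rightarrow> poly p' z / poly q' z"
      by (rule Lim_transform_eventually) (use evG[of z] in \<open>auto elim: eventually_mono\<close>)
    moreover from this have "\<not> is_pole G z"
      by (meson at_neq_bot is_pole_def not_tendsto_and_filterlim_at_infinity)
    then have "G \<midarrow>z\<rightarrow> G z" using G by (auto simp: nicely_meromorphic_on_def)
    ultimately show "G z = poly p' z / poly q' z"
      using LIM_unique by blast
  next
    fix z assume z: "poly q' z = 0"
    have "poly p' z \<noteq> 0" using pq(3) z by (metis coprime_poly_0)
    then have "p' \<noteq> 0" by auto
    have "order z p' = 0" using \<open>poly p' z \<noteq> 0\<close> by (simp add: order_root)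
    moreover have "order z q' > 0" using z q' by (simp add: order_root)
    ultimately have "zorder (\<lambda>w. poly p' w / poly q' w) z < 0"
      by (simp add: zorder_rational \<open>p' \<noteq> 0\<close> q')
    moreover have "\<exists>\<^sub>F w in at z. poly p' w / poly q' w \<noteq> 0"
      using eventually_conj[OF poly_frequently_nz[OF \<open>p' \<noteq> 0\<close>, of z] poly_frequently_nz[OF q', of z]]
      by (intro eventually_frequently) (auto elim: eventually_mono)
    moreover have "(\<lambda>w. poly p' w / poly q' w) meromorphic_on {z}"
      by (intro meromorphic_intros meromorphic_poly)
    ultimately have "is_pole (\<lambda>w. poly p' w / poly q' w) z"
      using is_pole_iff_zorder_neg by blast
    then show "is_pole G z"
      using is_pole_cong[OF evG[of z] refl] by blast
  qed
qed

section \<open>Meromorphic functions in the affine coordinate\<close>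

text \<open>The inverse of the coordinate of the sphere around infinity.\<close>

definition at_inf :: "complex \<Rightarrow> complex option" where
  "at_inf t = (if t = 0 then None else Some (inverse t))"

lemma at_inf_eq: "t \<noteq> 0 \<Longrightarrow> Some (inverse t) = at_inf t"
  by (simp add: at_inf_def)

text \<open>The affine part of the sphere serves as a global coordinate of the surface: every local notion
  has to be carried from the charts of \<open>S\<close> to this coordinate.\<close>

locale uniformized_surface =
  fixes S :: "('m, 'x) surface_scheme" and \<phi> :: "complex option \<Rightarrow> 'm"
  assumes surface: "riemann_surface S" and conformal: "conformal_bijection riemann_sphere S \<phi>"
begin

lemma bij_phi: "bij_betw \<phi> UNIV (topspace (space S))"
proof -
  have "topspace (space riemann_sphere) = UNIV"
    by (auto simp: riemann_sphere_def) (metis option.exhaust rangeI)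
  then show ?thesis using conformal by (simp add: conformal_bijection_def)
qed

lemma phi_in [simp]: "\<phi> x \<in> topspace (space S)"
  using bij_phi by (auto simp: bij_betw_def)

lemma phi_eq_iff [simp]: "\<phi> x = \<phi> y \<longleftrightarrow> x = y"
  using bij_phi by (auto simp: bij_betw_def inj_def)

lemma phi_surj: "p \<in> topspace (space S) \<Longrightarrow> \<exists>x. p = \<phi> x"
  using bij_phi by (auto simp: bij_betw_def)

lemma inv_phi [simp]: "phi_inv \<phi> (\<phi> (Some a)) = a"
proof -
  have "inj \<phi>" by (auto intro: injI)
  then show ?thesis by (simp add: phi_inv_def)
qed

lemma continuous_phi: "continuous_map (Alexandroff_compactification euclidean) (space S) \<phi>"
  using conformal by (simp add: conformal_bijection_def holomorphic_map_def riemann_sphere_def)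

lemma open_affine_preimage:
  assumes "openin (space S) U"
  shows "open {\<zeta>. \<phi> (Some \<zeta>) \<in> U}"
proof -
  have "continuous_map euclidean (space S) (\<phi> \<circ> Some)"
    using continuous_map_compose[OF continuous_map_Some continuous_phi] .
  from openin_continuous_map_preimage[OF this assms] show ?thesis by simp
qed

lemma nhd_infinity_preimage:
  assumes "openin (space S) U" "\<phi> None \<in> U"
  obtains \<epsilon> where "\<epsilon> > 0" "\<And>t. t \<in> ball 0 \<epsilon> \<Longrightarrow> \<phi> (at_inf t) \<in> U"
proof -
  define V where "V = {x. \<phi> x \<in> U}"
  have top: "topspace (Alexandroff_compactification (euclidean :: complex topology)) = UNIV"
    by auto (metis option.exhaust rangeI)
  have "openin (Alexandroff_compactification euclidean) V"
    using openin_continuous_map_preimage[OF continuous_phi assms(1)] unfolding top V_def by simp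
  moreover have "None \<in> V" using assms(2) by (simp add: V_def)
  ultimately obtain C :: "complex set" where C: "compact C" "V = insert None (Some ` (UNIV - C))"
    unfolding openin_Alexandroff_compactification by auto
  obtain B where B: "B > 0" "\<And>x. x \<in> C \<Longrightarrow> norm x < B"
    using compact_imp_bounded[OF C(1)] bounded_pos_less by blast
  show thesis
  proof (rule that[of "1 / B"])
    show "1 / B > 0" using B by simp
    fix t :: complex assume t: "t \<in> ball 0 (1 / B)"
    have "inverse t \<notin> C" if "t \<noteq> 0"
    proof
      assume "inverse t \<in> C"
      then have "norm (inverse t) < B" by (rule B)
      moreover have "norm t * B < 1" using t B(1) by (simp add: field_simps)
      moreover have "norm (inverse t) * norm t = 1" using that by (simp add: norm_inverse)
      ultimately show False
        using that by (metis less_asym mult.commute mult_strict_left_mono zero_less_norm_iff)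
    qed
    then have "at_inf t \<in> V" unfolding C(2) at_inf_def by auto
    then show "\<phi> (at_inf t) \<in> U" by (simp add: V_def)
  qed
qed

lemma chart_props:
  assumes "(U, c) \<in> atlas S"
  shows "openin (space S) U" "open (c ` U)" "inj_on c U"
proof -
  have *: "openin (space S) U \<and> open (c ` U) \<and>
        homeomorphic_map (subtopology (space S) U) (top_of_set (c ` U)) c"
    using surface assms by (auto simp: riemann_surface_def)
  then show "openin (space S) U" "open (c ` U)" by auto
  have "inj_on c (topspace (subtopology (space S) U))"
    using * by (metis homeomorphic_imp_injective_map)
  moreover have "topspace (space S) \<inter> U = U"
    using openin_subset[of "space S" U] * by blast
  ultimately show "inj_on c U" by simp
qed

lemma coord_affine_holomorphic:
  assumes "(U, c) \<in> atlas S"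
  shows "(\<lambda>\<zeta>. c (\<phi> (Some \<zeta>))) holomorphic_on {\<zeta>. \<phi> (Some \<zeta>) \<in> U}"
proof -
  have inv: "inv_into (- {None}) the z = Some z" for z :: complex
  proof (rule inv_into_f_eq)
    show "inj_on the (- {None})" by (auto simp: inj_on_def)
  qed auto
  have "\<forall>(V, d)\<in>atlas riemann_sphere. (c \<circ> \<phi> \<circ> inv_into V d) holomorphic_on d ` (V \<inter> \<phi> -` U)"
    using conformal assms unfolding conformal_bijection_def holomorphic_map_def by blast
  then have "(c \<circ> \<phi> \<circ> inv_into (- {None}) the) holomorphic_on the ` ((- {None}) \<inter> \<phi> -` U)"
    by (auto simp: riemann_sphere_def)
  moreover have "the ` ((- {None}) \<inter> \<phi> -` U) = {\<zeta>. \<phi> (Some \<zeta>) \<in> U}"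
    by (auto simp: image_iff) force
  ultimately show ?thesis by (simp add: o_def inv)
qed

lemma coord_infinity_holomorphic:
  assumes "(U, c) \<in> atlas S"
  shows "(\<lambda>t. c (\<phi> (at_inf t))) holomorphic_on {t. \<phi> (at_inf t) \<in> U}"
proof -
  let ?d = "case_option 0 inverse :: complex option \<Rightarrow> complex"
  have d_at_inf: "?d (at_inf t) = t" "at_inf t \<in> - {Some 0}" for t
    by (auto simp: at_inf_def)
  have inj: "inj_on ?d (- {Some 0})"
    by (auto simp: inj_on_def split: option.splits)
  have inv: "inv_into (- {Some 0}) ?d t = at_inf t" for t
    by (rule inv_into_f_eq[OF inj d_at_inf(2) d_at_inf(1)])
  have "\<forall>(V, d)\<in>atlas riemann_sphere. (c \<circ> \<phi> \<circ> inv_into V d) holomorphic_on d ` (V \<inter> \<phi> -` U)"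
    using conformal assms unfolding conformal_bijection_def holomorphic_map_def by blast
  then have "(c \<circ> \<phi> \<circ> inv_into (- {Some 0}) ?d) holomorphic_on ?d ` ((- {Some 0}) \<inter> \<phi> -` U)"
    by (auto simp: riemann_sphere_def)
  moreover have "{t. \<phi> (at_inf t) \<in> U} \<subseteq> ?d ` ((- {Some 0}) \<inter> \<phi> -` U)"
  proof
    fix t assume "t \<in> {t. \<phi> (at_inf t) \<in> U}"
    then show "t \<in> ?d ` ((- {Some 0}) \<inter> \<phi> -` U)"
      using d_at_inf[of t] by (intro image_eqI[where x = "at_inf t"]) auto
  qed
  ultimately have "(c \<circ> \<phi> \<circ> inv_into (- {Some 0}) ?d) holomorphic_on {t. \<phi> (at_inf t) \<in> U}"
    by (rule holomorphic_on_subset)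
  then show ?thesis by (simp add: o_def inv)
qed

lemma chart_exists:
  assumes "p \<in> topspace (space S)"
  obtains U c where "(U, c) \<in> atlas S" "p \<in> U" "chart_at S p = (U, c)"
proof -
  have "(\<Union>(U, c)\<in>atlas S. U) = topspace (space S)"
    using surface unfolding riemann_surface_def by (elim conjE)
  then obtain C where "C \<in> atlas S \<and> p \<in> fst C"
    using assms by (metis (mono_tags, lifting) UN_E case_prod_beta)
  then have "chart_at S p \<in> atlas S \<and> p \<in> fst (chart_at S p)"
    unfolding chart_at_def by (rule someI)
  then show thesis by (intro that[of "fst (chart_at S p)" "snd (chart_at S p)"]) auto
qed

text \<open>A chart read in the affine coordinate is injective and holomorphic, so its derivative does not vanish.
  Composition with it therefore preserves orders and poles.\<close>

lemma coord_affine_local_injection: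
  assumes "(U, c) \<in> atlas S" "\<phi> (Some a) \<in> U"
  defines "\<psi> \<equiv> \<lambda>\<zeta>. c (\<phi> (Some \<zeta>))"
  shows "\<psi> analytic_on {a}" "\<forall>\<^sub>F \<zeta> in nhds a. \<phi> (Some \<zeta>) \<in> U" "\<forall>\<^sub>F \<zeta> in at a. \<psi> \<zeta> \<noteq> \<psi> a"
    "zorder (\<lambda>\<zeta>. \<psi> \<zeta> - \<psi> a) a = 1"
proof -
  define O' where "O' = {\<zeta>. \<phi> (Some \<zeta>) \<in> U}"
  have op: "open O'" unfolding O'_def by (rule open_affine_preimage[OF chart_props(1)[OF assms(1)]])
  have a: "a \<in> O'" using assms by (simp add: O'_def)
  have hol: "\<psi> holomorphic_on O'"
    unfolding \<psi>_def O'_def by (rule coord_affine_holomorphic[OF assms(1)])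
  show an: "\<psi> analytic_on {a}" using hol op a analytic_on_open by (meson analytic_on_subset empty_subsetI insert_subset)
  show "\<forall>\<^sub>F \<zeta> in nhds a. \<phi> (Some \<zeta>) \<in> U"
    using eventually_nhds_in_open[OF op a] by (simp add: O'_def)
  have inj: "inj_on \<psi> O'"
  proof (rule inj_onI)
    fix x y assume "x \<in> O'" "y \<in> O'" "\<psi> x = \<psi> y"
    then have "\<phi> (Some x) = \<phi> (Some y)"
      using chart_props(3)[OF assms(1)] by (auto simp: O'_def \<psi>_def dest: inj_onD)
    then show "x = y" by simp
  qed
  have "\<forall>\<^sub>F \<zeta> in at a. \<zeta> \<in> O' - {a}" using eventually_at_in_open[OF op a] .
  then show "\<forall>\<^sub>F \<zeta> in at a. \<psi> \<zeta> \<noteq> \<psi> a"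
    by eventually_elim (use inj a in \<open>auto dest: inj_onD\<close>)
  have "deriv \<psi> a \<noteq> 0" by (rule holomorphic_injective_imp_regular[OF hol op inj a])
  then have "deriv (\<lambda>\<zeta>. \<psi> \<zeta> - \<psi> a) a \<noteq> 0"
    using an by (subst deriv_diff) (auto simp: analytic_on_imp_differentiable_at)
  then show "zorder (\<lambda>\<zeta>. \<psi> \<zeta> - \<psi> a) a = 1"
    by (intro zorder_zero_eqI'[where n = 1, simplified]) (auto intro!: analytic_intros an)
qed

text \<open>Besides meromorphy, the convention that the value at a pole is \<open>0\<close> has to survive the change of coordinate.\<close>

lemma meromorphic_affine:
  assumes "meromorphic_fun S F"
  shows "(\<lambda>\<zeta>. F (\<phi> (Some \<zeta>))) nicely_meromorphic_on UNIV"
proof -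
  have *: "(\<lambda>\<zeta>. F (\<phi> (Some \<zeta>))) nicely_meromorphic_on {a}" for a
  proof -
    obtain U c where U: "(U, c) \<in> atlas S" "\<phi> (Some a) \<in> U" and "chart_at S (\<phi> (Some a)) = (U, c)"
      by (rule chart_exists[OF phi_in[of "Some a"]])
    define \<psi> where "\<psi> = (\<lambda>\<zeta>. c (\<phi> (Some \<zeta>)))"
    have \<psi>: "\<psi> analytic_on {a}" "\<forall>\<^sub>F \<zeta> in nhds a. \<phi> (Some \<zeta>) \<in> U" "\<forall>\<^sub>F \<zeta> in at a. \<psi> \<zeta> \<noteq> \<psi> a"
    "zorder (\<lambda>\<zeta>. \<psi> \<zeta> - \<psi> a) a = 1"
    using coord_affine_local_injection[OF U] unfolding \<psi>_def by blast+
    define G where "G = F \<circ> inv_into U c"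
    have G: "G nicely_meromorphic_on c ` U" using assms U(1) by (auto simp: meromorphic_fun_def G_def)
    have inU: "\<psi> a \<in> c ` U" using U by (auto simp: \<psi>_def)
    have ev: "\<forall>\<^sub>F \<zeta> in nhds a. G (\<psi> \<zeta>) = F (\<phi> (Some \<zeta>))"
      using \<psi>(2) by eventually_elim (use chart_props(3)[OF U(1)] in \<open>simp add: G_def \<psi>_def\<close>)
    then have ev': "\<forall>\<^sub>F \<zeta> in at a. G (\<psi> \<zeta>) = F (\<phi> (Some \<zeta>))" and eqa: "G (\<psi> a) = F (\<phi> (Some a))"
      by (auto simp: eventually_nhds_conv_at)
    have lim: "\<psi> \<midarrow>a\<rightarrow> \<psi> a" using \<psi>(1) analytic_at_imp_isCont isContD by blast
    have "(\<lambda>\<zeta>. G (\<psi> \<zeta>)) meromorphic_on {a}"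
      by (rule meromorphic_on_compose[of G "c ` U"]) (use G \<psi>(1) inU in \<open>auto simp: nicely_meromorphic_on_def\<close>)
    moreover have "(is_pole (\<lambda>\<zeta>. G (\<psi> \<zeta>)) a \<and> G (\<psi> a) = 0) \<or> (\<lambda>\<zeta>. G (\<psi> \<zeta>)) \<midarrow>a\<rightarrow> G (\<psi> a)"
    proof -
      consider "is_pole G (\<psi> a)" "G (\<psi> a) = 0" | "G \<midarrow>\<psi> a\<rightarrow> G (\<psi> a)"
        using G inU by (auto simp: nicely_meromorphic_on_def)
      then show ?thesis
      proof cases
        case 1
        then show ?thesis using is_pole_compose[OF 1(1) lim \<psi>(3)] by auto
      next
        case 2
        then have "isCont G (\<psi> a)" by (simp add: isCont_def)
        then show ?thesis using isCont_tendsto_compose[OF _ lim] by blast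
      qed
    qed
    ultimately have "(\<lambda>\<zeta>. G (\<psi> \<zeta>)) nicely_meromorphic_on {a}"
      by (simp add: nicely_meromorphic_on_def)
    then show ?thesis
      unfolding nicely_meromorphic_on_def
      using meromorphic_on_cong[of "{a}" "\<lambda>\<zeta>. G (\<psi> \<zeta>)" "\<lambda>\<zeta>. F (\<phi> (Some \<zeta>))" "{a}"] ev' eqa
        is_pole_cong[OF ev' refl] tendsto_cong[OF ev'] by simp
  qed
  have "(\<lambda>\<zeta>. F (\<phi> (Some \<zeta>))) meromorphic_on UNIV"
    by (rule iffD2[OF meromorphic_on_meromorphic_at]) (use * in \<open>simp add: nicely_meromorphic_on_def\<close>)
  then show ?thesis
    using * by (simp add: nicely_meromorphic_on_def)
qed

lemma meromorphic_infinity: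
  assumes "meromorphic_fun S F"
  shows "(\<lambda>t. F (\<phi> (Some (inverse t)))) meromorphic_on {0}"
proof -
  obtain U c where U: "(U, c) \<in> atlas S" "\<phi> None \<in> U" "chart_at S (\<phi> None) = (U, c)"
    by (rule chart_exists[OF phi_in[of None]])
  obtain \<epsilon> where \<epsilon>: "\<epsilon> > 0" "\<And>t. t \<in> ball 0 \<epsilon> \<Longrightarrow> \<phi> (at_inf t) \<in> U"
    using nhd_infinity_preimage[OF chart_props(1)[OF U(1)] U(2)] by blast
  define \<psi> where "\<psi> = (\<lambda>t. c (\<phi> (at_inf t)))"
  have "\<psi> holomorphic_on ball 0 \<epsilon>"
    unfolding \<psi>_def by (rule holomorphic_on_subset[OF coord_infinity_holomorphic[OF U(1)]]) (use \<epsilon> in auto)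
  then have an: "\<psi> analytic_on {0}"
    using \<epsilon>(1) by (auto simp: analytic_at intro!: exI[of _ "ball 0 \<epsilon>"])
  define G where "G = F \<circ> inv_into U c"
  have G: "G meromorphic_on c ` U"
    using assms U(1) by (auto simp: meromorphic_fun_def G_def nicely_meromorphic_on_def)
  have "(\<lambda>t. G (\<psi> t)) meromorphic_on {0}"
    by (rule meromorphic_on_compose[OF G an]) (use U in \<open>auto simp: \<psi>_def at_inf_def\<close>)
  moreover have "\<forall>\<^sub>F t in at 0. G (\<psi> t) = F (\<phi> (Some (inverse t)))"
    unfolding eventually_at
    by (rule exI[of _ \<epsilon>])
       (use \<epsilon> chart_props(3)[OF U(1)] in \<open>auto simp: G_def \<psi>_def at_inf_eq\<close>)
  ultimately show ?thesis
    using meromorphic_on_cong[of "{0}" "\<lambda>t. G (\<psi> t)" "\<lambda>t. F (\<phi> (Some (inverse t)))" "{0}"] by simp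
qed

lemma meromorphic_fun_rational:
  assumes "meromorphic_fun S F"
  shows "\<exists>p q. q \<noteq> 0 \<and> coprime p q \<and>
    (\<forall>z. poly q z \<noteq> 0 \<longrightarrow> F (\<phi> (Some z)) = poly p z / poly q z) \<and>
    (\<forall>z. poly q z = 0 \<longrightarrow> is_pole (\<lambda>\<zeta>. F (\<phi> (Some \<zeta>))) z)"
  by (rule meromorphic_on_sphere_imp_rational[OF meromorphic_affine[OF assms] meromorphic_infinity[OF assms]])

text \<open>Orders and poles are defined in a chart of the surface; this makes them computable from the rational functions
  in the affine coordinate.\<close>

lemma local_order_affine:
  fixes a :: complex
  assumes "meromorphic_fun S F"
  defines "f \<equiv> local_rep S (\<phi> (Some a)) F" and "b \<equiv> coord S (\<phi> (Some a)) (\<phi> (Some a))"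
    and "g \<equiv> (\<lambda>\<zeta>. F (\<phi> (Some \<zeta>)))"
  shows "f meromorphic_on {b}"
    "(\<forall>\<^sub>F t in at b. f t = 0) \<longleftrightarrow> (\<forall>\<^sub>F \<zeta> in at a. g \<zeta> = 0)"
    "\<exists>\<^sub>F \<zeta> in at a. g \<zeta> \<noteq> 0 \<Longrightarrow> zorder f b = zorder g a"
    "is_pole f b \<longleftrightarrow> is_pole g a"
proof -
  obtain U c where U: "(U, c) \<in> atlas S" "\<phi> (Some a) \<in> U" and ch: "chart_at S (\<phi> (Some a)) = (U, c)"
    by (rule chart_exists[OF phi_in[of "Some a"]])
  define \<psi> where "\<psi> = (\<lambda>\<zeta>. c (\<phi> (Some \<zeta>)))"
  have \<psi>: "\<psi> analytic_on {a}" "\<forall>\<^sub>F \<zeta> in nhds a. \<phi> (Some \<zeta>) \<in> U" "\<forall>\<^sub>F \<zeta> in at a. \<psi> \<zeta> \<noteq> \<psi> a"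
    "zorder (\<lambda>\<zeta>. \<psi> \<zeta> - \<psi> a) a = 1"
    using coord_affine_local_injection[OF U] unfolding \<psi>_def by blast+
  have f: "f = F \<circ> inv_into U c" and b: "b = \<psi> a"
    by (simp_all add: f_def b_def local_rep_def coord_def ch \<psi>_def)
  have "f nicely_meromorphic_on c ` U" using assms(1) U(1) by (auto simp: meromorphic_fun_def f)
  then show m: "f meromorphic_on {b}"
    using U by (auto simp: nicely_meromorphic_on_def b \<psi>_def intro: meromorphic_on_subset)
  have mg: "g meromorphic_on {a}"
    using meromorphic_affine[OF assms(1)] unfolding g_def nicely_meromorphic_on_def
    by (meson meromorphic_on_subset subset_UNIV)
  have ev: "\<forall>\<^sub>F \<zeta> in at a. (f \<circ> \<psi>) \<zeta> = g \<zeta>"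
  proof -
    have "\<forall>\<^sub>F \<zeta> in nhds a. (f \<circ> \<psi>) \<zeta> = g \<zeta>"
      using \<psi>(2) by eventually_elim (use chart_props(3)[OF U(1)] in \<open>simp add: f g_def \<psi>_def\<close>)
    then show ?thesis by (simp add: eventually_nhds_conv_at)
  qed
  have lim: "filterlim \<psi> (at b) (at a)"
  proof -
    have "\<psi> \<midarrow>a\<rightarrow> \<psi> a" using \<psi>(1) analytic_at_imp_isCont isContD by blast
    then show ?thesis using \<psi>(3) unfolding b by (simp add: filterlim_at)
  qed
  have z1: "\<forall>\<^sub>F \<zeta> in at a. g \<zeta> = 0" if "\<forall>\<^sub>F t in at b. f t = 0"
    using eventually_compose_filterlim[OF that lim] ev by eventually_elim auto
  have nz: "\<forall>\<^sub>F \<zeta> in at a. g \<zeta> \<noteq> 0" if "\<forall>\<^sub>F t in at b. f t \<noteq> 0"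
    using eventually_compose_filterlim[OF that lim] ev by eventually_elim auto
  have dich: "(\<forall>\<^sub>F t in at b. f t = 0) \<or> (\<forall>\<^sub>F t in at b. f t \<noteq> 0)"
    using m non_zero_neighbour[of f b] by (auto simp: meromorphic_at_iff frequently_def)
  show iff: "(\<forall>\<^sub>F t in at b. f t = 0) \<longleftrightarrow> (\<forall>\<^sub>F \<zeta> in at a. g \<zeta> = 0)"
  proof
    assume g0: "\<forall>\<^sub>F \<zeta> in at a. g \<zeta> = 0"
    show "\<forall>\<^sub>F t in at b. f t = 0"
    proof (rule ccontr)
      assume "\<not> (\<forall>\<^sub>F t in at b. f t = 0)"
      then have "\<forall>\<^sub>F \<zeta> in at a. False"
        using dich eventually_conj[OF g0 nz] by (auto elim: eventually_mono)
      then show False by simp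
    qed
  qed (rule z1)
  show zo: "zorder f b = zorder g a" if fr: "\<exists>\<^sub>F \<zeta> in at a. g \<zeta> \<noteq> 0"
  proof -
    have nzf: "\<forall>\<^sub>F t in at b. f t \<noteq> 0" using dich iff fr by (auto simp: frequently_def)
    have "zorder (f \<circ> \<psi>) a = zorder f (\<psi> a) * zorder (\<lambda>x. \<psi> x - \<psi> a) a"
      using m \<psi> nzf unfolding b meromorphic_at_iff by (intro zorder_compose') auto
    then show ?thesis using \<psi>(4) zorder_cong[OF ev refl] by (simp add: b)
  qed
  show "is_pole f b \<longleftrightarrow> is_pole g a"
    unfolding is_pole_iff_zorder_neg[OF m] is_pole_iff_zorder_neg[OF mg]
    using iff zo by (auto simp: frequently_def)
qed

end

section \<open>The covering map as a rational function\<close>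

lemma nicely_meromorphic_on_nhds_cong:
  assumes "\<forall>\<^sub>F w in nhds z. f w = g w"
  shows "f nicely_meromorphic_on {z} \<longleftrightarrow> g nicely_meromorphic_on {z}"
proof -
  have ev: "\<forall>\<^sub>F w in at z. f w = g w" and eq: "f z = g z"
    using assms by (auto simp: eventually_nhds_conv_at)
  show ?thesis
    unfolding nicely_meromorphic_on_def
    using meromorphic_on_cong[of "{z}" f g "{z}"] ev eq is_pole_cong[OF ev refl] tendsto_cong[OF ev] by simp
qed

lemma nicely_meromorphic_on_pointwise:
  "f nicely_meromorphic_on A \<longleftrightarrow> (\<forall>z\<in>A. f nicely_meromorphic_on {z})"
  unfolding nicely_meromorphic_on_def
  by (subst meromorphic_on_meromorphic_at[of f A]) (simp add: ball_conj_distrib)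

lemma degree_eq_card_roots:
  assumes "\<And>x. poly p x = 0 \<Longrightarrow> poly (pderiv p) x \<noteq> 0" and "p \<noteq> (0 :: complex poly)"
  shows "degree p = card {x. poly p x = 0}"
proof -
  have "rsquarefree p" using assms(1) by (auto simp: rsquarefree_roots)
  from complex_poly_decompose_rsquarefree[OF this]
  have "degree p = degree (smult (lead_coeff p) (\<Prod>z|poly p z = 0. [:-z, 1:]))" by simp
  also have "\<dots> = degree (\<Prod>z|poly p z = 0. [:-z, 1:])" using assms(2) by simp
  also have "\<dots> = (\<Sum>z|poly p z = 0. degree [:-z, 1:])" by (intro degree_prod_sum_eq) auto
  also have "\<dots> = card {x. poly p x = 0}" by simp
  finally show ?thesis .
qed

lemma pderiv_dvd_imp_const:
  fixes D :: "complex poly"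
  assumes "D dvd pderiv D"
  shows "pderiv D = 0"
proof (rule ccontr)
  assume nz: "pderiv D \<noteq> 0"
  then have "degree D \<le> degree (pderiv D)" using assms dvd_imp_degree_le by blast
  then have "degree D = 0" by (simp add: degree_pderiv)
  then show False using nz by (simp add: pderiv_eq_0_iff)
qed

text \<open>The projection as a meromorphic function, with the conventional value \<open>0\<close> at the points over infinity.\<close>

definition proj_value :: "('m, 'r) covering \<Rightarrow> 'm \<Rightarrow> complex" where
  "proj_value M p = (case proj M p of None \<Rightarrow> 0 | Some z \<Rightarrow> z)"

lemma phi_proj_value: "phi_proj M \<phi> \<zeta> = proj_value M (\<phi> (Some \<zeta>))"
  by (simp add: phi_proj_def proj_value_def)

lemma coord_sphere_infinity: "coord riemann_sphere None = case_option 0 inverse"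
proof -
  have "chart_at riemann_sphere None = (- {Some 0}, case_option 0 inverse)"
    unfolding chart_at_def by (rule some_equality) (auto simp: riemann_sphere_def)
  then show ?thesis by (simp add: coord_def)
qed

locale rational_covering = uniformized_surface M \<phi>
  for M :: "('m, 'r::finite) covering" and \<phi> :: "complex option \<Rightarrow> 'm" +
  assumes covering: "branched_covering M"
begin

lemma fibre: "p \<in> topspace (space M) \<and> proj M p = z \<longleftrightarrow> p \<in> range (\<lambda>k. sheet M k z)"
proof -
  have "{p \<in> topspace (space M). proj M p = z} = range (\<lambda>k. sheet M k z)"
    using covering unfolding branched_covering_def by (elim conjE) (erule spec)
  then show ?thesis by blast
qed

lemma proj_sheet [simp]: "proj M (sheet M k z) = z" and sheet_in: "sheet M k z \<in> topspace (space M)"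
  using fibre[of "sheet M k z" z] by auto

lemma open_proj_preimage:
  assumes "(U, c) \<in> atlas M" and "openin (Alexandroff_compactification euclidean) V"
  shows "open (c ` (U \<inter> proj M -` V))"
proof -
  have cont: "continuous_map (space M) (Alexandroff_compactification euclidean) (proj M)"
    using covering by (simp add: branched_covering_def holomorphic_map_def riemann_sphere_def)
  have U: "openin (space M) U" by (rule chart_props(1)[OF assms(1)])
  have "openin (space M) {p \<in> topspace (space M). proj M p \<in> V}"
    by (rule openin_continuous_map_preimage[OF cont assms(2)])
  then have "openin (space M) (U \<inter> {p \<in> topspace (space M). proj M p \<in> V})" using U by blast
  moreover have "U \<inter> {p \<in> topspace (space M). proj M p \<in> V} = U \<inter> proj M -` V"
    using openin_subset[OF U] by auto
  ultimately have "openin (subtopology (space M) U) (U \<inter> proj M -` V)"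
    by (metis Int_lower1 U openin_open_subtopology)
  moreover have "homeomorphic_map (subtopology (space M) U) (top_of_set (c ` U)) c"
    using surface assms(1) unfolding riemann_surface_def by blast
  ultimately have "openin (top_of_set (c ` U)) (c ` (U \<inter> proj M -` V))"
    by (metis homeomorphic_imp_open_map open_map_def)
  then show ?thesis using chart_props(2)[OF assms(1)] openin_open_trans by blast
qed

lemma open_sphere_charts:
  "openin (Alexandroff_compactification (euclidean :: complex topology)) (- {None})"
  "openin (Alexandroff_compactification (euclidean :: complex topology)) (- {Some 0})"
proof -
  have "- {None} = Some ` (UNIV :: complex set)" by (auto simp: image_iff)
  then show "openin (Alexandroff_compactification (euclidean :: complex topology)) (- {None})" by simp
  have "- {Some 0} = insert None (Some ` (UNIV - {0 :: complex}))"
    by (auto simp: image_iff)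
  then show "openin (Alexandroff_compactification (euclidean :: complex topology)) (- {Some 0})"
    unfolding openin_Alexandroff_compactification by (intro disjI2 exI[of _ "{0}"]) auto
qed

text \<open>Over infinity the projection is the inverse of a holomorphic function \<open>H\<close>. It has a genuine pole there because
  \<open>H\<close> cannot vanish identically: the fibre over infinity is finite.\<close>

lemma proj_in_chart:
  assumes ch: "(U, c) \<in> atlas M" and p: "p \<in> U"
  defines "G \<equiv> proj_value M \<circ> inv_into U c" and "H \<equiv> case_option 0 inverse \<circ> proj M \<circ> inv_into U c"
  shows "proj M p \<noteq> None \<Longrightarrow> G analytic_on {c p}"
    and "proj M p = None \<Longrightarrow> H analytic_on {c p} \<and> H (c p) = 0 \<and> (\<forall>\<^sub>F t in nhds (c p). G t = inverse (H t)) \<and>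
      (\<forall>\<^sub>F t in at (c p). H t \<noteq> 0)"
proof -
  have hol: "\<forall>(V, d)\<in>atlas riemann_sphere. (d \<circ> proj M \<circ> inv_into U c) holomorphic_on c ` (U \<inter> proj M -` V)"
    using covering ch unfolding branched_covering_def holomorphic_map_def by blast
  have inv: "inv_into U c (c x) = x" if "x \<in> U" for x
    using chart_props(3)[OF ch] that by simp
  {
    assume pn: "proj M p \<noteq> None"
    let ?O = "c ` (U \<inter> proj M -` (- {None}))"
    have "(the \<circ> proj M \<circ> inv_into U c) holomorphic_on ?O"
      using hol by (auto simp: riemann_sphere_def)
    moreover have "G t = (the \<circ> proj M \<circ> inv_into U c) t" if "t \<in> ?O" for t
      using that inv by (auto simp: G_def proj_value_def split: option.splits)
    ultimately have "G holomorphic_on ?O" by (metis (no_types, lifting) holomorphic_cong)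
    moreover have "open ?O" by (rule open_proj_preimage[OF ch open_sphere_charts(1)])
    moreover have "c p \<in> ?O" using p pn by auto
    ultimately show "G analytic_on {c p}"
      by (meson analytic_at)
  }
  {
    assume pn: "proj M p = None"
    let ?O = "c ` (U \<inter> proj M -` (- {Some 0}))"
    have H: "H holomorphic_on ?O"
      using hol by (auto simp: riemann_sphere_def H_def)
    have op: "open ?O" by (rule open_proj_preimage[OF ch open_sphere_charts(2)])
    have cp: "c p \<in> ?O" using p pn by auto
    have an: "H analytic_on {c p}" using H op cp by (meson analytic_at)
    have H0: "H (c p) = 0" using inv[OF p] pn by (simp add: H_def)
    have G: "\<forall>\<^sub>F t in nhds (c p). G t = inverse (H t)"
    proof -
      have "G t = inverse (H t)" for t
        by (auto simp: G_def H_def proj_value_def split: option.splits)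
      then show ?thesis by simp
    qed
    \<comment> \<open>Otherwise \<open>H\<close> would vanish on an open set, all of whose infinitely many points would lie over infinity.\<close>
    have nz: "\<forall>\<^sub>F t in at (c p). H t \<noteq> 0"
    proof (rule ccontr)
      assume "\<not> ?thesis"
      then have "\<exists>\<^sub>F t in at (c p). H t = 0" by (simp add: frequently_def)
      then have "\<forall>\<^sub>F t in at (c p). H t = 0"
        using an by (intro not_essential_frequently_0_imp_eventually_0)
          (auto simp: isolated_singularity_at_analytic not_essential_analytic)
      then have "\<forall>\<^sub>F t in nhds (c p). H t = 0"
        using H0 by (simp add: eventually_nhds_conv_at)
      from eventually_conj[OF this eventually_nhds_in_open[OF op cp]]
      have "\<forall>\<^sub>F t in nhds (c p). H t = 0 \<and> t \<in> ?O" .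
      then obtain T where T: "open T" "c p \<in> T" "\<And>t. t \<in> T \<Longrightarrow> H t = 0 \<and> t \<in> ?O"
        unfolding eventually_nhds by blast
      have infT: "infinite T" using T(1,2) finite_imp_not_open by blast
      have "inj_on (inv_into U c) T"
      proof (rule inj_on_subset[OF inj_on_inv_into])
        show "c ` U \<subseteq> c ` U" ..
        show "T \<subseteq> c ` U" using T(3) by blast
      qed
      then have inf: "infinite (inv_into U c ` T)" using infT by (simp add: finite_image_iff)
      have "inv_into U c ` T \<subseteq> range (\<lambda>k. sheet M k None)"
      proof
        fix x assume "x \<in> inv_into U c ` T"
        then obtain t where t: "t \<in> T" "x = inv_into U c t" by auto
        then obtain y where y: "y \<in> U" "proj M y \<noteq> Some 0" "t = c y" using T(3)[OF t(1)] by auto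
        then have x: "x = y" using t inv by simp
        have "H t = 0" using T(3) t by auto
        then have "proj M y = None" using y inv by (auto simp: H_def split: option.splits)
        moreover have "y \<in> topspace (space M)" using openin_subset[OF chart_props(1)[OF ch]] y by auto
        ultimately show "x \<in> range (\<lambda>k. sheet M k None)" using fibre x by blast
      qed
      then show False using inf by (meson finite finite_imageI finite_subset)
    qed
    show "H analytic_on {c p} \<and> H (c p) = 0 \<and> (\<forall>\<^sub>F t in nhds (c p). G t = inverse (H t)) \<and>
      (\<forall>\<^sub>F t in at (c p). H t \<noteq> 0)"
      using an H0 G nz by blast
  }
qed

lemma meromorphic_proj_value: "meromorphic_fun M (proj_value M)"
  unfolding meromorphic_fun_def
proof safe
  fix U c assume ch: "(U, c) \<in> atlas M"
  let ?G = "proj_value M \<circ> inv_into U c"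
  show "?G nicely_meromorphic_on c ` U"
  proof (subst nicely_meromorphic_on_pointwise, safe)
    fix p assume p: "p \<in> U"
    show "?G nicely_meromorphic_on {c p}"
    proof (cases "proj M p")
      case (Some z)
      then show ?thesis using proj_in_chart(1)[OF ch p]
        by (auto intro!: analytic_on_imp_nicely_meromorphic_on)
    next
      case None
      note * = proj_in_chart(2)[OF ch p None]
      then have "(\<lambda>t. inverse ((case_option 0 inverse \<circ> proj M \<circ> inv_into U c) t)) nicely_meromorphic_on {c p}"
        by (intro nicely_meromorphic_on_inverse analytic_on_imp_nicely_meromorphic_on) (elim conjE)
      moreover have "\<forall>\<^sub>F t in nhds (c p). ?G t = inverse ((case_option 0 inverse \<circ> proj M \<circ> inv_into U c) t)"
        using * by (elim conjE)
      ultimately show ?thesis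
        by (simp only: nicely_meromorphic_on_nhds_cong)
    qed
  qed
qed

text \<open>The multiplicity of the covering map at a point over infinity is the order of the zero of the reciprocal of the projection,
  so the pole order of the projection counts the sheets that meet there.\<close>

lemma pole_iff_infinity: "is_pole (phi_proj M \<phi>) a \<longleftrightarrow> proj M (\<phi> (Some a)) = None"
  and pole_order_eq_sheets: "proj M (\<phi> (Some a)) = None \<Longrightarrow>
    int (card {k. sheet M k None = \<phi> (Some a)}) = - zorder (phi_proj M \<phi>) a"
proof -
  let ?p = "\<phi> (Some a)"
  have f: "phi_proj M \<phi> = (\<lambda>\<zeta>. proj_value M (\<phi> (Some \<zeta>)))" by (auto simp: phi_proj_value)
  obtain U c where U: "(U, c) \<in> atlas M" "?p \<in> U" and ch: "chart_at M ?p = (U, c)"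
    by (rule chart_exists[OF phi_in[of "Some a"]])
  define G where "G = proj_value M \<circ> inv_into U c"
  define H where "H = case_option 0 inverse \<circ> proj M \<circ> inv_into U c"
  have lr: "local_rep M ?p (proj_value M) = G" "coord M ?p ?p = c ?p" "local_rep M ?p (proj M) = proj M \<circ> inv_into U c"
    by (simp_all add: local_rep_def coord_def ch G_def)
  note loc = local_order_affine[OF meromorphic_proj_value, of a, folded f, unfolded lr]
  have A: "is_pole (phi_proj M \<phi>) a" and Z: "zorder (phi_proj M \<phi>) a = - zorder H (c ?p)"
    if pn: "proj M ?p = None"
  proof -
    have an: "H analytic_on {c ?p}" and Hc: "H (c ?p) = 0" and evG: "\<forall>\<^sub>F t in nhds (c ?p). G t = inverse (H t)"
      and nz: "\<forall>\<^sub>F t in at (c ?p). H t \<noteq> 0"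
      using proj_in_chart(2)[OF U pn] by (simp_all only: G_def H_def)
    have H0: "H \<midarrow>c ?p\<rightarrow> 0" using analytic_at_imp_isCont[OF an] Hc by (simp add: isCont_def)
    have ev: "\<forall>\<^sub>F t in at (c ?p). G t = inverse (H t)"
      using evG by (simp add: eventually_nhds_conv_at)
    have "filterlim H (at 0) (at (c ?p))"
      using H0 nz by (simp add: filterlim_at)
    then have "is_pole (\<lambda>t. inverse (H t)) (c ?p)"
      unfolding is_pole_def by (rule filterlim_compose[OF filterlim_inverse_at_infinity])
    then have "is_pole G (c ?p)" using is_pole_cong[OF ev refl] by simp
    then show pole: "is_pole (phi_proj M \<phi>) a" using loc(4) by simp
    have mH: "H meromorphic_on {c ?p}" by (rule analytic_on_imp_meromorphic_on[OF an])
    have frH: "\<exists>\<^sub>F t in at (c ?p). H t \<noteq> 0" using nz by (intro eventually_frequently) auto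
    have ev1: "\<forall>\<^sub>F t in at (c ?p). G t = 1 / H t" using ev by (simp add: inverse_eq_divide)
    have "zorder G (c ?p) = zorder (\<lambda>t. 1 / H t) (c ?p)"
      by (rule zorder_cong[OF ev1 refl])
    also have "\<dots> = - zorder H (c ?p)"
      using zorder_divide[OF meromorphic_on_const[of 1] _ mH frH] by simp
    finally have "zorder G (c ?p) = - zorder H (c ?p)" .
    moreover have "\<exists>\<^sub>F \<zeta> in at a. phi_proj M \<phi> \<zeta> \<noteq> 0"
      using pole by (intro eventually_frequently non_zero_neighbour_pole) auto
    ultimately show "zorder (phi_proj M \<phi>) a = - zorder H (c ?p)" using loc(3) by (simp add: phi_proj_value)
  qed
  show "is_pole (phi_proj M \<phi>) a \<longleftrightarrow> proj M (\<phi> (Some a)) = None"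
  proof
    assume "is_pole (phi_proj M \<phi>) a"
    then have "is_pole G (c ?p)" using loc(4) by simp
    then show "proj M ?p = None"
      using proj_in_chart(1)[OF U] analytic_at_imp_no_pole unfolding G_def by blast
  qed (rule A)
  assume pn: "proj M ?p = None"
  have "map_multiplicity M riemann_sphere (proj M) ?p = zorder H (c ?p)"
    unfolding map_multiplicity_def lr pn coord_sphere_infinity by (simp add: o_def H_def)
  moreover have "int (card {k. sheet M k (proj M ?p) = ?p}) = map_multiplicity M riemann_sphere (proj M) ?p"
    using covering phi_in[of "Some a"] unfolding branched_covering_def by blast
  ultimately show "int (card {k. sheet M k None = ?p}) = - zorder (phi_proj M \<phi>) a"
    using Z[OF pn] pn by simp
qed

text \<open>Counting pole orders by sheets identifies the normalized denominator with the base of the first product in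
  \<open>h_fun\<close>.\<close>

lemma proj_rational:
  obtains A D where "D \<noteq> 0" "coprime A D" "\<And>z. poly D z \<noteq> 0 \<Longrightarrow> phi_proj M \<phi> z = poly A z / poly D z"
    "\<And>z. poly D z = 0 \<longleftrightarrow> proj M (\<phi> (Some z)) = None"
    "\<And>z. poly D z = (\<Prod>j | sheet M j None \<noteq> \<phi> None. z - phi_inv \<phi> (sheet M j None))"
proof -
  obtain A D where D0: "D \<noteq> 0" and cop: "coprime A D"
    and f: "\<And>z. poly D z \<noteq> 0 \<Longrightarrow> proj_value M (\<phi> (Some z)) = poly A z / poly D z"
    and pole: "\<And>z. poly D z = 0 \<Longrightarrow> is_pole (\<lambda>\<zeta>. proj_value M (\<phi> (Some \<zeta>))) z"
    using meromorphic_fun_rational[OF meromorphic_proj_value] by blast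
  have feq: "phi_proj M \<phi> = (\<lambda>\<zeta>. proj_value M (\<phi> (Some \<zeta>)))" by (auto simp: phi_proj_value)
  have f': "phi_proj M \<phi> z = poly A z / poly D z" if "poly D z \<noteq> 0" for z
    using f[OF that] by (simp add: phi_proj_value)
  have ev: "\<forall>\<^sub>F z in at a. phi_proj M \<phi> z = poly A z / poly D z" for a
    using poly_frequently_nz[OF D0, of a] by eventually_elim (rule f')
  have Dz: "poly D z = 0 \<longleftrightarrow> proj M (\<phi> (Some z)) = None" for z
  proof
    assume "poly D z = 0"
    then show "proj M (\<phi> (Some z)) = None" using pole pole_iff_infinity feq by simp
  next
    assume "proj M (\<phi> (Some z)) = None"
    then have p: "is_pole (phi_proj M \<phi>) z" using pole_iff_infinity by simp
    show "poly D z = 0"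
    proof (rule ccontr)
      assume "poly D z \<noteq> 0"
      then have "(\<lambda>z. poly A z / poly D z) analytic_on {z}" by (intro analytic_intros analytic_poly) auto
      then have "\<not> is_pole (\<lambda>z. poly A z / poly D z) z" by (rule analytic_at_imp_no_pole)
      then show False using p is_pole_cong[OF ev[of z] refl] by simp
    qed
  qed
  have ord: "order a D = card {k. sheet M k None = \<phi> (Some a)}" for a
  proof (cases "poly D a = 0")
    case False
    then have "proj M (\<phi> (Some a)) \<noteq> None" using Dz by simp
    then have e: "{k. sheet M k None = \<phi> (Some a)} = {}" using proj_sheet[of _ None] by (metis (mono_tags, lifting) empty_Collect_eq)
    show ?thesis unfolding e using False by (simp add: order_root)
  next
    case True
    then have pn: "proj M (\<phi> (Some a)) = None" using Dz by simp
    have "poly A a \<noteq> 0" using cop True coprime_poly_0 by blast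
    then have "A \<noteq> 0" and oA: "order a A = 0" by (auto simp: order_root)
    have "zorder (phi_proj M \<phi>) a = zorder (\<lambda>z. poly A z / poly D z) a"
      by (rule zorder_cong[OF ev refl])
    also have "\<dots> = - int (order a D)" using \<open>A \<noteq> 0\<close> D0 oA by (simp add: zorder_rational)
    finally show ?thesis using pole_order_eq_sheets[OF pn] by simp
  qed
  define K where "K = {j. sheet M j None \<noteq> \<phi> None}"
  define g where "g = (\<lambda>j. phi_inv \<phi> (sheet M j None))"
  have sheet_g: "sheet M j None = \<phi> (Some (g j))" if jK: "j \<in> K" for j
  proof -
    obtain x where x: "sheet M j None = \<phi> x" using phi_surj[OF sheet_in] by blast
    then obtain a where "x = Some a" using jK by (cases x) (auto simp: K_def)
    then show ?thesis using x by (simp add: g_def)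
  qed
  have fin: "finite {z. poly D z = 0}" using D0 by (simp add: poly_roots_finite)
  have D: "poly D z = lead_coeff D * (\<Prod>j\<in>K. z - g j)" for z
  proof -
    have "D = smult (lead_coeff D) (\<Prod>a|poly D a = 0. [:-a, 1:] ^ order a D)"
      by (rule complex_poly_decompose[symmetric])
    then have "poly D z = lead_coeff D * (\<Prod>a|poly D a = 0. (z - a) ^ order a D)"
      by (metis (no_types, lifting) diff_conv_add_uminus add.commute mult.right_neutral mult_zero_right poly_pCons poly_0 add_0_right poly_power poly_prod poly_smult prod.cong)
    also have "(\<Prod>a|poly D a = 0. (z - a) ^ order a D) = (\<Prod>a|poly D a = 0. \<Prod>j\<in>{j\<in>K. g j = a}. z - g j)"
    proof (intro prod.cong refl)
      fix a assume "a \<in> {a. poly D a = 0}"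
      have "{j\<in>K. g j = a} = {k. sheet M k None = \<phi> (Some a)}"
        using sheet_g by (force simp: K_def g_def)
      then have "card {j\<in>K. g j = a} = order a D" using ord by simp
      moreover have "(\<Prod>j\<in>{j\<in>K. g j = a}. z - g j) = (\<Prod>j\<in>{j\<in>K. g j = a}. z - a)"
        by (rule prod.cong) auto
      ultimately show "(z - a) ^ order a D = (\<Prod>j\<in>{j\<in>K. g j = a}. z - g j)" by simp
    qed
    also have "\<dots> = (\<Prod>j\<in>K. z - g j)"
    proof (rule prod.group[OF _ fin])
      show "g ` K \<subseteq> {a. poly D a = 0}"
        using sheet_g Dz proj_sheet by (metis (mono_tags, lifting) image_subsetI mem_Collect_eq)
    qed auto
    finally show ?thesis .
  qed
  define l where "l = lead_coeff D"
  have l0: "l \<noteq> 0" using D0 by (simp add: l_def)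
  show thesis
  proof (rule that[of "smult (1 / l) D" "smult (1 / l) A"])
    show "smult (1 / l) D \<noteq> 0" using D0 l0 by simp
    show "coprime (smult (1 / l) A) (smult (1 / l) D)"
    proof (rule coprimeI)
      fix d assume "d dvd smult (1 / l) A" "d dvd smult (1 / l) D"
      then have "d dvd A" "d dvd D" using l0 dvd_smult_cancel[of d "1 / l"] by auto
      then show "is_unit d" by (rule coprime_common_divisor[OF cop])
    qed
    show "phi_proj M \<phi> z = poly (smult (1 / l) A) z / poly (smult (1 / l) D) z" if "poly (smult (1 / l) D) z \<noteq> 0" for z
      using that f'[of z] l0 by simp
    show "poly (smult (1 / l) D) z = 0 \<longleftrightarrow> proj M (\<phi> (Some z)) = None" for z
      using Dz l0 by simp
    show "poly (smult (1 / l) D) z = (\<Prod>j | sheet M j None \<noteq> \<phi> None. z - phi_inv \<phi> (sheet M j None))" for z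
      using D[of z] l0 by (simp add: l_def K_def g_def)
  qed
qed

text \<open>Off a finite set of \<open>z\<close>, the roots of \<open>A - z D\<close> are the \<open>r\<close> distinct points over \<open>z\<close>. They are simple roots unless
  \<open>z\<close> is one of the finitely many values of \<open>f\<close> at the zeros of the Wronskian \<open>A' D - A D'\<close>, the numerator of the
  derivative of \<open>f\<close>. So \<open>A - z D\<close> has degree exactly \<open>r\<close> for almost all \<open>z\<close>, which determines the degrees of \<open>A\<close> and \<open>D\<close>.\<close>

lemma generic_fibres:
  assumes D0: "D \<noteq> 0" and cop: "coprime A D"
    and f: "\<And>z. poly D z \<noteq> 0 \<Longrightarrow> phi_proj M \<phi> z = poly A z / poly D z"
    and Dz: "\<And>z. poly D z = 0 \<longleftrightarrow> proj M (\<phi> (Some z)) = None"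
    and distinct: "finite {z. \<not> inj (\<lambda>k. sheet M k (Some z))}"
  obtains Z where "finite Z" "degree A \<le> CARD('r)" "degree D \<le> CARD('r)" "degree A = CARD('r) \<or> degree D = CARD('r)"
    "pderiv A * D - A * pderiv D \<noteq> 0"
    "\<And>z k. z \<notin> Z \<Longrightarrow> sheet M k (Some z) = \<phi> (Some (phi_inv \<phi> (sheet M k (Some z))))"
    "\<And>z. z \<notin> Z \<Longrightarrow> inj (\<lambda>k. phi_inv \<phi> (sheet M k (Some z)))"
    "\<And>z. z \<notin> Z \<Longrightarrow> {x. poly A x = z * poly D x} = range (\<lambda>k. phi_inv \<phi> (sheet M k (Some z)))"
    "\<And>z. z \<notin> Z \<Longrightarrow> degree (A - smult z D) = CARD('r)"
    "\<And>z k. z \<notin> Z \<Longrightarrow> deriv (phi_proj M \<phi>) (phi_inv \<phi> (sheet M k (Some z))) \<noteq> 0"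
    "\<And>z. poly D z \<noteq> 0 \<Longrightarrow> deriv (phi_proj M \<phi>) z = poly (pderiv A * D - A * pderiv D) z / poly D z ^ 2"
proof -
  define w where "w = (\<lambda>z k. phi_inv \<phi> (sheet M k (Some z)))"
  \<comment> \<open>The second part keeps all points over \<open>z\<close> in the affine part of the sphere.\<close>
  define Z0 where "Z0 = {z. \<not> inj (\<lambda>k. sheet M k (Some z))} \<union> {z. proj M (\<phi> None) = Some z}"
  have finZ0: "finite Z0"
  proof -
    have "{z. proj M (\<phi> None) = Some z} \<subseteq> {the (proj M (\<phi> None))}" by auto
    then have "finite {z. proj M (\<phi> None) = Some z}" using finite_subset by blast
    then show ?thesis using distinct by (simp add: Z0_def)
  qed
  have sh: "sheet M k (Some z) = \<phi> (Some (w z k))" if "z \<notin> Z0" for z k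
  proof -
    obtain x where x: "sheet M k (Some z) = \<phi> x" using phi_surj[OF sheet_in] by blast
    have "x \<noteq> None"
    proof
      assume "x = None"
      then have "proj M (\<phi> None) = Some z" using proj_sheet[of k "Some z"] x by simp
      then show False using that by (simp add: Z0_def)
    qed
    then show ?thesis using x by (auto simp: w_def)
  qed
  have injw: "inj (w z)" if "z \<notin> Z0" for z
  proof (rule injI)
    fix j k assume "w z j = w z k"
    then have "sheet M j (Some z) = sheet M k (Some z)" using sh[OF that] by simp
    then show "j = k" using that by (auto simp: Z0_def dest: injD)
  qed
  have roots: "{x. poly A x = z * poly D x} = range (w z)" if z: "z \<notin> Z0" for z
  proof safe
    fix x assume x: "poly A x = z * poly D x"
    have Dx: "poly D x \<noteq> 0" using x cop coprime_poly_0 by force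
    then have fx: "phi_proj M \<phi> x = z" using f x by simp
    obtain y where y: "proj M (\<phi> (Some x)) = Some y" using Dz Dx by auto
    then have "y = z" using fx by (simp add: phi_proj_def)
    then have "\<phi> (Some x) \<in> range (\<lambda>k. sheet M k (Some z))" using fibre y phi_in by blast
    then show "x \<in> range (w z)" by (auto simp: w_def) (metis inv_phi rangeI)
  next
    fix k
    have pr: "proj M (\<phi> (Some (w z k))) = Some z" using proj_sheet[of k "Some z"] sh[OF z] by simp
    then have "poly D (w z k) \<noteq> 0" using Dz by auto
    moreover have "phi_proj M \<phi> (w z k) = z" using pr by (simp add: phi_proj_def)
    ultimately show "poly A (w z k) = z * poly D (w z k)" using f[of "w z k"] by (simp add: field_simps)
  qed
  have nz: "A - smult z D \<noteq> 0" if "z \<notin> Z0" for z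
  proof
    assume "A - smult z D = 0"
    then have "{x. poly A x = z * poly D x} = UNIV" by auto
    then have "finite (UNIV :: complex set)" using roots[OF that] by (metis finite_UNIV_fun finite finite_imageI)
    then show False using infinite_UNIV_char_0 by blast
  qed
  define Wr where "Wr = pderiv A * D - A * pderiv D"
  have Wr: "Wr \<noteq> 0"
  proof
    assume "Wr = 0"
    then have eq: "pderiv A * D = A * pderiv D" by (simp add: Wr_def)
    have "D dvd A * pderiv D" using eq by (metis dvd_triv_right)
    then have "D dvd pderiv D" using cop by (simp add: coprime_commute coprime_dvd_mult_right_iff)
    then have d: "pderiv D = 0" by (rule pderiv_dvd_imp_const)
    then have a: "pderiv A = 0" using eq D0 by simp
    obtain z where z: "z \<notin> Z0" using ex_new_if_finite[OF infinite_UNIV_char_0 finZ0] by blast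
    have "degree A = 0" "degree D = 0" using a d by (simp_all add: pderiv_eq_0_iff)
    then obtain c1 c2 where "A = [:c1:]" "D = [:c2:]" by (metis degree_eq_zeroE)
    then obtain c where c: "A - smult z D = [:c:]" by simp
    have "c \<noteq> 0" using nz[OF z] c by auto
    moreover have "poly (A - smult z D) (w z undefined) = 0" using roots[OF z] by auto
    ultimately show False using c by simp
  qed
  have der: "deriv (phi_proj M \<phi>) z = poly Wr z / poly D z ^ 2" if Dz0: "poly D z \<noteq> 0" for z
  proof -
    have "open {z. poly D z \<noteq> 0}"
      by (intro open_Collect_neq continuous_intros)
    then have "\<forall>\<^sub>F x in nhds z. poly D x \<noteq> 0" using Dz0 eventually_nhds by blast
    then have ev: "\<forall>\<^sub>F x in nhds z. phi_proj M \<phi> x = poly A x / poly D x" by eventually_elim (rule f)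
    have "((\<lambda>x. poly A x / poly D x) has_field_derivative
            (poly (pderiv A) z * poly D z - poly A z * poly (pderiv D) z) / (poly D z * poly D z)) (at z)"
      using Dz0 by (intro DERIV_divide poly_DERIV)
    then have "deriv (\<lambda>x. poly A x / poly D x) z = poly Wr z / poly D z ^ 2"
      by (simp add: DERIV_imp_deriv Wr_def power2_eq_square)
    then show ?thesis using deriv_cong_ev[OF ev refl] by simp
  qed
  define Z where "Z = Z0 \<union> (\<lambda>x. poly A x / poly D x) ` {x. poly Wr x = 0}"
  have finZ: "finite Z" using finZ0 poly_roots_finite[OF Wr] by (simp add: Z_def)
  have Z0Z: "z \<notin> Z0" if "z \<notin> Z" for z using that by (simp add: Z_def)
  have DW: "poly D x \<noteq> 0 \<and> poly Wr x \<noteq> 0" if "z \<notin> Z" "poly A x = z * poly D x" for x z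
  proof -
    have "poly D x \<noteq> 0" using that cop coprime_poly_0 by force
    moreover from this have "z = poly A x / poly D x" using that by simp
    ultimately show ?thesis using that(1) by (auto simp: Z_def)
  qed
  have deg: "degree (A - smult z D) = CARD('r)" if z: "z \<notin> Z" for z
  proof -
    have "degree (A - smult z D) = card {x. poly (A - smult z D) x = 0}"
    proof (rule degree_eq_card_roots[OF _ nz[OF Z0Z[OF z]]])
      fix x assume "poly (A - smult z D) x = 0"
      then have x: "poly A x = z * poly D x" by simp
      have "poly (pderiv (A - smult z D)) x * poly D x = poly Wr x"
        using x by (simp add: Wr_def pderiv_diff pderiv_smult algebra_simps)
      then show "poly (pderiv (A - smult z D)) x \<noteq> 0" using DW[OF z x] by auto
    qed
    also have "{x. poly (A - smult z D) x = 0} = range (w z)" using roots[OF Z0Z[OF z]] by simp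
    also have "card \<dots> = CARD('r)" using injw[OF Z0Z[OF z]] by (simp add: card_image)
    finally show ?thesis .
  qed
  obtain z1 where z1: "z1 \<notin> Z" using ex_new_if_finite[OF infinite_UNIV_char_0 finZ] by blast
  obtain z2 where z2: "z2 \<notin> insert z1 Z"
    using ex_new_if_finite[OF infinite_UNIV_char_0, of "insert z1 Z"] finZ by auto
  have dD: "degree D \<le> CARD('r)"
  proof -
    have "smult (z2 - z1) D = (A - smult z1 D) - (A - smult z2 D)" by (simp add: smult_diff_left)
    then have "degree (smult (z2 - z1) D) \<le> CARD('r)"
      using deg[OF z1] deg[of z2] z2 by (metis degree_diff_le insertCI order_refl)
    then show ?thesis using z2 by auto
  qed
  have dA: "degree A \<le> CARD('r)"
  proof -
    have "A = (A - smult z1 D) + smult z1 D" by simp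
    then show ?thesis
      using deg[OF z1] dD by (metis degree_add_le degree_smult_le order_refl order_trans)
  qed
  have dAD: "degree A = CARD('r) \<or> degree D = CARD('r)"
  proof (rule ccontr)
    assume "\<not> ?thesis"
    then have "degree A < CARD('r)" "degree (smult z1 D) < CARD('r)" using dA dD by (auto simp: degree_smult_eq)
    then have "degree (A - smult z1 D) < CARD('r)" by (rule degree_diff_less)
    then show False using deg[OF z1] by simp
  qed
  show thesis
  proof (rule that[of Z, OF finZ dA dD dAD])
    show "pderiv A * D - A * pderiv D \<noteq> 0" using Wr by (simp add: Wr_def)
    fix z k assume z: "z \<notin> Z"
    show "sheet M k (Some z) = \<phi> (Some (phi_inv \<phi> (sheet M k (Some z))))"
      using sh[OF Z0Z[OF z]] by (simp add: w_def)
    have r: "poly A (w z k) = z * poly D (w z k)" using roots[OF Z0Z[OF z]] by auto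
    show "deriv (phi_proj M \<phi>) (phi_inv \<phi> (sheet M k (Some z))) \<noteq> 0"
      using DW[OF z r] der[of "w z k"] by (simp add: w_def)
  next
    fix z assume z: "z \<notin> Z"
    show "inj (\<lambda>k. phi_inv \<phi> (sheet M k (Some z)))" using injw[OF Z0Z[OF z]] by (simp add: w_def)
    show "{x. poly A x = z * poly D x} = range (\<lambda>k. phi_inv \<phi> (sheet M k (Some z)))"
      using roots[OF Z0Z[OF z]] by (simp add: w_def)
    show "degree (A - smult z D) = CARD('r)" by (rule deg[OF z])
  next
    fix z assume "poly D z \<noteq> 0"
    then show "deriv (phi_proj M \<phi>) z = poly (pderiv A * D - A * pderiv D) z / poly D z ^ 2"
      using der by (simp add: Wr_def)
  qed
qed

end

section \<open>Vectors of meromorphic functions\<close>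

lemma nicely_meromorphic_eq_analytic:
  assumes "f nicely_meromorphic_on {z}" "\<forall>\<^sub>F w in at z. f w = g w" "g analytic_on {z}"
  shows "f z = g z"
proof -
  have "g \<midarrow>z\<rightarrow> g z" using analytic_at_imp_isCont[OF assms(3)] by (simp add: isCont_def)
  then have lim: "f \<midarrow>z\<rightarrow> g z" using tendsto_cong[OF assms(2)] by simp
  then have "\<not> is_pole f z"
    by (meson at_neq_bot is_pole_def not_tendsto_and_filterlim_at_infinity)
  then have "f \<midarrow>z\<rightarrow> f z" using assms(1) by (auto simp: nicely_meromorphic_on_def)
  then show ?thesis using lim LIM_unique by blast
qed

text \<open>That the cofactors \<open>u i\<close> have no common zero is recorded as a Bezout identity, which can be used inside polynomial
  identities.\<close>

lemma finite_gcd_bezout: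
  fixes P :: "'r::finite \<Rightarrow> complex poly"
  assumes "P k \<noteq> 0"
  obtains g u s where "g \<noteq> 0" "\<And>i. P i = g * u i" "(\<Sum>i\<in>UNIV. s i * u i) = 1"
proof -
  have "\<exists>g s u. (\<forall>i\<in>S. P i = g * u i) \<and> g = (\<Sum>i\<in>S. s i * P i)" if "finite S" for S
    using that
  proof induction
    case empty
    then show ?case by auto
  next
    case (insert x S)
    then obtain g s u where IH: "\<And>i. i \<in> S \<Longrightarrow> P i = g * u i" "g = (\<Sum>i\<in>S. s i * P i)" by blast
    define a b where "a = fst (bezout_coefficients g (P x))" and "b = snd (bezout_coefficients g (P x))"
    have bez: "a * g + b * P x = gcd g (P x)"
      unfolding a_def b_def by (rule bezout_coefficients_fst_snd)
    obtain c d where c: "g = gcd g (P x) * c" and d: "P x = gcd g (P x) * d"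
      by (metis dvd_def gcd_dvd1 gcd_dvd2)
    define s' where "s' = (\<lambda>i. if i = x then b else a * s i)"
    define u' where "u' = (\<lambda>i. if i = x then d else c * u i)"
    have "P i = gcd g (P x) * u' i" if "i \<in> insert x S" for i
      using that IH(1)[of i] c d by (cases "i = x") (auto simp: u'_def mult.assoc[symmetric])
    moreover have "gcd g (P x) = (\<Sum>i\<in>insert x S. s' i * P i)"
    proof -
      have "(\<Sum>i\<in>S. s' i * P i) = (\<Sum>i\<in>S. a * (s i * P i))"
        using insert.hyps by (intro sum.cong) (auto simp: s'_def)
      also have "\<dots> = a * g" using IH(2) by (simp add: sum_distrib_left)
      finally show ?thesis using insert.hyps bez by (simp add: s'_def add.commute)
    qed
    ultimately show ?case by blast
  qed
  from this[of UNIV] have "\<exists>g s u. (\<forall>i. P i = g * u i) \<and> g = (\<Sum>i\<in>UNIV. s i * P i)" by simp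
  then obtain g s u where "\<forall>i. P i = g * u i" and *: "g = (\<Sum>i\<in>UNIV. s i * P i)"
    by (elim exE conjE)
  then have Pg: "P i = g * u i" for i by (elim allE)
  have g: "g \<noteq> 0" using Pg[of k] assms by (cases "g = 0") simp_all
  have "g * (\<Sum>i\<in>UNIV. s i * u i) = (\<Sum>i\<in>UNIV. s i * P i)"
    unfolding sum_distrib_left by (intro sum.cong refl) (simp only: Pg mult.left_commute)
  then have "g * (\<Sum>i\<in>UNIV. s i * u i) = g * 1"
    using * by (simp only: mult_1_right)
  then have "(\<Sum>i\<in>UNIV. s i * u i) = 1" using g by simp
  with g Pg show thesis by (rule that)
qed

lemma poly_eq_prod_roots:
  fixes p :: "complex poly"
  assumes "finite T" "p \<noteq> 0" "{a. poly p a = 0} \<subseteq> T"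
  shows "poly p z = lead_coeff p * (\<Prod>a\<in>T. (z - a) ^ order a p)"
proof -
  have "poly p z = poly (smult (lead_coeff p) (\<Prod>a|poly p a = 0. [:-a, 1:] ^ order a p)) z"
    by (simp add: complex_poly_decompose)
  also have "\<dots> = lead_coeff p * (\<Prod>a|poly p a = 0. (z - a) ^ order a p)"
    by (simp add: poly_prod)
  also have "(\<Prod>a|poly p a = 0. (z - a) ^ order a p) = (\<Prod>a\<in>T. (z - a) ^ order a p)"
    using assms by (intro prod.mono_neutral_left) (auto simp: order_root)
  finally show ?thesis .
qed

context uniformized_surface
begin

text \<open>Bring the entries to a common denominator and split off the greatest common divisor of the numerators. Since the
  remaining vector \<open>u\<close> has no zero, the order of the vector at a point is the order of the scalar factor \<open>g / q\<close>.\<close>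

lemma eigenvector_factorization:
  fixes F :: "'m \<Rightarrow> complex^'r::finite"
  assumes mv: "meromorphic_vec S F" and nz: "F (\<phi> (Some \<zeta>0)) $ k \<noteq> 0"
  obtains g q u s where "g \<noteq> 0" "q \<noteq> 0" "coprime g q" "(\<Sum>i\<in>UNIV. s i * u i) = 1"
    "\<And>\<zeta> i. poly q \<zeta> \<noteq> 0 \<Longrightarrow> F (\<phi> (Some \<zeta>)) $ i = poly g \<zeta> * poly (u i) \<zeta> / poly q \<zeta>"
    "\<And>\<zeta>. \<phi> (Some \<zeta>) \<in> zeros_of S F \<union> poles_of S F \<longleftrightarrow> poly g \<zeta> = 0 \<or> poly q \<zeta> = 0"
    "\<And>\<zeta>. \<phi> (Some \<zeta>) \<in> zeros_of S F \<union> poles_of S F \<Longrightarrow>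
       vec_order S F (\<phi> (Some \<zeta>)) = int (order \<zeta> g) - int (order \<zeta> q)"
proof -
  define f where "f = (\<lambda>i \<zeta>. F (\<phi> (Some \<zeta>)) $ i)"
  have mf: "meromorphic_fun S (\<lambda>p. F p $ i)" for i using mv by (simp add: meromorphic_vec_def)
  have nm: "f i nicely_meromorphic_on A" for i A
    using meromorphic_affine[OF mf[of i]] unfolding f_def by (rule nicely_meromorphic_on_subset) auto
  have "\<forall>i. \<exists>p q. q \<noteq> 0 \<and> (\<forall>z. poly q z \<noteq> 0 \<longrightarrow> f i z = poly p z / poly q z)"
    using meromorphic_fun_rational[OF mf] unfolding f_def by blast
  then obtain p0 q0 where pq0: "\<And>i. q0 i \<noteq> 0" "\<And>i z. poly (q0 i) z \<noteq> 0 \<Longrightarrow> f i z = poly (p0 i) z / poly (q0 i) z"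
    by metis
  define Q where "Q = (\<Prod>i\<in>UNIV. q0 i)"
  have Q0: "Q \<noteq> 0" using pq0(1) by (simp add: Q_def)
  define P where "P = (\<lambda>i. p0 i * (\<Prod>j\<in>UNIV - {i}. q0 j))"
  have fP: "f i z = poly (P i) z / poly Q z" if "poly Q z \<noteq> 0" for i z
  proof -
    have QQ: "Q = q0 i * (\<Prod>j\<in>UNIV - {i}. q0 j)" unfolding Q_def by (rule prod.remove) auto
    then have "poly (q0 i) z \<noteq> 0" "poly (\<Prod>j\<in>UNIV - {i}. q0 j) z \<noteq> 0" using that by (metis mult_zero_left mult_zero_right poly_mult)+
    then show ?thesis using pq0(2)[of i z] unfolding QQ P_def by simp
  qed
  have evQ: "\<forall>\<^sub>F z in at a. poly Q z \<noteq> 0" for a by (rule poly_frequently_nz[OF Q0])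
  have "\<exists>i. P i \<noteq> 0"
  proof (rule ccontr)
    assume "\<not> ?thesis"
    then have P0: "P i = 0" for i by simp
    have "\<forall>\<^sub>F z in at \<zeta>0. f k z = 0" using evQ[of \<zeta>0] by eventually_elim (simp add: fP P0)
    then have "f k \<zeta>0 = 0"
      using nicely_meromorphic_eq_analytic[OF nm, where g = "\<lambda>_. 0"] by simp
    then show False using nz by (simp add: f_def)
  qed
  then obtain i0 where "P i0 \<noteq> 0" by blast
  obtain g0 s u where g0: "g0 \<noteq> 0" and Pu: "\<And>i. P i = g0 * u i" and bez: "(\<Sum>i\<in>UNIV. s i * u i) = 1"
    by (rule finite_gcd_bezout[of P i0, OF \<open>P i0 \<noteq> 0\<close>]) blast
  obtain d g q where gq: "g0 = d * g" "Q = d * q" "coprime g q"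
  proof -
    have "gcd g0 Q \<noteq> 0" using Q0 by simp
    from gcd_coprime_exists[OF this] obtain a b where "g0 = a * gcd g0 Q" "Q = b * gcd g0 Q" "coprime a b"
      by (elim exE conjE)
    then show thesis using that[of "gcd g0 Q" a b] by (simp only: mult.commute)
  qed
  have g: "g \<noteq> 0" and q: "q \<noteq> 0" using g0 Q0 gq by auto
  have ev: "\<forall>\<^sub>F z in at a. f i z = poly g z * poly (u i) z / poly q z" for a i
    using evQ[of a]
  proof eventually_elim
    case (elim z)
    then have "poly d z \<noteq> 0" "poly q z \<noteq> 0" using gq by auto
    then show ?case using fP[OF elim, of i] by (simp add: Pu gq)
  qed
  have fgq: "f i z = poly g z * poly (u i) z / poly q z" if "poly q z \<noteq> 0" for i z
    by (rule nicely_meromorphic_eq_analytic[OF nm ev]) (use that in \<open>auto intro!: analytic_intros analytic_poly\<close>)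
  have ex_u: "\<exists>i. poly (u i) a \<noteq> 0" for a
  proof (rule ccontr)
    assume "\<not> ?thesis"
    then have "poly (\<Sum>i\<in>UNIV. s i * u i) a = 0" by (simp add: poly_sum)
    then show False using bez by simp
  qed
  \<comment> \<open>The order of the scalar factor \<open>g / q\<close>. An entry of the vector has order at least \<open>\<delta> a\<close>, with equality where \<open>u i\<close> does not vanish.\<close>
  define \<delta> where "\<delta> = (\<lambda>a. int (order a g) - int (order a q))"
  define lr where "lr = (\<lambda>a i. local_rep S (\<phi> (Some a)) (\<lambda>x. F x $ i))"
  define b where "b = (\<lambda>a. coord S (\<phi> (Some a)) (\<phi> (Some a)))"
  have zero_iff: "(\<forall>\<^sub>F t in at (b a). lr a i t = 0) \<longleftrightarrow> u i = 0" for a i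
  proof -
    have "(\<forall>\<^sub>F t in at (b a). lr a i t = 0) \<longleftrightarrow> (\<forall>\<^sub>F z in at a. f i z = 0)"
      unfolding b_def lr_def f_def by (rule local_order_affine(2)[OF mf])
    also have "\<dots> \<longleftrightarrow> u i = 0"
    proof
      assume f0: "\<forall>\<^sub>F z in at a. f i z = 0"
      show "u i = 0"
      proof (rule ccontr)
        assume "u i \<noteq> 0"
        have "\<forall>\<^sub>F z in at a. False"
          using f0 ev[of i a] poly_frequently_nz[OF g, of a] poly_frequently_nz[OF q, of a] poly_frequently_nz[OF \<open>u i \<noteq> 0\<close>, of a]
          by eventually_elim auto
        then show False by simp
      qed
    qed (use ev[of i a] in \<open>auto elim: eventually_mono\<close>)
    finally show ?thesis .
  qed
  have order: "zorder (lr a i) (b a) = \<delta> a + int (order a (u i))" if "u i \<noteq> 0" for a i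
  proof -
    have "\<not> (\<forall>\<^sub>F t in at (b a). lr a i t = 0)" using zero_iff that by simp
    then have "\<not> (\<forall>\<^sub>F z in at a. f i z = 0)"
      unfolding b_def lr_def f_def using local_order_affine(2)[OF mf] by blast
    then have fr: "\<exists>\<^sub>F z in at a. f i z \<noteq> 0" by (simp add: frequently_def)
    have "zorder (lr a i) (b a) = zorder (f i) a"
      using fr unfolding b_def lr_def f_def by (rule local_order_affine(3)[OF mf])
    also have "\<dots> = zorder (\<lambda>z. poly (g * u i) z / poly q z) a"
      by (rule zorder_cong) (use ev[of i a] in simp_all)
    also have "\<dots> = int (order a (g * u i)) - int (order a q)"
      using g q that by (intro zorder_rational) auto
    also have "\<dots> = \<delta> a + int (order a (u i))"
      using g that by (simp add: \<delta>_def order_mult)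
    finally show ?thesis .
  qed
  have pole: "is_pole (lr a i) (b a) \<longleftrightarrow> u i \<noteq> 0 \<and> \<delta> a + int (order a (u i)) < 0" for a i
  proof -
    have "lr a i meromorphic_on {b a}"
      unfolding b_def lr_def by (rule local_order_affine(1)[OF mf])
    then show ?thesis
      using zero_iff[of a i] order[of i a] by (auto simp: is_pole_iff_zorder_neg frequently_def)
  qed
  have lrE: "local_rep S (\<phi> (Some a)) (\<lambda>x. F x $ i) = lr a i" "coord S (\<phi> (Some a)) (\<phi> (Some a)) = b a" for a i
    by (simp_all add: lr_def b_def)
  have zo: "zero_of_order S F (\<phi> (Some a)) m \<longleftrightarrow> m > 0 \<and> \<delta> a = int m" for a m
  proof -
    obtain i0 where i0: "poly (u i0) a \<noteq> 0" using ex_u by blast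
    then have u0: "u i0 \<noteq> 0" and o0: "order a (u i0) = 0" by (auto simp: order_root)
    have "zero_of_order S F (\<phi> (Some a)) m \<longleftrightarrow> m > 0 \<and>
        (\<forall>i. u i = 0 \<or> zorder (lr a i) (b a) \<ge> int m) \<and> (\<exists>i. u i \<noteq> 0 \<and> zorder (lr a i) (b a) = int m)"
      unfolding zero_of_order_def Let_def lrE frequently_def by (simp add: zero_iff)
    also have "\<dots> \<longleftrightarrow> m > 0 \<and> (\<forall>i. u i = 0 \<or> \<delta> a + int (order a (u i)) \<ge> int m) \<and> (\<exists>i. u i \<noteq> 0 \<and> \<delta> a + int (order a (u i)) = int m)"
      using order by (metis (no_types, lifting))
    also have "\<dots> \<longleftrightarrow> m > 0 \<and> \<delta> a = int m"
    proof safe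
      fix i assume *: "\<forall>i. u i = 0 \<or> int m \<le> \<delta> a + int (order a (u i))" "u i \<noteq> 0" "\<delta> a + int (order a (u i)) = int m"
      show "\<delta> a = int m" using *(1)[rule_format, of i0] u0 o0 *(3) by simp
    next
      assume "\<delta> a = int m"
      then show "\<exists>i. u i \<noteq> 0 \<and> \<delta> a + int (order a (u i)) = int m" using u0 o0 by (intro exI[of _ i0]) simp
    qed auto
    finally show ?thesis .
  qed
  have po: "pole_of_order S F (\<phi> (Some a)) m \<longleftrightarrow> m > 0 \<and> \<delta> a = - int m" for a m
  proof -
    obtain i0 where i0: "poly (u i0) a \<noteq> 0" using ex_u by blast
    then have u0: "u i0 \<noteq> 0" and o0: "order a (u i0) = 0" by (auto simp: order_root)
    have "pole_of_order S F (\<phi> (Some a)) m \<longleftrightarrow> m > 0 \<and>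
        (\<exists>i. is_pole (lr a i) (b a) \<and> - zorder (lr a i) (b a) = int m) \<and>
        (\<forall>i. is_pole (lr a i) (b a) \<longrightarrow> - zorder (lr a i) (b a) \<le> int m)"
      unfolding pole_of_order_def Let_def lrE by simp
    also have "\<dots> \<longleftrightarrow> m > 0 \<and>
        (\<exists>i. u i \<noteq> 0 \<and> \<delta> a + int (order a (u i)) < 0 \<and> - (\<delta> a + int (order a (u i))) = int m) \<and>
        (\<forall>i. u i \<noteq> 0 \<and> \<delta> a + int (order a (u i)) < 0 \<longrightarrow> - (\<delta> a + int (order a (u i))) \<le> int m)"
      unfolding pole using order by (metis (no_types, lifting))
    also have "\<dots> \<longleftrightarrow> m > 0 \<and> \<delta> a = - int m"
    proof safe
      fix i assume *: "\<forall>i. u i \<noteq> 0 \<and> \<delta> a + int (order a (u i)) < 0 \<longrightarrow> - (\<delta> a + int (order a (u i))) \<le> int m"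
        "u i \<noteq> 0" "- (\<delta> a + int (order a (u i))) = int m" "0 < m"
      show "\<delta> a = - int m" using *(1)[rule_format, of i0] u0 o0 *(3,4) by simp
    next
      assume "0 < m" "\<delta> a = - int m"
      then show "\<exists>i. u i \<noteq> 0 \<and> \<delta> a + int (order a (u i)) < 0 \<and> - (\<delta> a + int (order a (u i))) = int m"
        using u0 o0 by (intro exI[of _ i0]) simp
    qed auto
    finally show ?thesis .
  qed
  have mem: "\<phi> (Some a) \<in> zeros_of S F \<union> poles_of S F \<longleftrightarrow> \<delta> a \<noteq> 0" for a
  proof -
    have "\<phi> (Some a) \<in> zeros_of S F \<union> poles_of S F \<longleftrightarrow> (\<exists>m. m > 0 \<and> \<delta> a = int m) \<or> (\<exists>m. m > 0 \<and> \<delta> a = - int m)"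
      unfolding zeros_of_def poles_of_def Un_iff mem_Collect_eq zo po using phi_in by blast
    also have "\<dots> \<longleftrightarrow> \<delta> a \<noteq> 0"
      by (cases "\<delta> a" rule: int_cases3) auto
    finally show ?thesis .
  qed
  have \<delta>0: "\<delta> a \<noteq> 0 \<longleftrightarrow> poly g a = 0 \<or> poly q a = 0" for a
  proof -
    have "\<not> (poly g a = 0 \<and> poly q a = 0)" using gq(3) coprime_poly_0 by blast
    then show ?thesis using g q by (auto simp: \<delta>_def order_root)
  qed
  show thesis
  proof (rule that[OF g q gq(3) bez])
    show "F (\<phi> (Some \<zeta>)) $ i = poly g \<zeta> * poly (u i) \<zeta> / poly q \<zeta>" if "poly q \<zeta> \<noteq> 0" for \<zeta> i
      using fgq[OF that] by (simp add: f_def)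
    show "\<phi> (Some a) \<in> zeros_of S F \<union> poles_of S F \<longleftrightarrow> poly g a = 0 \<or> poly q a = 0" for a
      using mem \<delta>0 by blast
    show "vec_order S F (\<phi> (Some a)) = int (order a g) - int (order a q)"
      if "\<phi> (Some a) \<in> zeros_of S F \<union> poles_of S F" for a
    proof -
      have "\<delta> a \<noteq> 0" using that mem by blast
      have "vec_order S F (\<phi> (Some a)) = \<delta> a"
        unfolding vec_order_def zo po
        using \<open>\<delta> a \<noteq> 0\<close> by (intro the_equality) (cases "\<delta> a" rule: int_cases3; auto)+
      then show ?thesis by (simp add: \<delta>_def)
    qed
  qed
qed

end

context rational_covering
begin

text \<open>The product over zeros and poles undoes the scalar factor \<open>g / q\<close> of the vector, up to a constant.\<close>

lemma h_fun_factorization: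
  fixes F :: "'m \<Rightarrow> complex^'r"
  assumes g: "g \<noteq> 0" and q: "q \<noteq> 0"
    and zp: "\<And>\<zeta>. \<phi> (Some \<zeta>) \<in> zeros_of M F \<union> poles_of M F \<longleftrightarrow> poly g \<zeta> = 0 \<or> poly q \<zeta> = 0"
    and ord: "\<And>\<zeta>. \<phi> (Some \<zeta>) \<in> zeros_of M F \<union> poles_of M F \<Longrightarrow>
       vec_order M F (\<phi> (Some \<zeta>)) = int (order \<zeta> g) - int (order \<zeta> q)"
    and D: "\<And>z. poly D z = (\<Prod>j | sheet M j None \<noteq> \<phi> None. z - phi_inv \<phi> (sheet M j None))"
    and nz: "poly g \<zeta> \<noteq> 0" "poly q \<zeta> \<noteq> 0"
  shows "h_fun M \<phi> N F \<zeta> = lead_coeff g / lead_coeff q * poly D \<zeta> ^ (N - 1) * poly q \<zeta> / poly g \<zeta>"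
proof -
  define T where "T = {a. poly g a = 0 \<or> poly q a = 0}"
  have T: "finite T" "{a. poly g a = 0} \<subseteq> T" "{a. poly q a = 0} \<subseteq> T"
    using poly_roots_finite[OF g] poly_roots_finite[OF q] by (auto simp: T_def Collect_disj_eq)
  have set: "(zeros_of M F \<union> poles_of M F) - {\<phi> None} = (\<lambda>a. \<phi> (Some a)) ` T"
  proof safe
    fix p assume p: "p \<in> zeros_of M F" "p \<notin> (\<lambda>a. \<phi> (Some a)) ` T"
    then have "p \<in> topspace (space M)" by (simp add: zeros_of_def)
    then obtain x where x: "p = \<phi> x" using phi_surj by blast
    show "p = \<phi> None"
    proof (cases x)
      case (Some a)
      then have "a \<in> T" using zp[of a] p(1) x by (simp add: T_def)
      then show ?thesis using p(2) x Some by blast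
    qed (use x in simp)
  next
    fix p assume p: "p \<in> poles_of M F" "p \<notin> (\<lambda>a. \<phi> (Some a)) ` T"
    then have "p \<in> topspace (space M)" by (simp add: poles_of_def)
    then obtain x where x: "p = \<phi> x" using phi_surj by blast
    show "p = \<phi> None"
    proof (cases x)
      case (Some a)
      then have "a \<in> T" using zp[of a] p(1) x by (simp add: T_def)
      then show ?thesis using p(2) x Some by blast
    qed (use x in simp)
  next
    fix a assume "a \<in> T" "\<phi> (Some a) \<notin> poles_of M F"
    then show "\<phi> (Some a) \<in> zeros_of M F" using zp[of a] by (auto simp: T_def)
  qed auto
  have notin: "\<zeta> \<notin> T" using nz by (simp add: T_def)
  have "(\<Prod>p\<in>(zeros_of M F \<union> poles_of M F) - {\<phi> None}. (\<zeta> - phi_inv \<phi> p) powi (- vec_order M F p)) =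
    (\<Prod>a\<in>T. (\<zeta> - a) powi (- vec_order M F (\<phi> (Some a))))"
    unfolding set by (subst prod.reindex) (auto simp: inj_on_def)
  also have "\<dots> = (\<Prod>a\<in>T. (\<zeta> - a) ^ order a q / (\<zeta> - a) ^ order a g)"
  proof (intro prod.cong refl)
    fix a assume a: "a \<in> T"
    then have "vec_order M F (\<phi> (Some a)) = int (order a g) - int (order a q)"
      using ord zp by (simp add: T_def)
    moreover have "\<zeta> - a \<noteq> 0" using a notin by auto
    ultimately show "(\<zeta> - a) powi (- vec_order M F (\<phi> (Some a))) = (\<zeta> - a) ^ order a q / (\<zeta> - a) ^ order a g"
      by (simp add: power_int_diff)
  qed
  also have "\<dots> = (\<Prod>a\<in>T. (\<zeta> - a) ^ order a q) / (\<Prod>a\<in>T. (\<zeta> - a) ^ order a g)"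
    by (rule prod_dividef)
  also have "\<dots> = lead_coeff g / lead_coeff q * (poly q \<zeta> / poly g \<zeta>)"
    using g q poly_eq_prod_roots[OF T(1) g T(2), of \<zeta>] poly_eq_prod_roots[OF T(1) q T(3), of \<zeta>] nz
    by (simp add: field_simps)
  finally have "(\<Prod>p\<in>(zeros_of M F \<union> poles_of M F) - {\<phi> None}. (\<zeta> - phi_inv \<phi> p) powi (- vec_order M F p)) =
    lead_coeff g / lead_coeff q * (poly q \<zeta> / poly g \<zeta>)" .
  then show ?thesis
    by (simp add: h_fun_def D prod_power_distrib)
qed

end

section \<open>Duality and the Bezoutian\<close>

lemma poly_eq_off_finite:
  fixes p q :: "complex poly"
  assumes "finite Z" "\<And>x. x \<notin> Z \<Longrightarrow> poly p x = poly q x"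
  shows "p = q"
proof (rule ccontr)
  assume "p \<noteq> q"
  then have "finite {x. poly (p - q) x = 0}" by (intro poly_roots_finite) simp
  moreover have "UNIV \<subseteq> Z \<union> {x. poly (p - q) x = 0}" using assms(2) by auto
  ultimately have "finite (UNIV :: complex set)" using assms(1) by (meson finite_UnI finite_subset)
  then show False using infinite_UNIV_char_0 by blast
qed

lemma poly_many_roots_zero:
  fixes p :: "complex poly"
  assumes "finite S" "degree p < card S" "\<And>x. x \<in> S \<Longrightarrow> poly p x = 0"
  shows "p = 0"
proof (rule ccontr)
  assume "p \<noteq> 0"
  then have "card S \<le> card {x. poly p x = 0}"
    using assms by (intro card_mono poly_roots_finite) auto
  then show False using card_poly_roots_bound[OF \<open>p \<noteq> 0\<close>] assms(2) by simp
qed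

lemma proportional_if_same_roots:
  fixes p P :: "complex poly"
  assumes "finite S" "degree P = card S" "card S > 0" "degree p \<le> card S"
    "\<And>x. x \<in> S \<Longrightarrow> poly P x = 0" "\<And>x. x \<in> S \<Longrightarrow> poly p x = 0"
  shows "\<exists>c. p = smult c P"
proof -
  define c where "c = coeff p (card S) / lead_coeff P"
  have P0: "lead_coeff P \<noteq> 0" using assms(2,3) by (metis degree_0 leading_coeff_0_iff less_irrefl)
  have "degree (p - smult c P) < card S"
  proof (rule degree_lessI)
    show "p - smult c P \<noteq> 0 \<or> 0 < card S" using assms(3) by simp
    show "\<forall>k\<ge>card S. coeff (p - smult c P) k = 0"
    proof safe
      fix k assume k: "card S \<le> k"
      show "coeff (p - smult c P) k = 0"
      proof (cases "k = card S")
        case True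
        then show ?thesis using P0 assms(2) by (simp add: c_def)
      next
        case False
        then have "k > degree p" "k > degree P" using k assms by auto
        then show ?thesis by (simp add: coeff_eq_0)
      qed
    qed
  qed
  then have "p - smult c P = 0"
    by (rule poly_many_roots_zero[OF assms(1)]) (use assms in auto)
  then show ?thesis by auto
qed

lemma poly_no_roots_const:
  fixes p :: "complex poly"
  assumes "\<And>x. poly p x \<noteq> 0"
  obtains b where "p = [:b:]" "b \<noteq> 0"
proof -
  have "constant (poly p)" using fundamental_theorem_of_algebra assms by blast
  then have "degree p = 0" by (simp add: constant_degree)
  then obtain b where "p = [:b:]" by (metis degree_eq_zeroE)
  then show thesis using assms[of 0] by (intro that[of b]) auto
qed

text \<open>The vectors \<open>u\<close> and \<open>v\<close> are dual on almost all fibres of \<open>A / D\<close>, and the conclusion says that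
  \<open>\<Sum>i. u_i(x) v_i(y)\<close> is a constant multiple of the Bezoutian of \<open>A\<close> and \<open>D\<close>. The degree
  bound on \<open>u\<close> passes on to \<open>v\<close>.

  Fix one generic fibre \<open>x_k\<close>, over \<open>z0\<close>, and put \<open>T_k(y) = \<Sum>i. u_i(x_k) v_i(y)\<close>. For a generic point \<open>y\<close>, over \<open>z\<close>, the
  polynomial \<open>t = \<Sum>i. v_i(y) u_i\<close> has degree less than \<open>r\<close> and vanishes at the other points of the fibre
  of \<open>y\<close>, so it is a multiple of \<open>(A - z D) / (X - y)\<close>. Its values at the \<open>x_k\<close> show that the vector \<open>T_k(y)\<close> is proportional to
  \<open>D(x_k) l_k(y)\<close> with \<open>l_k = (A - z0 D) / (X - x_k)\<close>. Neither of these two polynomial vectors has a zero, hence the factor of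
  proportionality is constant in \<open>y\<close>. That proves the identity for \<open>x = x_k\<close> and all \<open>y\<close>, and bounds the degree of
  \<open>v\<close>, which is spanned by the \<open>T_k\<close>. For fixed \<open>y\<close> both sides have degree at most \<open>r\<close> in \<open>x\<close> and agree at the
  \<open>r + 1\<close> points \<open>x_k\<close> and \<open>y\<close>, so they agree for all \<open>x\<close>.

  The matrix \<open>H\<close> exists because the Bezoutian divided by \<open>x - y\<close> is symmetric.\<close>

lemma bezoutian_duality:
  fixes A D :: "complex poly" and u v s :: "'r::finite \<Rightarrow> complex poly" and w :: "complex \<Rightarrow> 'r \<Rightarrow> complex"
  assumes Z: "finite Z" and cop: "coprime A D" and Wr: "pderiv A * D - A * pderiv D \<noteq> 0"
    and degA: "degree A \<le> CARD('r)" and degD: "degree D \<le> CARD('r)"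
    and inj: "\<And>z. z \<notin> Z \<Longrightarrow> inj (w z)"
    and roots: "\<And>z. z \<notin> Z \<Longrightarrow> {x. poly A x = z * poly D x} = range (w z)"
    and deg: "\<And>z. z \<notin> Z \<Longrightarrow> degree (A - smult z D) = CARD('r)"
    and degu: "\<And>i. degree (u i) \<le> CARD('r) - 1"
    and orth: "\<And>z j k. z \<notin> Z \<Longrightarrow> j \<noteq> k \<Longrightarrow> (\<Sum>i\<in>UNIV. poly (u i) (w z j) * poly (v i) (w z k)) = 0"
    and dual: "\<And>z. z \<notin> Z \<Longrightarrow> \<exists>d. \<forall>i j. (\<Sum>k\<in>UNIV. d k * poly (u i) (w z k) * poly (v j) (w z k)) = (if i = j then 1 else 0)"
    and bez: "(\<Sum>i\<in>UNIV. s i * v i) = 1"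
  obtains c H where "c \<noteq> 0"
    "\<And>x y. (x - y) * (\<Sum>i\<in>UNIV. poly (u i) x * poly (v i) y) = c * (poly A x * poly D y - poly A y * poly D x)"
    "\<And>x. (\<Sum>i\<in>UNIV. poly (u i) x * poly (v i) x) = c * poly (pderiv A * D - A * pderiv D) x"
    "\<And>i. degree (v i) \<le> CARD('r) - 1"
    "\<And>i x. poly (u i) x = (\<Sum>j\<in>UNIV. H i j * poly (v j) x)"
proof -
  let ?r = "CARD('r)"
  have r: "?r > 0" by simp
  have Droot: "poly D x \<noteq> 0" if "poly A x = z * poly D x" for x z
    using that cop coprime_poly_0 by force
  have AD: "A - smult z D \<noteq> 0" for z
  proof
    assume "A - smult z D = 0"
    then have "A = smult z D" by simp
    then show False using Wr by (simp add: pderiv_smult mult.commute)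
  qed
  obtain z0 where z0: "z0 \<notin> Z" using ex_new_if_finite[OF infinite_UNIV_char_0 Z] by blast
  define x where "x = w z0"
  define P0 where "P0 = A - smult z0 D"
  have injx: "x j = x k \<longleftrightarrow> j = k" for j k using inj[OF z0] by (auto simp: x_def inj_def)
  have cardx: "card (range x) = ?r" using inj[OF z0] by (simp add: x_def card_image)
  have xroot: "poly A (x k) = z0 * poly D (x k)" for k using roots[OF z0] by (auto simp: x_def)
  have P0x: "poly P0 (x k) = 0" for k using xroot by (simp add: P0_def)
  have degP0: "degree P0 = ?r" using deg[OF z0] by (simp add: P0_def)
  have "\<exists>l. P0 = [:- x k, 1:] * l" for k using P0x[of k] by (metis dvd_def poly_eq_0_iff_dvd)
  then obtain l where l: "\<And>k. P0 = [:- x k, 1:] * l k" by metis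
  have P0nz: "P0 \<noteq> 0" using AD by (simp add: P0_def)
  have lnz: "l k \<noteq> 0" for k using l[of k] P0nz by auto
  have degl: "degree (l k) = ?r - 1" for k
  proof -
    have "degree P0 = degree [:- x k, 1:] + degree (l k)"
      by (subst l[of k]) (rule degree_mult_eq, use lnz in auto)
    then show ?thesis using degP0 by simp
  qed
  have loff: "poly (l k) (x j) = 0" if "j \<noteq> k" for j k
  proof -
    have "(x j - x k) * poly (l k) (x j) = 0" using P0x[of j] by (subst (asm) l[of k]) (auto simp: algebra_simps)
    then show ?thesis using that injx by auto
  qed
  have ldiag: "poly (l k) (x k) \<noteq> 0" for k
  proof
    assume lk: "poly (l k) (x k) = 0"
    have "poly (l k) (x j) = 0" for j using lk loff by (cases "j = k") auto
    then have "poly (l k) y = 0" if "y \<in> range x" for y using that by auto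
    then have "l k = 0" using degl[of k] cardx r by (intro poly_many_roots_zero[of "range x"]) auto
    then show False using lnz by simp
  qed
  obtain d where d: "\<And>i j. (\<Sum>k\<in>UNIV. d k * poly (u i) (x k) * poly (v j) (x k)) = (if i = j then 1 else 0)"
    using dual[OF z0] unfolding x_def by blast
  define T where "T = (\<lambda>k. \<Sum>i\<in>UNIV. smult (poly (u i) (x k)) (v i))"
  have Tp: "poly (T k) y = (\<Sum>i\<in>UNIV. poly (u i) (x k) * poly (v i) y)" for k y
    by (simp add: T_def poly_sum)
  \<comment> \<open>Duality on the fixed fibre: the \<open>v i\<close> are combinations of the \<open>T k\<close>.\<close>
  have vT: "v i = (\<Sum>k\<in>UNIV. smult (d k * poly (v i) (x k)) (T k))" for i
  proof (rule poly_eq_off_finite[of "{}"])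
    fix y
    have "poly (\<Sum>k\<in>UNIV. smult (d k * poly (v i) (x k)) (T k)) y =
        (\<Sum>k\<in>UNIV. \<Sum>j\<in>UNIV. (d k * poly (u j) (x k) * poly (v i) (x k)) * poly (v j) y)"
      by (simp add: poly_sum Tp sum_distrib_left mult_ac)
    also have "\<dots> = (\<Sum>j\<in>UNIV. (\<Sum>k\<in>UNIV. d k * poly (u j) (x k) * poly (v i) (x k)) * poly (v j) y)"
      by (subst sum.swap) (simp add: sum_distrib_right)
    also have "\<dots> = poly (v i) y"
      by (simp add: d if_distrib[of "\<lambda>a. a * _"] cong: if_cong)
    finally show "poly (v i) y = poly (\<Sum>k\<in>UNIV. smult (d k * poly (v i) (x k)) (T k)) y" by simp
  qed simp
  define l' where "l' = (\<lambda>k. smult (poly D (x k)) (l k))"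
  \<comment> \<open>The points \<open>y\<close> whose fibre is not generic, and the fixed fibre itself.\<close>
  define Bad where "Bad = {y. poly D y = 0} \<union> (\<Union>z\<in>Z. {y. poly (A - smult z D) y = 0}) \<union> range x"
  have Dnz: "D \<noteq> 0" using Droot[OF xroot] by auto
  have finBad: "finite Bad"
    unfolding Bad_def by (intro finite_UnI finite_UN_I poly_roots_finite Z Dnz AD finite_imageI finite)
  have propT: "\<exists>c. \<forall>k. poly (T k) y = c * poly (l' k) y" if y: "y \<notin> Bad" for y
  proof -
    define z where "z = poly A y / poly D y"
    have Dy: "poly D y \<noteq> 0" using y by (simp add: Bad_def)
    then have Ay: "poly A y = z * poly D y" by (simp add: z_def)
    then have zZ: "z \<notin> Z" using y by (auto simp: Bad_def)
    obtain k0 where k0: "y = w z k0" using roots[OF zZ] Ay by auto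
    define t where "t = (\<Sum>i\<in>UNIV. smult (poly (v i) y) (u i))"
    have degt: "degree t \<le> ?r - 1"
      unfolding t_def by (intro degree_sum_le order_trans[OF degree_smult_le degu]) simp
    have "\<exists>c. [:- y, 1:] * t = smult c (A - smult z D)"
    proof (rule proportional_if_same_roots[where S = "range (w z)"])
      show "degree (A - smult z D) = card (range (w z))" "0 < card (range (w z))"
        using deg[OF zZ] inj[OF zZ] by (simp_all add: card_image)
      have "degree [:- y, 1:] = 1" by simp
      then have "degree ([:- y, 1:] * t) \<le> ?r"
        using degree_mult_le[of "[:- y, 1:]" t] degt r by linarith
      then show "degree ([:- y, 1:] * t) \<le> card (range (w z))"
        using inj[OF zZ] r by (simp add: card_image)
      fix a assume a: "a \<in> range (w z)"
      then show "poly (A - smult z D) a = 0" using roots[OF zZ] by auto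
      obtain j where j: "a = w z j" using a by auto
      show "poly ([:- y, 1:] * t) a = 0"
      proof (cases "j = k0")
        case False
        then have "poly t a = 0" using orth[OF zZ False] by (simp add: t_def poly_sum j k0 mult.commute)
        then show ?thesis by simp
      qed (simp add: j k0)
    qed simp
    then obtain c where c: "[:- y, 1:] * t = smult c (A - smult z D)" ..
    show ?thesis
    proof (intro exI[of _ "c / poly D y"] allI)
      fix k
      have ne: "x k - y \<noteq> 0" using y by (auto simp: Bad_def)
      have "(x k - y) * poly t (x k) = c * (poly A (x k) - z * poly D (x k))"
        using arg_cong[OF c, of "\<lambda>p. poly p (x k)"] by (simp add: algebra_simps)
      then have 1: "(x k - y) * poly t (x k) = c * ((z0 - z) * poly D (x k))"
        using xroot[of k] by (simp add: algebra_simps)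
      have "(y - x k) * poly (l k) y = poly P0 y" by (subst l[of k]) (simp add: algebra_simps)
      also have "\<dots> = (z - z0) * poly D y" using Ay by (simp add: P0_def algebra_simps)
      finally have 2: "(x k - y) * poly (l k) y = (z0 - z) * poly D y" by (simp add: algebra_simps)
      have "(x k - y) * (poly t (x k) * poly D y) = ((x k - y) * poly t (x k)) * poly D y"
        by simp
      also have "\<dots> = c * poly D (x k) * ((z0 - z) * poly D y)"
        unfolding 1 by simp
      also have "\<dots> = (x k - y) * (c * poly (l' k) y)"
        unfolding 2[symmetric] by (simp add: l'_def)
      finally have "(x k - y) * (poly t (x k) * poly D y) = (x k - y) * (c * poly (l' k) y)" .
      then have "poly t (x k) * poly D y = c * poly (l' k) y" using ne by simp
      moreover have "poly t (x k) = poly (T k) y" by (simp add: t_def Tp poly_sum mult.commute)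
      ultimately show "poly (T k) y = c / poly D y * poly (l' k) y" using Dy by (simp add: field_simps)
    qed
  qed
  have cross: "T j * l' k = T k * l' j" for j k
  proof (rule poly_eq_off_finite[OF finBad])
    fix y assume "y \<notin> Bad"
    then obtain c where "\<forall>k. poly (T k) y = c * poly (l' k) y" using propT by blast
    then show "poly (T j * l' k) y = poly (T k * l' j) y" by simp
  qed
  define \<sigma> where "\<sigma> = (\<lambda>k. \<Sum>i\<in>UNIV. smult (d k * poly (v i) (x k)) (s i))"
  have \<sigma>T: "(\<Sum>k\<in>UNIV. \<sigma> k * T k) = 1"
  proof -
    have "(\<Sum>k\<in>UNIV. \<sigma> k * T k) = (\<Sum>k\<in>UNIV. \<Sum>i\<in>UNIV. s i * smult (d k * poly (v i) (x k)) (T k))"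
      by (simp add: \<sigma>_def sum_distrib_right)
    also have "\<dots> = (\<Sum>i\<in>UNIV. s i * (\<Sum>k\<in>UNIV. smult (d k * poly (v i) (x k)) (T k)))"
      by (subst sum.swap) (simp add: sum_distrib_left)
    also have "\<dots> = 1" using bez by (simp add: vT[symmetric])
    finally show ?thesis .
  qed
  \<comment> \<open>The polynomial factor with \<open>l' = \<beta> T\<close>, obtained from the Bezout identity for \<open>T\<close>. It has no zero because \<open>l'\<close> has none.\<close>
  define \<beta> where "\<beta> = (\<Sum>k\<in>UNIV. \<sigma> k * l' k)"
  have \<beta>T: "\<beta> * T j = l' j" for j
  proof -
    have "\<beta> * T j = (\<Sum>k\<in>UNIV. \<sigma> k * (T j * l' k))"
      unfolding \<beta>_def sum_distrib_right by (intro sum.cong refl) (simp only: mult_ac)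
    also have "\<dots> = (\<Sum>k\<in>UNIV. \<sigma> k * T k) * l' j"
      unfolding sum_distrib_right by (intro sum.cong refl, subst cross) (simp only: mult.assoc)
    finally show ?thesis by (simp add: \<sigma>T)
  qed
  have "poly \<beta> y \<noteq> 0" for y
  proof
    assume 0: "poly \<beta> y = 0"
    have ly: "poly (l k) y = 0" for k
    proof -
      have "poly (l' k) y = 0" using arg_cong[OF \<beta>T[of k], of "\<lambda>p. poly p y"] 0 by simp
      then show ?thesis using Droot[OF xroot[of k]] by (simp add: l'_def)
    qed
    then have "poly P0 y = 0" by (subst l[of undefined]) simp
    then have "y \<in> range x" using roots[OF z0] by (auto simp: P0_def x_def)
    then show False using ly ldiag by auto
  qed
  then obtain b where b: "\<beta> = [:b:]" "b \<noteq> 0" by (rule poly_no_roots_const)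
  have Tl: "T k = smult (1 / b) (l' k)" for k
    using \<beta>T[of k] b by (simp flip: \<open>\<beta> * T k = l' k\<close>)
  have degT: "degree (T k) \<le> ?r - 1" for k
    using degl[of k] by (simp add: Tl l'_def)
  have degv: "degree (v i) \<le> ?r - 1" for i
    by (subst vT) (intro degree_sum_le order_trans[OF degree_smult_le degT], simp)
  define c where "c = 1 / b"
  have c0: "c \<noteq> 0" using b by (simp add: c_def)
  have idx: "(x k - y) * poly (T k) y = c * (poly A (x k) * poly D y - poly A y * poly D (x k))" for k y
  proof -
    have "(y - x k) * poly (l k) y = poly P0 y" by (subst l[of k]) (simp add: algebra_simps)
    then have "(x k - y) * poly (l k) y = z0 * poly D y - poly A y" by (simp add: P0_def algebra_simps)
    then have "(x k - y) * poly (T k) y = c * poly D (x k) * (z0 * poly D y - poly A y)"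
      by (simp add: Tl l'_def c_def)
    then show ?thesis using xroot[of k] by (simp add: algebra_simps)
  qed
  have main_off: "[:- y, 1:] * (\<Sum>i\<in>UNIV. smult (poly (v i) y) (u i)) = smult c (smult (poly D y) A - smult (poly A y) D)"
    if y: "y \<notin> range x" for y
  proof -
    define t where "t = (\<Sum>i\<in>UNIV. smult (poly (v i) y) (u i))"
    have degt: "degree t \<le> ?r - 1"
      unfolding t_def by (intro degree_sum_le order_trans[OF degree_smult_le degu]) simp
    have "[:- y, 1:] * t - smult c (smult (poly D y) A - smult (poly A y) D) = 0"
    proof (rule poly_many_roots_zero[of "insert y (range x)"])
      have "degree [:- y, 1:] = 1" by simp
      then have "degree ([:- y, 1:] * t) \<le> ?r"
        using degree_mult_le[of "[:- y, 1:]" t] degt r by linarith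
      moreover have "degree (smult c (smult (poly D y) A - smult (poly A y) D)) \<le> ?r"
        by (intro order_trans[OF degree_smult_le] degree_diff_le degA degD)
      ultimately have "degree ([:- y, 1:] * t - smult c (smult (poly D y) A - smult (poly A y) D)) \<le> ?r"
        by (rule degree_diff_le)
      then show "degree ([:- y, 1:] * t - smult c (smult (poly D y) A - smult (poly A y) D)) < card (insert y (range x))"
        using y cardx by simp
      fix a assume "a \<in> insert y (range x)"
      then consider "a = y" | k where "a = x k" by auto
      then show "poly ([:- y, 1:] * t - smult c (smult (poly D y) A - smult (poly A y) D)) a = 0"
      proof cases
        case (2 k)
        have "poly t a = poly (T k) y" by (simp add: t_def Tp poly_sum mult.commute 2)
        then show ?thesis using idx[of k y] by (simp add: 2 algebra_simps)
      qed simp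
    qed simp
    then show ?thesis by (simp add: t_def)
  qed
  have main: "(a - y) * (\<Sum>i\<in>UNIV. poly (u i) a * poly (v i) y) = c * (poly A a * poly D y - poly A y * poly D a)" for a y
  proof -
    have "[:a, -1:] * (\<Sum>i\<in>UNIV. smult (poly (u i) a) (v i)) = smult c (smult (poly A a) D - smult (poly D a) A)"
    proof (rule poly_eq_off_finite[of "range x"])
      fix y assume "y \<notin> range x"
      from arg_cong[OF main_off[OF this], of "\<lambda>p. poly p a"]
      show "poly ([:a, -1:] * (\<Sum>i\<in>UNIV. smult (poly (u i) a) (v i))) y = poly (smult c (smult (poly A a) D - smult (poly D a) A)) y"
        by (simp add: poly_sum algebra_simps)
    qed simp
    from arg_cong[OF this, of "\<lambda>p. poly p y"] show ?thesis
      by (simp add: poly_sum algebra_simps)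
  qed
  have diag: "(\<Sum>i\<in>UNIV. poly (u i) y * poly (v i) y) = c * poly (pderiv A * D - A * pderiv D) y" for y
  proof -
    define t where "t = (\<Sum>i\<in>UNIV. smult (poly (v i) y) (u i))"
    have "[:- y, 1:] * t = smult c (smult (poly D y) A - smult (poly A y) D)"
    proof (rule poly_eq_off_finite[of "{}"])
      fix a show "poly ([:- y, 1:] * t) a = poly (smult c (smult (poly D y) A - smult (poly A y) D)) a"
        using main[of a y] by (simp add: t_def poly_sum algebra_simps)
    qed simp
    then have "poly (pderiv ([:- y, 1:] * t)) y = poly (pderiv (smult c (smult (poly D y) A - smult (poly A y) D))) y"
      by simp
    then have "poly t y = c * (poly D y * poly (pderiv A) y - poly A y * poly (pderiv D) y)"
      by (simp add: pderiv_mult pderiv_pCons pderiv_smult pderiv_diff)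
    then show ?thesis by (simp add: t_def poly_sum mult.commute)
  qed
  have sym: "(\<Sum>i\<in>UNIV. poly (u i) a * poly (v i) y) = (\<Sum>i\<in>UNIV. poly (u i) y * poly (v i) a)" for a y
  proof (cases "a = y")
    case False
    have "(a - y) * (\<Sum>i\<in>UNIV. poly (u i) a * poly (v i) y) = (a - y) * (\<Sum>i\<in>UNIV. poly (u i) y * poly (v i) a)"
    proof -
      have "(a - y) * (\<Sum>i\<in>UNIV. poly (u i) y * poly (v i) a) = - ((y - a) * (\<Sum>i\<in>UNIV. poly (u i) y * poly (v i) a))"
        by (simp only: mult_minus_left[symmetric] minus_diff_eq)
      then show ?thesis unfolding main by (simp add: algebra_simps)
    qed
    then show ?thesis using False by simp
  qed simp
  \<comment> \<open>Expand \<open>u i\<close> by duality on the fixed fibre and exchange the arguments of the symmetric Bezoutian.\<close>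
  define H where "H = (\<lambda>i j. \<Sum>k\<in>UNIV. d k * poly (u i) (x k) * poly (u j) (x k))"
  have H: "poly (u i) a = (\<Sum>j\<in>UNIV. H i j * poly (v j) a)" for i a
  proof -
    have "poly (u i) a = (\<Sum>j\<in>UNIV. (if i = j then 1 else 0) * poly (u j) a)"
      by (simp add: if_distrib[of "\<lambda>a. a * _"] cong: if_cong)
    also have "\<dots> = (\<Sum>j\<in>UNIV. (\<Sum>k\<in>UNIV. d k * poly (u i) (x k) * poly (v j) (x k)) * poly (u j) a)"
      by (simp only: d)
    also have "\<dots> = (\<Sum>j\<in>UNIV. \<Sum>k\<in>UNIV. d k * poly (u i) (x k) * (poly (u j) a * poly (v j) (x k)))"
      unfolding sum_distrib_right by (intro sum.cong refl) (simp only: mult_ac)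
    also have "\<dots> = (\<Sum>k\<in>UNIV. d k * poly (u i) (x k) * (\<Sum>j\<in>UNIV. poly (u j) a * poly (v j) (x k)))"
      by (subst sum.swap) (simp add: sum_distrib_left)
    also have "\<dots> = (\<Sum>k\<in>UNIV. d k * poly (u i) (x k) * (\<Sum>j\<in>UNIV. poly (u j) (x k) * poly (v j) a))"
      by (simp add: sym[of a])
    also have "\<dots> = (\<Sum>j\<in>UNIV. \<Sum>k\<in>UNIV. d k * poly (u i) (x k) * (poly (u j) (x k) * poly (v j) a))"
      by (subst sum.swap) (simp add: sum_distrib_left)
    also have "\<dots> = (\<Sum>j\<in>UNIV. H i j * poly (v j) a)"
      unfolding H_def sum_distrib_right by (intro sum.cong refl) (simp only: mult_ac)
    finally show ?thesis .
  qed
  show thesis by (rule that[OF c0 main diag degv H])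
qed

section \<open>Curve integrals and finite sets\<close>

lemma countable_if_isolated:
  fixes N :: "'a::second_countable_topology set"
  assumes "\<And>t. t \<in> N \<Longrightarrow> \<not> t islimpt N"
  shows "countable N"
proof -
  obtain B :: "'a set set" where B: "countable B" "topological_basis B"
    using ex_countable_basis by blast
  have "\<exists>b. b \<in> B \<and> t \<in> b \<and> b \<inter> N = {t}" if t: "t \<in> N" for t
  proof -
    obtain U where U: "t \<in> U" "open U" "\<And>y. y \<in> N \<Longrightarrow> y \<in> U \<Longrightarrow> y = t"
      using assms[OF t] unfolding islimpt_def by blast
    obtain b where "b \<in> B" "t \<in> b" "b \<subseteq> U"
      using topological_basisE[OF B(2) U(2,1)] by blast
    then show ?thesis using U(3) t by blast
  qed
  then obtain b where b: "\<And>t. t \<in> N \<Longrightarrow> b t \<in> B \<and> t \<in> b t \<and> b t \<inter> N = {t}" by metis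
  have "inj_on b N" by (rule inj_onI) (use b in blast)
  moreover have "countable (b ` N)" by (rule countable_subset[OF _ B(1)]) (use b in blast)
  ultimately show ?thesis using countable_image_inj_on by blast
qed

text \<open>A curve with nonzero velocity leaves a point at once, so these parameters are isolated.\<close>

lemma level_set_regular_countable:
  fixes g :: "real \<Rightarrow> complex"
  assumes "\<And>t. t \<in> N \<Longrightarrow> (g has_vector_derivative D t) (at t) \<and> D t \<noteq> 0 \<and> g t = b"
  shows "countable N"
proof (rule countable_if_isolated)
  fix t assume t: "t \<in> N"
  show "\<not> t islimpt N"
  proof
    assume lim: "t islimpt N"
    have der: "(g has_derivative (\<lambda>h. h *\<^sub>R D t)) (at t)" and D: "D t \<noteq> 0" and gt: "g t = b"
      using assms[OF t] by (auto simp: has_vector_derivative_def)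
    have "norm (D t) / 2 > 0" using D by simp
    then obtain d where d: "d > 0"
      "\<And>y. norm (y - t) < d \<Longrightarrow> norm (g y - g t - (y - t) *\<^sub>R D t) \<le> norm (D t) / 2 * norm (y - t)"
      using der unfolding has_derivative_at_alt by blast
    obtain y where y: "y \<in> N" "y \<noteq> t" "dist y t < d"
      using lim d(1) unfolding islimpt_approachable by blast
    have "norm ((y - t) *\<^sub>R D t) \<le> norm (D t) / 2 * norm (y - t)"
      using d(2)[of y] y assms[OF y(1)] gt by (simp add: dist_norm)
    then have "\<bar>y - t\<bar> * norm (D t) \<le> \<bar>y - t\<bar> * (norm (D t) / 2)"
      by (simp add: mult.commute)
    then have "norm (D t) \<le> norm (D t) / 2" using y(2) by (simp add: mult_le_cancel_left)
    then show False using D by simp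
  qed
qed

lemma has_curve_integral_Nil: "has_curve_integral [] f v \<longleftrightarrow> v = 0"
  by (simp add: has_curve_integral_def)

lemma has_curve_integral_Cons:
  "has_curve_integral ((I, g) # \<gamma>) f v \<longleftrightarrow>
     (\<lambda>t. f (g t) * vector_derivative g (at t)) integrable_on I \<and>
     has_curve_integral \<gamma> f (v - integral I (\<lambda>t. f (g t) * vector_derivative g (at t)))"
  by (auto simp: has_curve_integral_def algebra_simps)

text \<open>A curve may spend a long time at an exceptional point, but only with velocity zero, and then both
  integrands vanish. The parameters at which it passes through with nonzero velocity are countable.\<close>

lemma has_curve_integral_cong_off_finite:
  assumes curves: "\<forall>C\<in>set \<gamma>. piecewise_smooth_curve C"
    and B: "finite B" and eq: "\<And>z. z \<notin> B \<Longrightarrow> F z = G z"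
  shows "has_curve_integral \<gamma> F v \<longleftrightarrow> has_curve_integral \<gamma> G v"
proof -
  let ?i = "\<lambda>F (g :: real \<Rightarrow> complex) t. F (g t) * vector_derivative g (at t)"
  have *: "?i F g integrable_on I \<longleftrightarrow> ?i G g integrable_on I" "integral I (?i F g) = integral I (?i G g)"
    if "(I, g) \<in> set \<gamma>" for I g
  proof -
    have "g piecewise_C1_differentiable_on I"
      using curves that by (auto simp: piecewise_smooth_curve_def)
    then obtain S where S: "finite S" "g C1_differentiable_on (I - S)"
      by (auto simp: piecewise_C1_differentiable_on_def)
    define N where "N = (\<lambda>b. {t \<in> I - S. g t = b \<and> vector_derivative g (at t) \<noteq> 0})"
    have "countable (N b)" for b
    proof (rule level_set_regular_countable)
      fix t assume t: "t \<in> N b"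
      obtain D where "(g has_vector_derivative D) (at t)"
        using S(2) t unfolding C1_differentiable_on_def N_def by blast
      then have "(g has_vector_derivative vector_derivative g (at t)) (at t)"
        by (simp add: vector_derivative_at)
      then show "(g has_vector_derivative vector_derivative g (at t)) (at t) \<and> vector_derivative g (at t) \<noteq> 0 \<and> g t = b"
        using t by (simp add: N_def)
    qed
    then have "countable (S \<union> (\<Union>b\<in>B. N b))" using B S(1) by (auto intro: countable_finite)
    then have "negligible (\<Union>((\<lambda>x. {x}) ` (S \<union> (\<Union>b\<in>B. N b))))"
      by (intro negligible_countable_Union countable_image) auto
    then have neg: "negligible (S \<union> (\<Union>b\<in>B. N b))" by simp
    have e: "?i F g t = ?i G g t" if "t \<in> I - (S \<union> (\<Union>b\<in>B. N b))" for t
      using that eq by (cases "g t \<in> B") (auto simp: N_def)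
    show "?i F g integrable_on I \<longleftrightarrow> ?i G g integrable_on I"
    proof
      assume "?i F g integrable_on I"
      then show "?i G g integrable_on I" by (rule integrable_spike[OF _ neg]) (rule e[symmetric])
    next
      assume "?i G g integrable_on I"
      then show "?i F g integrable_on I" by (rule integrable_spike[OF _ neg]) (rule e)
    qed
    show "integral I (?i F g) = integral I (?i G g)"
      by (rule integral_spike[OF neg]) (rule e[symmetric])
  qed
  show ?thesis
    using *
  proof (induction \<gamma> arbitrary: v)
    case (Cons C \<gamma>)
    obtain I g where C: "C = (I, g)" by (cases C)
    have IH: "has_curve_integral \<gamma> F v \<longleftrightarrow> has_curve_integral \<gamma> G v" for v
      by (rule Cons.IH) (use Cons.prems in auto)
    show ?case
      unfolding C has_curve_integral_Cons IH using Cons.prems[of I g] by (simp add: C)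
  qed (simp add: has_curve_integral_Nil)
qed

text \<open>The curve integral and its lift to the sphere both satisfy these axioms, so the algebra of orthogonal polynomials can be done
  once for both.\<close>

locale linear_integral =
  fixes J :: integral_pred
  assumes unique: "J f a \<Longrightarrow> J f b \<Longrightarrow> a = b"
    and zero: "J (\<lambda>_. 0) 0"
    and add: "J f a \<Longrightarrow> J g b \<Longrightarrow> J (\<lambda>x. f x + g x) (a + b)"
    and cmult: "J f a \<Longrightarrow> J (\<lambda>x. c * f x) (c * a)"
begin

lemma sum: "(\<And>i. i \<in> S \<Longrightarrow> J (f i) (a i)) \<Longrightarrow> J (\<lambda>x. \<Sum>i\<in>S. f i x) (\<Sum>i\<in>S. a i)"
proof (induction S rule: infinite_finite_induct)
  case (insert i S)
  then show ?case using add[of "f i" "a i" "\<lambda>x. \<Sum>i\<in>S. f i x"] by simp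
qed (simp_all add: zero)

end

lemma linear_curve_integral: "linear_integral (has_curve_integral \<gamma>)"
proof
  let ?i = "\<lambda>F (g :: real \<Rightarrow> complex) t. F (g t) * vector_derivative g (at t)"
  show "a = b" if "has_curve_integral \<gamma> f a" "has_curve_integral \<gamma> f b" for f a b
    using that unfolding has_curve_integral_def by simp
  show "has_curve_integral \<gamma> (\<lambda>_. 0) 0"
  proof (induction \<gamma>)
    case (Cons C \<gamma>)
    then show ?case by (cases C) (simp add: has_curve_integral_Cons integrable_0)
  qed (simp add: has_curve_integral_Nil)
  show "has_curve_integral \<gamma> (\<lambda>x. f x + g x) (a + b)"
    if f: "has_curve_integral \<gamma> f a" and g: "has_curve_integral \<gamma> g b" for f g a b
    using f g
  proof (induction \<gamma> arbitrary: a b)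
    case (Cons C \<gamma>)
    obtain I h where C: "C = (I, h)" by (cases C)
    have i: "?i f h integrable_on I" "?i g h integrable_on I"
      and J: "has_curve_integral \<gamma> f (a - integral I (?i f h))" "has_curve_integral \<gamma> g (b - integral I (?i g h))"
      using Cons.prems by (simp_all add: C has_curve_integral_Cons)
    have e: "?i (\<lambda>x. f x + g x) h = (\<lambda>t. ?i f h t + ?i g h t)"
      by (simp add: distrib_right)
    have v: "a + b - integral I (\<lambda>t. ?i f h t + ?i g h t) = (a - integral I (?i f h)) + (b - integral I (?i g h))"
      using integral_add[OF i] by simp
    show ?case
      unfolding C has_curve_integral_Cons e v by (intro conjI integrable_add[OF i] Cons.IH[OF J])
  qed (simp add: has_curve_integral_Nil)
  show "has_curve_integral \<gamma> (\<lambda>x. c * f x) (c * a)" if f: "has_curve_integral \<gamma> f a" for f a c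
    using f
  proof (induction \<gamma> arbitrary: a)
    case (Cons C \<gamma>)
    obtain I h where C: "C = (I, h)" by (cases C)
    have i: "?i f h integrable_on I" and J: "has_curve_integral \<gamma> f (a - integral I (?i f h))"
      using Cons.prems by (simp_all add: C has_curve_integral_Cons)
    have e: "?i (\<lambda>x. c * f x) h = (\<lambda>t. c * ?i f h t)"
      by (simp add: mult.assoc)
    have v: "c * a - integral I (\<lambda>t. c * ?i f h t) = c * (a - integral I (?i f h))"
      using i by (simp add: right_diff_distrib)
    show ?case
      unfolding C has_curve_integral_Cons e v by (intro conjI integrable_on_mult_right[OF i] Cons.IH[OF J])
  qed (simp add: has_curve_integral_Nil)
qed

lemma linear_lifted_integral: "linear_integral (has_lifted_integral M \<phi> \<gamma>)"
proof -
  interpret linear_integral "has_curve_integral \<gamma>" by (rule linear_curve_integral)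
  show ?thesis
  proof
    show "a = b" if "has_lifted_integral M \<phi> \<gamma> f a" "has_lifted_integral M \<phi> \<gamma> f b" for f a b
      using that unfolding has_lifted_integral_def by (rule unique)
    show "has_lifted_integral M \<phi> \<gamma> (\<lambda>_. 0) 0"
      unfolding has_lifted_integral_def using zero by simp
    show "has_lifted_integral M \<phi> \<gamma> (\<lambda>x. f x + g x) (a + b)"
      if "has_lifted_integral M \<phi> \<gamma> f a" "has_lifted_integral M \<phi> \<gamma> g b" for f g a b
      using add[OF that[unfolded has_lifted_integral_def]] unfolding has_lifted_integral_def
      by (simp add: sum.distrib add_divide_distrib)
    show "has_lifted_integral M \<phi> \<gamma> (\<lambda>x. c * f x) (c * a)"
      if "has_lifted_integral M \<phi> \<gamma> f a" for f a c
      using cmult[OF that[unfolded has_lifted_integral_def], of c] unfolding has_lifted_integral_def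
      by (simp add: sum_distrib_left)
  qed
qed

text \<open>An unbounded parameter interval does no harm: the curve is then proper, so the part of its image in a bounded set is
  already covered by a compact set of parameters.\<close>

lemma closed_curve_image:
  assumes "\<forall>C\<in>set \<gamma>. piecewise_smooth_curve C"
  shows "closed (curve_image \<gamma>)"
proof -
  have "closed (g ` I)" if "(I, g) \<in> set \<gamma>" for I g
  proof -
    have ps: "closed I" "continuous_on I g"
      "\<not> bdd_above I \<Longrightarrow> filterlim g at_infinity at_top" "\<not> bdd_below I \<Longrightarrow> filterlim g at_infinity at_bot"
      using assms that by (auto simp: piecewise_smooth_curve_def piecewise_C1_differentiable_on_def)
    have comp: "compact (g ` {t \<in> I. norm (g t) \<le> R})" for R
    proof (rule compact_continuous_image)
      show "continuous_on {t \<in> I. norm (g t) \<le> R} g" using ps(2) by (rule continuous_on_subset) auto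
      have "closed (I \<inter> (\<lambda>t. norm (g t)) -` {..R})"
        by (intro continuous_closed_preimage ps(1) continuous_intros ps(2))
      moreover have "I \<inter> (\<lambda>t. norm (g t)) -` {..R} = {t \<in> I. norm (g t) \<le> R}" by auto
      ultimately have cl: "closed {t \<in> I. norm (g t) \<le> R}" by simp
      have "bdd_above {t \<in> I. norm (g t) \<le> R}"
      proof (cases "bdd_above I")
        case True
        then show ?thesis by (rule bdd_above_mono) auto
      next
        case False
        then have "\<forall>\<^sub>F t in at_top. norm (g t) \<ge> max 1 (R + 1)"
          using ps(3) filterlim_at_infinity[OF order_refl, of g "at_top"] by (simp del: max.bounded_iff)
        then have "\<forall>\<^sub>F t in at_top. norm (g t) \<ge> R + 1" by eventually_elim simp
        then obtain c where c: "\<And>t. t \<ge> c \<Longrightarrow> norm (g t) \<ge> R + 1" unfolding eventually_at_top_linorder by blast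
        show ?thesis
        proof (rule bdd_aboveI[of _ c])
          fix x assume "x \<in> {t \<in> I. norm (g t) \<le> R}"
          then show "x \<le> c" using c[of x] by (cases "x \<le> c") auto
        qed
      qed
      moreover have "bdd_below {t \<in> I. norm (g t) \<le> R}"
      proof (cases "bdd_below I")
        case True
        then show ?thesis by (rule bdd_below_mono) auto
      next
        case False
        then have "\<forall>\<^sub>F t in at_bot. norm (g t) \<ge> max 1 (R + 1)"
          using ps(4) filterlim_at_infinity[OF order_refl, of g "at_bot"] by (simp del: max.bounded_iff)
        then have "\<forall>\<^sub>F t in at_bot. norm (g t) \<ge> R + 1" by eventually_elim simp
        then obtain c where c: "\<And>t. t \<le> c \<Longrightarrow> norm (g t) \<ge> R + 1" unfolding eventually_at_bot_linorder by blast
        show ?thesis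
        proof (rule bdd_belowI[of _ c])
          fix x assume "x \<in> {t \<in> I. norm (g t) \<le> R}"
          then show "c \<le> x" using c[of x] by (cases "c \<le> x") auto
        qed
      qed
      ultimately have "bounded {t \<in> I. norm (g t) \<le> R}"
        by (meson bdd_above_def bdd_below_def bounded_closed_interval bounded_subset subsetI atLeastAtMost_iff)
      then show "compact {t \<in> I. norm (g t) \<le> R}" using cl compact_eq_bounded_closed by blast
    qed
    show ?thesis
      unfolding closed_sequential_limits
    proof safe
      fix y l assume y: "\<forall>n. y n \<in> g ` I" and lim: "y \<longlonglongrightarrow> l"
      obtain R where R: "\<And>n. norm (y n) \<le> R"
        using convergent_imp_bounded[OF lim] by (auto simp: bounded_iff)
      have mem: "y n \<in> g ` {t \<in> I. norm (g t) \<le> R}" for n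
      proof -
        obtain t where "t \<in> I" "y n = g t" using y by blast
        then show ?thesis using R[of n] by (intro image_eqI[of _ _ t]) auto
      qed
      have "closed (g ` {t \<in> I. norm (g t) \<le> R})" by (rule compact_imp_closed[OF comp])
      then have "l \<in> g ` {t \<in> I. norm (g t) \<le> R}"
        using mem lim by (rule closed_sequentially)
      then show "l \<in> g ` I" by (rule imageE) simp
    qed
  qed
  then show ?thesis unfolding curve_image_def by (intro closed_UN) auto
qed

section \<open>Scalar orthogonality and Hankel matrices\<close>

lemma poly_as_sum_lessThan:
  fixes p :: "complex poly"
  assumes "degree p < m"
  shows "poly p x = (\<Sum>i<m. coeff p i * x ^ i)"
proof -
  have "(\<Sum>i\<le>degree p. coeff p i * x ^ i) = (\<Sum>i<m. coeff p i * x ^ i)"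
    using assms by (intro sum.mono_neutral_left) (auto simp: coeff_eq_0)
  then show ?thesis using poly_altdef[of p x] by simp
qed

lemma poly_sum_monoms_lessThan:
  fixes p :: "complex poly"
  assumes "degree p < m"
  shows "p = (\<Sum>i<m. monom (coeff p i) i)"
proof (rule poly_eqI)
  fix k
  show "coeff p k = coeff (\<Sum>i<m. monom (coeff p i) i) k"
    using assms by (auto simp: coeff_sum coeff_eq_0)
qed

lemma degree_sum_less_nat:
  assumes "n > 0" "\<And>i. i \<in> S \<Longrightarrow> degree (f i) < n"
  shows "degree (\<Sum>i\<in>S. f i) < n"
proof -
  have "degree (\<Sum>i\<in>S. f i) \<le> n - 1"
  proof (cases "finite S")
    case True
    then show ?thesis using assms by (intro degree_sum_le) force+
  qed simp
  then show ?thesis using assms(1) by linarith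
qed

lemma power_sums_eq_off_finite:
  fixes a b :: "nat \<Rightarrow> complex"
  assumes "finite Z" "\<And>x. x \<notin> Z \<Longrightarrow> (\<Sum>i<n. a i * x ^ i) = (\<Sum>i<n. b i * x ^ i)" "k < n"
  shows "a k = b k"
proof -
  have "(\<Sum>i<n. monom (a i) i) = (\<Sum>i<n. monom (b i) i)"
    by (rule poly_eq_off_finite[OF assms(1)]) (use assms(2) in \<open>simp add: poly_sum poly_monom\<close>)
  then have "coeff (\<Sum>i<n. monom (a i) i) k = coeff (\<Sum>i<n. monom (b i) i) k" by simp
  then show ?thesis using assms(3) by (simp add: coeff_sum)
qed

definition kernel_fun :: "nat \<Rightarrow> (nat \<Rightarrow> nat \<Rightarrow> complex) \<Rightarrow> complex \<Rightarrow> complex \<Rightarrow> complex" where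
  "kernel_fun n C \<omega> \<zeta> = (\<Sum>k<n. \<Sum>l<n. C k l * \<omega> ^ k * \<zeta> ^ l)"

text \<open>The kernel as a polynomial in its first variable.\<close>

definition kernel_poly :: "nat \<Rightarrow> (nat \<Rightarrow> nat \<Rightarrow> complex) \<Rightarrow> complex \<Rightarrow> complex poly" where
  "kernel_poly n C \<zeta> = (\<Sum>l<n. smult (\<zeta> ^ l) (\<Sum>k<n. monom (C k l) k))"

lemma poly_kernel_poly: "poly (kernel_poly n C \<zeta>) \<omega> = kernel_fun n C \<omega> \<zeta>"
proof -
  have "poly (kernel_poly n C \<zeta>) \<omega> = (\<Sum>l<n. \<Sum>k<n. C k l * \<omega> ^ k * \<zeta> ^ l)"
    by (simp add: kernel_poly_def poly_sum poly_monom sum_distrib_left mult_ac)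
  then show ?thesis unfolding kernel_fun_def by (subst sum.swap)
qed

lemma degree_monom_sum: "n > 0 \<Longrightarrow> degree (\<Sum>k<n. monom (a k) k) < n" for a :: "nat \<Rightarrow> complex"
  by (rule degree_sum_less_nat) (auto intro: le_less_trans[OF degree_monom_le])

lemma degree_kernel_poly: "n > 0 \<Longrightarrow> degree (kernel_poly n C \<zeta>) < n"
  unfolding kernel_poly_def
  by (rule degree_sum_less_nat, assumption) (rule le_less_trans[OF degree_smult_le degree_monom_sum])

lemma matrix_mult_1: "((A :: complex^1^1) ** B) $ 1 $ 1 = A $ 1 $ 1 * B $ 1 $ 1"
  by (simp add: matrix_matrix_mult_def)

lemma mat_1_component [simp]: "(mat x :: complex^1^1) $ i $ j = x"
  by (simp add: mat_def) (metis (full_types) num1_eq1)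

lemma mat_polys_1:
  fixes P :: "complex \<Rightarrow> complex^1^1"
  assumes "P \<in> mat_polys m"
  shows "\<exists>c. \<forall>z. P z $ 1 $ 1 = (\<Sum>l\<le>m. c l * z ^ l)"
proof -
  obtain D :: "nat \<Rightarrow> complex^1^1" where "P = (\<lambda>z. \<Sum>l\<le>m. smult_mat (z ^ l) (D l))"
    using assms unfolding mat_polys_def by blast
  then have "\<forall>z. P z $ 1 $ 1 = (\<Sum>l\<le>m. D l $ 1 $ 1 * z ^ l)"
    by (simp add: smult_mat_def mult.commute)
  then show ?thesis by (intro exI[of _ "\<lambda>l. D l $ 1 $ 1"])
qed

lemma monomial_mat_polys:
  assumes "m \<le> k"
  shows "(\<lambda>z. mat (z ^ m)) \<in> mat_polys k"
proof -
  have "mat (z ^ m) = (\<Sum>l\<le>k. smult_mat (z ^ l) (if l = m then mat 1 else 0 :: complex^'a^'a))" for z :: complex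
  proof -
    have "(\<Sum>l\<le>k. smult_mat (z ^ l) (if l = m then mat 1 else 0 :: complex^'a^'a)) =
        (\<Sum>l\<le>k. if l = m then smult_mat (z ^ m) (mat 1) else 0)"
      by (intro sum.cong refl) (auto simp: smult_mat_def vec_eq_iff)
    also have "\<dots> = smult_mat (z ^ m) (mat 1)" using assms by simp
    finally show ?thesis by (simp add: smult_mat_def mat_def vec_eq_iff)
  qed
  then show ?thesis unfolding mat_polys_def mem_Collect_eq
    by (intro exI[of _ "\<lambda>l. if l = m then mat 1 else 0"] ext)
qed

lemma bivariate_scalar:
  assumes "n > 0"
  shows "(\<lambda>\<omega> \<zeta>. mat (K \<omega> \<zeta>) :: complex^1^1) \<in> bivariate_mat_polys (n - 1) \<longleftrightarrow> (\<exists>C. K = kernel_fun n C)"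
proof
  have set: "{..n - 1} = {..<n}" using assms by auto
  {
    assume "(\<lambda>\<omega> \<zeta>. mat (K \<omega> \<zeta>) :: complex^1^1) \<in> bivariate_mat_polys (n - 1)"
    then obtain C :: "nat \<Rightarrow> nat \<Rightarrow> complex^1^1" where
      C: "(\<lambda>\<omega> \<zeta>. mat (K \<omega> \<zeta>)) = (\<lambda>w z. \<Sum>k\<le>n - 1. \<Sum>l\<le>n - 1. smult_mat (w ^ k * z ^ l) (C k l))"
      unfolding bivariate_mat_polys_def by blast
    have "K \<omega> \<zeta> = kernel_fun n (\<lambda>k l. C k l $ 1 $ 1) \<omega> \<zeta>" for \<omega> \<zeta>
    proof -
      have "mat (K \<omega> \<zeta>) = (\<Sum>k<n. \<Sum>l<n. smult_mat (\<omega> ^ k * \<zeta> ^ l) (C k l))"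
        using fun_cong[OF fun_cong[OF C]] unfolding set .
      then have "(mat (K \<omega> \<zeta>) :: complex^1^1) $ 1 $ 1 = (\<Sum>k<n. \<Sum>l<n. smult_mat (\<omega> ^ k * \<zeta> ^ l) (C k l)) $ 1 $ 1"
        by (rule arg_cong)
      then show ?thesis by (simp add: kernel_fun_def smult_mat_def mult_ac)
    qed
    then show "\<exists>C. K = kernel_fun n C" by blast
  }
  {
    assume "\<exists>C. K = kernel_fun n C"
    then obtain C where C: "K = kernel_fun n C" ..
    have "mat (K w z) = (\<Sum>k\<le>n - 1. \<Sum>l\<le>n - 1. smult_mat (w ^ k * z ^ l) (mat (C k l) :: complex^1^1))" for w z
      unfolding set by (simp add: vec_eq_iff C kernel_fun_def smult_mat_def mult_ac)
    then show "(\<lambda>\<omega> \<zeta>. mat (K \<omega> \<zeta>) :: complex^1^1) \<in> bivariate_mat_polys (n - 1)"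
      unfolding bivariate_mat_polys_def mem_Collect_eq by (intro exI[of _ "\<lambda>k l. mat (C k l)"] ext)
  }
qed

text \<open>The assumed convergence provides the moments of order \<open>i < 2 * n\<close>, the ones that occur in the
  pairings of polynomials of degree at most \<open>n\<close> with polynomials of smaller degree.\<close>

locale moment_functional = linear_integral +
  fixes w :: "complex \<Rightarrow> complex" and n :: nat
  assumes n_pos: "n > 0"
    and convergence: "\<And>p k. degree p \<le> n \<Longrightarrow> k < n \<Longrightarrow> \<exists>v. J (\<lambda>\<zeta>. poly p \<zeta> * w \<zeta> * \<zeta> ^ k) v"
begin

definition \<mu> :: "nat \<Rightarrow> complex" where "\<mu> i = (THE v. J (\<lambda>\<zeta>. \<zeta> ^ i * w \<zeta>) v)"

text \<open>Integration against the weight on polynomials of degree less than \<open>2 * n\<close>. Higher coefficients are cut off, which makes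
  \<open>L\<close> linear on all polynomials.\<close>

definition L :: "complex poly \<Rightarrow> complex" where "L p = (\<Sum>i<2*n. coeff p i * \<mu> i)"

lemma moment: "i < 2 * n \<Longrightarrow> J (\<lambda>\<zeta>. \<zeta> ^ i * w \<zeta>) (\<mu> i)"
proof -
  assume i: "i < 2 * n"
  \<comment> \<open>The exponent is split as \<open>i = a + (i - a)\<close> with \<open>a \<le> n\<close> and \<open>i - a < n\<close>; this is possible up to \<open>i = 2 n - 1\<close>.\<close>
  define a where "a = min i n"
  have "degree (monom (1 :: complex) a) \<le> n" by (rule order_trans[OF degree_monom_le]) (simp add: a_def)
  moreover have "i - a < n" using i n_pos by (auto simp: a_def)
  ultimately obtain v where "J (\<lambda>\<zeta>. poly (monom 1 a) \<zeta> * w \<zeta> * \<zeta> ^ (i - a)) v"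
    using convergence by blast
  moreover have "poly (monom 1 a) \<zeta> * w \<zeta> * \<zeta> ^ (i - a) = \<zeta> ^ i * w \<zeta>" for \<zeta>
  proof -
    have "\<zeta> ^ i = \<zeta> ^ a * \<zeta> ^ (i - a)" by (simp add: a_def flip: power_add)
    then show ?thesis by (simp add: poly_monom)
  qed
  ultimately have v: "J (\<lambda>\<zeta>. \<zeta> ^ i * w \<zeta>) v" by simp
  show ?thesis unfolding \<mu>_def
  proof (rule theI)
    show "J (\<lambda>\<zeta>. \<zeta> ^ i * w \<zeta>) v" by (rule v)
    show "x = v" if "J (\<lambda>\<zeta>. \<zeta> ^ i * w \<zeta>) x" for x using that v by (rule unique)
  qed
qed

lemma L_add: "L (p + q) = L p + L q" and L_diff: "L (p - q) = L p - L q"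
  and L_smult: "L (smult c p) = c * L p" and L_0: "L 0 = 0"
  by (simp_all add: L_def algebra_simps sum.distrib sum_subtractf sum_distrib_left)

lemma L_sum: "L (\<Sum>i\<in>S. f i) = (\<Sum>i\<in>S. L (f i))"
  by (induction S rule: infinite_finite_induct) (simp_all add: L_add L_0)

lemma L_monom: "i < 2 * n \<Longrightarrow> L (monom c i) = c * \<mu> i"
proof -
  assume i: "i < 2 * n"
  have "L (monom c i) = (\<Sum>j<2*n. if j = i then c * \<mu> i else 0)"
    unfolding L_def by (intro sum.cong) auto
  then show ?thesis using i by simp
qed

lemma L_integral: "degree p < 2 * n \<Longrightarrow> J (\<lambda>\<zeta>. poly p \<zeta> * w \<zeta>) (L p)"
proof -
  assume p: "degree p < 2 * n"
  have "J (\<lambda>\<zeta>. \<Sum>i<2*n. coeff p i * (\<zeta> ^ i * w \<zeta>)) (\<Sum>i<2*n. coeff p i * \<mu> i)"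
    by (intro sum cmult moment) simp
  moreover have "(\<Sum>i<2*n. coeff p i * (\<zeta> ^ i * w \<zeta>)) = poly p \<zeta> * w \<zeta>" for \<zeta>
    by (simp add: poly_as_sum_lessThan[OF p] sum_distrib_right mult.assoc)
  ultimately show ?thesis by (simp add: L_def)
qed

lemma L_iff: "degree p < 2 * n \<Longrightarrow> J (\<lambda>\<zeta>. poly p \<zeta> * w \<zeta>) v \<longleftrightarrow> v = L p"
  using L_integral unique by blast

lemma L_product_iff:
  assumes "degree p + degree q < 2 * n"
  shows "J (\<lambda>\<zeta>. poly p \<zeta> * w \<zeta> * poly q \<zeta>) v \<longleftrightarrow> v = L (p * q)"
proof -
  have "degree (p * q) < 2 * n" using degree_mult_le[of p q] assms by linarith
  from L_iff[OF this, of v] show ?thesis by (simp add: mult_ac)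
qed

text \<open>The coefficients of the kernel form a right inverse of the Hankel matrix \<open>\<mu> (m + k)\<close>.\<close>

definition inverts_moments :: "(nat \<Rightarrow> nat \<Rightarrow> complex) \<Rightarrow> bool" where
  "inverts_moments C \<longleftrightarrow> (\<forall>m<n. \<forall>l<n. (\<Sum>k<n. \<mu> (m + k) * C k l) = (if m = l then 1 else 0))"

text \<open>For a symmetric matrix \<open>H\<close> with \<open>H C = 1 = H C'\<close> one has \<open>C' = (H C)\<^sup>T C' = C\<^sup>T (H C') = C\<^sup>T\<close>.
  With \<open>C' = C\<close> this is the symmetry of the inverse, and for two inverses it gives their uniqueness.\<close>

lemma inverts_moments_transpose:
  assumes "inverts_moments C" "inverts_moments C'" "a < n" "b < n"
  shows "C' a b = C b a"
proof -
  have H: "(\<Sum>k<n. \<mu> (m + k) * C k l) = (if m = l then 1 else 0)"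
    "(\<Sum>k<n. \<mu> (m + k) * C' k l) = (if m = l then 1 else 0)" if "m < n" "l < n" for m l
    using assms(1,2) that by (auto simp: inverts_moments_def)
  have "C' a b = (\<Sum>m<n. (if m = a then 1 else 0) * C' m b)"
    using assms by (simp add: if_distrib[of "\<lambda>x. x * _"] cong: if_cong)
  also have "\<dots> = (\<Sum>m<n. (\<Sum>k<n. \<mu> (m + k) * C k a) * C' m b)"
    using assms by (intro sum.cong refl) (simp add: H)
  also have "\<dots> = (\<Sum>m<n. \<Sum>k<n. C k a * (\<mu> (k + m) * C' m b))"
    unfolding sum_distrib_right by (intro sum.cong refl) (simp add: add.commute mult_ac)
  also have "\<dots> = (\<Sum>k<n. C k a * (\<Sum>m<n. \<mu> (k + m) * C' m b))"
    by (subst sum.swap) (simp add: sum_distrib_left)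
  also have "\<dots> = (\<Sum>k<n. C k a * (if k = b then 1 else 0))"
    using assms by (intro sum.cong refl) (simp add: H)
  also have "\<dots> = C b a"
    using assms by (simp add: if_distrib[of "\<lambda>x. _ * x"] cong: if_cong)
  finally show ?thesis .
qed

lemma inverts_moments_symmetric: "inverts_moments C \<Longrightarrow> a < n \<Longrightarrow> b < n \<Longrightarrow> C a b = C b a"
  by (rule inverts_moments_transpose)

lemma inverts_moments_unique:
  assumes "inverts_moments C" "inverts_moments C'"
  shows "kernel_fun n C' = kernel_fun n C"
proof -
  have "C' a b = C a b" if "a < n" "b < n" for a b
    using inverts_moments_transpose[OF assms that] inverts_moments_symmetric[OF assms(1) that] by simp
  then show ?thesis unfolding kernel_fun_def by (intro ext sum.cong refl) auto
qed

lemma kernel_integral_left: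
  assumes "m < n"
  shows "J (\<lambda>\<omega>. \<omega> ^ m * w \<omega> * kernel_fun n C \<omega> \<zeta>) (\<Sum>l<n. (\<Sum>k<n. \<mu> (m + k) * C k l) * \<zeta> ^ l)"
proof -
  have "J (\<lambda>\<omega>. \<Sum>l<n. \<Sum>k<n. (C k l * \<zeta> ^ l) * (\<omega> ^ (m + k) * w \<omega>)) (\<Sum>l<n. \<Sum>k<n. (C k l * \<zeta> ^ l) * \<mu> (m + k))"
    using assms by (intro sum cmult moment) auto
  moreover have "(\<Sum>l<n. \<Sum>k<n. (C k l * \<zeta> ^ l) * (\<omega> ^ (m + k) * w \<omega>)) = \<omega> ^ m * w \<omega> * kernel_fun n C \<omega> \<zeta>" for \<omega>
    unfolding poly_kernel_poly[symmetric] kernel_poly_def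
    by (simp add: poly_sum poly_monom sum_distrib_left power_add mult_ac)
  moreover have "(\<Sum>l<n. \<Sum>k<n. (C k l * \<zeta> ^ l) * \<mu> (m + k)) = (\<Sum>l<n. (\<Sum>k<n. \<mu> (m + k) * C k l) * \<zeta> ^ l)"
    unfolding sum_distrib_right by (intro sum.cong refl) (simp only: mult_ac)
  ultimately show ?thesis by simp
qed

text \<open>Finitely many second arguments may be missing, since both sides are polynomials in it.\<close>

lemma left_reproducing_imp_inverts:
  assumes "finite Z" "\<And>m \<zeta>. m < n \<Longrightarrow> \<zeta> \<notin> Z \<Longrightarrow> J (\<lambda>\<omega>. \<omega> ^ m * w \<omega> * kernel_fun n C \<omega> \<zeta>) (\<zeta> ^ m)"
  shows "inverts_moments C"
  unfolding inverts_moments_def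
proof (intro allI impI)
  fix m l assume m: "m < n" and l: "l < n"
  show "(\<Sum>k<n. \<mu> (m + k) * C k l) = (if m = l then 1 else 0)"
  proof (rule power_sums_eq_off_finite[OF assms(1) _ l])
    fix \<zeta> assume "\<zeta> \<notin> Z"
    from unique[OF kernel_integral_left[OF m] assms(2)[OF m this]]
    show "(\<Sum>l<n. (\<Sum>k<n. \<mu> (m + k) * C k l) * \<zeta> ^ l) = (\<Sum>l<n. (if m = l then 1 else 0) * \<zeta> ^ l)"
      using m by (simp add: if_distrib[of "\<lambda>x. x * _"] cong: if_cong)
  qed
qed

lemma kernel_fun_transpose: "kernel_fun n (\<lambda>k l. C l k) \<omega> \<zeta> = kernel_fun n C \<zeta> \<omega>"
  unfolding kernel_fun_def by (subst sum.swap) (simp add: mult_ac)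

text \<open>The transposed kernel reproduces from the left, so its coefficients invert the Hankel matrix and
  are therefore symmetric.\<close>

lemma right_reproducing_imp_inverts:
  assumes "finite Z" "\<And>m \<omega>. m < n \<Longrightarrow> \<omega> \<notin> Z \<Longrightarrow> J (\<lambda>\<zeta>. kernel_fun n C \<omega> \<zeta> * w \<zeta> * \<zeta> ^ m) (\<omega> ^ m)"
  shows "inverts_moments C"
proof -
  have T: "inverts_moments (\<lambda>k l. C l k)"
  proof (rule left_reproducing_imp_inverts[OF assms(1)])
    fix m \<zeta> assume "m < n" "\<zeta> \<notin> Z"
    then have "J (\<lambda>x. kernel_fun n C \<zeta> x * w x * x ^ m) (\<zeta> ^ m)" by (rule assms(2))
    moreover have "(\<lambda>x. x ^ m * w x * kernel_fun n (\<lambda>k l. C l k) x \<zeta>) = (\<lambda>x. kernel_fun n C \<zeta> x * w x * x ^ m)"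
      by (rule ext, subst kernel_fun_transpose) (simp only: mult_ac)
    ultimately show "J (\<lambda>x. x ^ m * w x * kernel_fun n (\<lambda>k l. C l k) x \<zeta>) (\<zeta> ^ m)" by simp
  qed
  show ?thesis
    unfolding inverts_moments_def
  proof (intro allI impI)
    fix m l assume ml: "m < n" "l < n"
    have "(\<Sum>k<n. \<mu> (m + k) * C k l) = (\<Sum>k<n. \<mu> (m + k) * C l k)"
      using inverts_moments_symmetric[OF T] ml by (intro sum.cong refl) auto
    then show "(\<Sum>k<n. \<mu> (m + k) * C k l) = (if m = l then 1 else 0)"
      using T ml by (auto simp: inverts_moments_def)
  qed
qed

end

locale moment_kernel = moment_functional +
  fixes C :: "nat \<Rightarrow> nat \<Rightarrow> complex"
  assumes inverts: "inverts_moments C"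
begin

abbreviation K where "K \<equiv> kernel_fun n C"

abbreviation Kp where "Kp \<equiv> kernel_poly n C"

lemma K_symmetric: "K \<omega> \<zeta> = K \<zeta> \<omega>"
proof -
  have "K \<omega> \<zeta> = (\<Sum>k<n. \<Sum>l<n. C l k * \<omega> ^ k * \<zeta> ^ l)"
    unfolding kernel_fun_def using inverts_moments_symmetric[OF inverts] by (intro sum.cong refl) auto
  also have "\<dots> = K \<zeta> \<omega>"
    unfolding kernel_fun_def by (subst sum.swap) (simp add: mult_ac)
  finally show ?thesis .
qed

lemma K_left: "m < n \<Longrightarrow> J (\<lambda>\<omega>. \<omega> ^ m * w \<omega> * K \<omega> \<zeta>) (\<zeta> ^ m)"
proof -
  assume m: "m < n"
  have "(\<Sum>l<n. (\<Sum>k<n. \<mu> (m + k) * C k l) * \<zeta> ^ l) = (\<Sum>l<n. (if m = l then 1 else 0) * \<zeta> ^ l)"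
    using inverts m by (intro sum.cong refl) (simp add: inverts_moments_def)
  also have "\<dots> = \<zeta> ^ m" using m by (simp add: if_distrib[of "\<lambda>x. x * _"] cong: if_cong)
  finally show ?thesis using kernel_integral_left[OF m, of C \<zeta>] by simp
qed

lemma reproducing: "degree a < n \<Longrightarrow> L (a * Kp \<zeta>) = poly a \<zeta>"
proof -
  assume a: "degree a < n"
  have m: "L (monom 1 m * Kp \<zeta>) = \<zeta> ^ m" if "m < n" for m
  proof -
    have "J (\<lambda>\<omega>. poly (monom 1 m) \<omega> * w \<omega> * poly (Kp \<zeta>) \<omega>) (\<zeta> ^ m)"
      using K_left[OF that, of \<zeta>] by (simp add: poly_kernel_poly poly_monom)
    moreover have "degree (monom (1 :: complex) m) + degree (Kp \<zeta>) < 2 * n"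
      using degree_kernel_poly[OF n_pos, of C \<zeta>] degree_monom_le[of "1 :: complex" m] that by linarith
    ultimately show ?thesis using L_product_iff by metis
  qed
  have "a * Kp \<zeta> = (\<Sum>i<n. smult (coeff a i) (monom 1 i * Kp \<zeta>))"
    by (subst poly_sum_monoms_lessThan[OF a]) (simp add: sum_distrib_right smult_monom flip: mult_smult_left)
  then have "L (a * Kp \<zeta>) = (\<Sum>i<n. coeff a i * \<zeta> ^ i)" by (simp add: L_sum L_smult m)
  then show ?thesis by (simp add: poly_as_sum_lessThan[OF a])
qed

text \<open>The reproducing property recovers \<open>a\<close> from its pairings with the monomials.\<close>

lemma nondegenerate:
  assumes "degree a < n" "\<And>k. k < n \<Longrightarrow> L (a * monom 1 k) = 0"
  shows "a = 0"
proof (rule poly_eq_off_finite[of "{}"])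
  fix \<zeta>
  have "a * Kp \<zeta> = (\<Sum>i<n. smult (coeff (Kp \<zeta>) i) (a * monom 1 i))"
    by (subst poly_sum_monoms_lessThan[OF degree_kernel_poly[OF n_pos, of C \<zeta>]])
      (simp add: sum_distrib_left smult_monom flip: mult_smult_right)
  then have "L (a * Kp \<zeta>) = 0" using assms(2) by (simp add: L_sum L_smult)
  then show "poly a \<zeta> = poly 0 \<zeta>" using reproducing[OF assms(1)] by simp
qed simp

lemma is_scalar_q_iff:
  "is_scalar_q J w n q \<longleftrightarrow> degree q < n \<and> (\<forall>k<n. L (q * monom 1 k) = (if k = n - 1 then 1 else 0))"
proof -
  have *: "J (\<lambda>\<zeta>. poly q \<zeta> * w \<zeta> * \<zeta> ^ k) v \<longleftrightarrow> L (q * monom 1 k) = v" if "degree q < n" "k < n" for k v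
  proof -
    have "degree q + degree (monom (1 :: complex) k) < 2 * n"
      using that degree_monom_le[of "1 :: complex" k] by linarith
    from L_product_iff[OF this, of v] show ?thesis by (auto simp: poly_monom)
  qed
  have "degree q \<le> n - 1 \<longleftrightarrow> degree q < n" using n_pos by auto
  then show ?thesis
    unfolding is_scalar_q_def by (auto simp: *)
qed

lemma is_scalar_p_iff:
  "is_scalar_p J w n p \<longleftrightarrow> degree p = n \<and> lead_coeff p = 1 \<and> (\<forall>k<n. L (p * monom 1 k) = 0)"
proof -
  have *: "J (\<lambda>\<zeta>. poly p \<zeta> * w \<zeta> * \<zeta> ^ k) v \<longleftrightarrow> L (p * monom 1 k) = v" if "degree p = n" "k < n" for k v
  proof -
    have "degree p + degree (monom (1 :: complex) k) < 2 * n"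
      using that degree_monom_le[of "1 :: complex" k] by linarith
    from L_product_iff[OF this, of v] show ?thesis by (auto simp: poly_monom)
  qed
  show ?thesis
    unfolding is_scalar_p_def by (auto simp: *)
qed

text \<open>The columns of the inverse Hankel matrix: the basis dual to the monomials. The last one is the polynomial \<open>q\<close> of the
  Christoffel--Darboux formula.\<close>

definition dual_poly :: "nat \<Rightarrow> complex poly" where "dual_poly l = (\<Sum>k<n. monom (C k l) k)"

lemma dual_poly: "degree (dual_poly l) < n" "m < n \<Longrightarrow> l < n \<Longrightarrow> L (dual_poly l * monom 1 m) = (if m = l then 1 else 0)"
proof -
  show "degree (dual_poly l) < n" unfolding dual_poly_def by (rule degree_monom_sum[OF n_pos])
  assume ml: "m < n" "l < n"
  have "dual_poly l * monom 1 m = (\<Sum>k<n. monom (C k l) (m + k))"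
    by (simp add: dual_poly_def sum_distrib_right mult_monom add.commute)
  then have "L (dual_poly l * monom 1 m) = (\<Sum>k<n. \<mu> (m + k) * C k l)"
    using ml by (simp add: L_sum L_monom mult.commute)
  then show "L (dual_poly l * monom 1 m) = (if m = l then 1 else 0)"
    using inverts ml by (simp add: inverts_moments_def)
qed

lemma ex1_scalar_q: "\<exists>!q. is_scalar_q J w n q" and scalar_q_eq: "is_scalar_q J w n q \<Longrightarrow> q = dual_poly (n - 1)"
proof -
  have ex: "is_scalar_q J w n (dual_poly (n - 1))"
    using dual_poly n_pos by (simp add: is_scalar_q_iff)
  have un: "q1 = q2" if "is_scalar_q J w n q1" "is_scalar_q J w n q2" for q1 q2
  proof -
    have "q1 - q2 = 0"
    proof (rule nondegenerate)
      show "degree (q1 - q2) < n" using that by (simp add: is_scalar_q_iff degree_diff_less)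
      show "L ((q1 - q2) * monom 1 k) = 0" if "k < n" for k
        using \<open>is_scalar_q J w n q1\<close> \<open>is_scalar_q J w n q2\<close> that
        by (simp add: is_scalar_q_iff left_diff_distrib L_diff)
    qed
    then show ?thesis by simp
  qed
  show "\<exists>!q. is_scalar_q J w n q" using ex un by blast
  show "q = dual_poly (n - 1)" if "is_scalar_q J w n q" using ex un that by blast
qed

lemma degree_monic_diff:
  assumes "degree p1 = n" "degree p2 = n" "lead_coeff p1 = 1" "lead_coeff p2 = (1 :: complex)"
  shows "degree (p1 - p2) < n"
  using n_pos by (rule degree_lessI[OF disjI2]) (use assms in \<open>auto simp: le_less coeff_eq_0\<close>)

text \<open>Subtract from \<open>\<zeta>\<^sup>n\<close> its projection to lower degree, which is expressed by the dual basis.\<close>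

lemma ex1_scalar_p: "\<exists>!p. is_scalar_p J w n p"
proof -
  define p where "p = monom 1 n - (\<Sum>k<n. smult (\<mu> (n + k)) (dual_poly k))"
  have lt: "degree (\<Sum>k<n. smult (\<mu> (n + k)) (dual_poly k)) < n"
    by (rule degree_sum_less_nat[OF n_pos]) (rule le_less_trans[OF degree_smult_le dual_poly(1)])
  have degp: "degree p = n"
    unfolding p_def diff_conv_add_uminus using lt by (subst degree_add_eq_left) (simp_all add: degree_monom_eq)
  have "coeff p n = 1" unfolding p_def using lt by (simp add: coeff_eq_0)
  then have lead: "lead_coeff p = 1" using degp by simp
  have ex: "is_scalar_p J w n p"
    unfolding is_scalar_p_iff
  proof (intro conjI degp lead allI impI)
    fix m assume m: "m < n"
    have "p * monom 1 m = monom 1 (n + m) - (\<Sum>k<n. smult (\<mu> (n + k)) (dual_poly k * monom 1 m))"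
      by (simp add: p_def left_diff_distrib mult_monom sum_distrib_right)
    then have "L (p * monom 1 m) = \<mu> (n + m) - (\<Sum>k<n. \<mu> (n + k) * (if m = k then 1 else 0))"
      using m by (simp add: L_diff L_sum L_smult L_monom dual_poly(2))
    then show "L (p * monom 1 m) = 0" using m by (simp add: if_distrib[of "\<lambda>x. _ * x"] cong: if_cong)
  qed
  have un: "p1 = p2" if "is_scalar_p J w n p1" "is_scalar_p J w n p2" for p1 p2
  proof -
    have "p1 - p2 = 0"
    proof (rule nondegenerate)
      show "degree (p1 - p2) < n" using that unfolding is_scalar_p_iff by (intro degree_monic_diff) blast+
      show "L ((p1 - p2) * monom 1 k) = 0" if "k < n" for k
        using \<open>is_scalar_p J w n p1\<close> \<open>is_scalar_p J w n p2\<close> that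
        by (simp add: is_scalar_p_iff left_diff_distrib L_diff)
    qed
    then show ?thesis by simp
  qed
  show ?thesis using ex un by blast
qed

text \<open>The coefficient of highest degree in \<open>s * K s \<omega>\<close> is \<open>q \<omega>\<close>, so this is \<open>q \<omega> * p s\<close> plus a polynomial of degree less
  than \<open>n\<close> in \<open>s\<close>. Integrated against \<open>K s \<zeta>\<close>, the first part vanishes by orthogonality and the second is reproduced. The result
  must be symmetric in \<open>\<omega>\<close> and \<open>\<zeta>\<close>.\<close>

lemma christoffel_darboux:
  assumes p: "is_scalar_p J w n p" and q: "is_scalar_q J w n q"
  shows "(\<zeta> - \<omega>) * K \<omega> \<zeta> = poly q \<omega> * poly p \<zeta> - poly p \<omega> * poly q \<zeta>"
proof -
  have p': "degree p = n" "lead_coeff p = 1" "\<And>k. k < n \<Longrightarrow> L (p * monom 1 k) = 0"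
    using p by (auto simp: is_scalar_p_iff)
  have Lp: "L (p * a) = 0" if "degree a < n" for a
  proof -
    have "p * a = (\<Sum>i<n. smult (coeff a i) (p * monom 1 i))"
      by (subst poly_sum_monoms_lessThan[OF that]) (simp add: sum_distrib_left smult_monom flip: mult_smult_right)
    then show ?thesis by (simp add: L_sum L_smult p'(3))
  qed
  have lead: "coeff (Kp \<omega>) (n - 1) = poly q \<omega>" for \<omega>
  proof -
    have "coeff (Kp \<omega>) (n - 1) = (\<Sum>l<n. \<omega> ^ l * C (n - 1) l)"
      using n_pos by (simp add: kernel_poly_def coeff_sum)
    also have "\<dots> = (\<Sum>l<n. C l (n - 1) * \<omega> ^ l)"
      using inverts_moments_symmetric[OF inverts] n_pos by (intro sum.cong refl) (auto simp: mult.commute)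
    also have "\<dots> = poly q \<omega>"
      unfolding scalar_q_eq[OF q] by (simp add: dual_poly_def poly_sum poly_monom)
    finally show ?thesis .
  qed
  have key: "L (monom 1 1 * Kp \<omega> * Kp \<zeta>) = \<zeta> * K \<zeta> \<omega> - poly q \<omega> * poly p \<zeta>" for \<omega> \<zeta>
  proof -
    define r where "r = monom 1 1 * Kp \<omega> - smult (poly q \<omega>) p"
    have dK: "degree (Kp \<omega>) < n" by (rule degree_kernel_poly[OF n_pos])
    have "degree r < n"
    proof (rule degree_lessI[OF disjI2[OF n_pos]], intro allI impI)
      fix k assume k: "n \<le> k"
      have "coeff (monom 1 1 * Kp \<omega>) k = coeff (Kp \<omega>) (k - 1)"
        using k n_pos by (simp add: coeff_monom_mult)
      then show "coeff r k = 0"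
        using k lead[of \<omega>] p'(1,2) dK n_pos by (cases "k = n") (auto simp: r_def coeff_eq_0)
    qed
    have "monom 1 1 * Kp \<omega> = smult (poly q \<omega>) p + r" by (simp add: r_def)
    then have "L (monom 1 1 * Kp \<omega> * Kp \<zeta>) = poly q \<omega> * L (p * Kp \<zeta>) + L (r * Kp \<zeta>)"
      by (simp add: distrib_right L_add L_smult)
    also have "\<dots> = poly r \<zeta>"
      using Lp[OF degree_kernel_poly[OF n_pos]] reproducing[OF \<open>degree r < n\<close>] by simp
    finally show ?thesis by (simp add: r_def poly_monom poly_kernel_poly)
  qed
  have "L (monom 1 1 * Kp \<omega> * Kp \<zeta>) = L (monom 1 1 * Kp \<zeta> * Kp \<omega>)" by (simp only: mult_ac)
  then have "\<zeta> * K \<zeta> \<omega> - poly q \<omega> * poly p \<zeta> = \<omega> * K \<omega> \<zeta> - poly q \<zeta> * poly p \<omega>"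
    unfolding key .
  then show ?thesis using K_symmetric[of \<omega> \<zeta>] by (simp add: algebra_simps)
qed

text \<open>Uniqueness, and existence except for the growth condition on the weight, follow from the inverse Hankel matrix.\<close>

lemma scalar_CD_kernel_iff:
  assumes growth: "\<not> bounded \<Gamma> \<Longrightarrow> w \<in> O[at_infinity](\<lambda>z. 1 / z ^ (2 * n))"
  shows "scalar_CD_kernel J \<Gamma> w n K' \<longleftrightarrow> K' = K"
proof
  assume K': "scalar_CD_kernel J \<Gamma> w n K'"
  then obtain C' where C': "K' = kernel_fun n C'"
    unfolding scalar_CD_kernel_def CD_kernel_def bivariate_scalar[OF n_pos] by blast
  consider "\<forall>P\<in>mat_polys (n - 1). \<forall>z. mat_integral J (\<lambda>\<omega>. P \<omega> ** (mat (w \<omega>) :: complex^1^1) ** mat (K' \<omega> z)) (P z)"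
    | "\<forall>P\<in>mat_polys (n - 1). \<forall>\<omega>. mat_integral J (\<lambda>z. mat (K' \<omega> z) ** (mat (w z) :: complex^1^1) ** P z) (P \<omega>)"
    using K' unfolding scalar_CD_kernel_def CD_kernel_def by blast
  then have "inverts_moments C'"
  proof cases
    case 1
    show ?thesis
    proof (rule left_reproducing_imp_inverts[of "{}"])
      fix m \<zeta> assume "m < n"
      then have "mat_integral J (\<lambda>\<omega>. mat (\<omega> ^ m) ** (mat (w \<omega>) :: complex^1^1) ** mat (K' \<omega> \<zeta>)) (mat (\<zeta> ^ m))"
        by (intro 1[rule_format] monomial_mat_polys) auto
      then show "J (\<lambda>\<omega>. \<omega> ^ m * w \<omega> * kernel_fun n C' \<omega> \<zeta>) (\<zeta> ^ m)"
        by (simp add: mat_integral_def matrix_mult_1 C')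
    qed simp
  next
    case 2
    show ?thesis
    proof (rule right_reproducing_imp_inverts[of "{}"])
      fix m \<omega> assume "m < n"
      then have "mat_integral J (\<lambda>\<zeta>. mat (K' \<omega> \<zeta>) ** (mat (w \<zeta>) :: complex^1^1) ** mat (\<zeta> ^ m)) (mat (\<omega> ^ m))"
        by (intro 2[rule_format] monomial_mat_polys) auto
      then show "J (\<lambda>\<zeta>. kernel_fun n C' \<omega> \<zeta> * w \<zeta> * \<zeta> ^ m) (\<omega> ^ m)"
        by (simp add: mat_integral_def matrix_mult_1 C')
    qed simp
  qed
  then show "K' = K" using inverts_moments_unique[OF inverts] C' by simp
next
  assume K': "K' = K"
  show "scalar_CD_kernel J \<Gamma> w n K'"
    unfolding scalar_CD_kernel_def CD_kernel_def bivariate_scalar[OF n_pos] K'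
  proof (intro conjI impI disjI1 ballI allI)
    fix P :: "complex \<Rightarrow> complex^1^1" and z assume "P \<in> mat_polys (n - 1)"
    then obtain c where c: "\<And>z. P z $ 1 $ 1 = (\<Sum>l\<le>n - 1. c l * z ^ l)" using mat_polys_1 by blast
    have "J (\<lambda>\<omega>. \<Sum>l\<le>n - 1. c l * (\<omega> ^ l * w \<omega> * K \<omega> z)) (\<Sum>l\<le>n - 1. c l * z ^ l)"
      using n_pos by (intro sum cmult K_left) auto
    then show "mat_integral J (\<lambda>\<omega>. P \<omega> ** mat (w \<omega>) ** mat (K \<omega> z)) (P z)"
      by (simp add: mat_integral_def matrix_mult_1 c sum_distrib_right mult.assoc)
  next
    fix i j :: 1 assume "\<not> bounded \<Gamma>"
    then show "(\<lambda>z. (mat (w z) :: complex^1^1) $ i $ j) \<in> O[at_infinity](\<lambda>z. 1 / z ^ (2 * n))"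
      using growth by simp
  qed auto
qed

end

section \<open>The matrix Christoffel--Darboux formula\<close>

lemma smult_mat_component [simp]: "smult_mat c A $ i $ j = c * A $ i $ j"
  by (simp add: smult_mat_def)

lemma smult_mat_eq_mat_left: "smult_mat c A = mat c ** (A :: complex^'r^'r)"
proof -
  have "(\<Sum>k\<in>UNIV. (if i = k then c else 0) * A $ k $ j) = c * A $ i $ j" for i j
    by (simp add: if_distrib[of "\<lambda>x. x * _"] cong: if_cong)
  then show ?thesis by (simp add: vec_eq_iff matrix_matrix_mult_def mat_def)
qed

lemma smult_mat_mult: "smult_mat c A ** B = smult_mat c (A ** B)" "A ** smult_mat c B = smult_mat c (A ** B)"
  by (simp_all add: vec_eq_iff matrix_matrix_mult_def sum_distrib_left mult_ac)

lemma smult_mat_smult: "smult_mat a (smult_mat b A) = smult_mat (a * b) A"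
  by (simp add: vec_eq_iff mult.assoc)

lemma smult_mat_diff: "smult_mat a (A - B) = smult_mat a A - smult_mat a B"
  and smult_mat_left_diff: "smult_mat (a - b) A = smult_mat a A - smult_mat b A"
  and smult_mat_0: "smult_mat a 0 = 0"
  by (simp_all add: vec_eq_iff algebra_simps)

lemma smult_mat_sum: "smult_mat a (\<Sum>i\<in>S. f i) = (\<Sum>i\<in>S. smult_mat a (f i))"
  by (simp add: vec_eq_iff sum_distrib_left)

lemma mat_mult_sum:
  fixes A :: "complex^'r^'r"
  shows "A ** (\<Sum>i\<in>S. f i) = (\<Sum>i\<in>S. A ** f i)" "(\<Sum>i\<in>S. f i) ** A = (\<Sum>i\<in>S. f i ** A)"
proof -
  show "A ** (\<Sum>i\<in>S. f i) = (\<Sum>i\<in>S. A ** f i)"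
    by (simp add: vec_eq_iff matrix_matrix_mult_def sum_distrib_left) (subst sum.swap, simp)
  show "(\<Sum>i\<in>S. f i) ** A = (\<Sum>i\<in>S. f i ** A)"
    by (simp add: vec_eq_iff matrix_matrix_mult_def sum_distrib_right) (subst sum.swap, simp)
qed

lemma mat_mult_diff:
  fixes A :: "complex^'r^'r"
  shows "A ** (B - C) = A ** B - A ** C" "(B - C) ** A = B ** A - C ** A"
  by (simp_all add: vec_eq_iff matrix_matrix_mult_def sum_subtractf algebra_simps)

text \<open>The terms of degree \<open>N\<close> cancel because \<open>P\<close> is monic.\<close>

lemma shifted_minus_monic:
  fixes X :: "nat \<Rightarrow> complex^'r^'r"
  assumes N: "N > 0" and P: "P \<in> monic_mat_polys N"
  shows "(\<lambda>s. smult_mat s (\<Sum>l<N. smult_mat (s ^ l) (X l)) - X (N - 1) ** P s) \<in> mat_polys (N - 1)"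
    and "(\<lambda>s. smult_mat s (\<Sum>l<N. smult_mat (s ^ l) (X l)) - P s ** X (N - 1)) \<in> mat_polys (N - 1)"
proof -
  obtain C where C: "C N = mat 1" "P = (\<lambda>z. \<Sum>l\<le>N. smult_mat (z ^ l) (C l))"
    using P unfolding monic_mat_polys_def by blast
  define X' where "X' = (\<lambda>l. if l = 0 then 0 else X (l - 1))"
  have shift: "smult_mat s (\<Sum>l<N. smult_mat (s ^ l) (X l)) = (\<Sum>l\<le>N. smult_mat (s ^ l) (X' l))" for s
  proof -
    have "(\<Sum>l\<le>N. smult_mat (s ^ l) (X' l)) = (\<Sum>l<N. smult_mat (s ^ Suc l) (X l))"
      by (subst sum.atMost_shift) (simp add: X'_def smult_mat_0)
    then show ?thesis by (simp add: smult_mat_sum smult_mat_smult)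
  qed
  have cut: "(\<Sum>l\<le>N. smult_mat (s ^ l) (Y l)) = (\<Sum>l\<le>N - 1. smult_mat (s ^ l) (Y l))" if "Y N = 0"
    for s and Y :: "nat \<Rightarrow> complex^'r^'r"
  proof -
    obtain m where m: "N = Suc m" using N by (cases N) auto
    show ?thesis using that by (simp add: m smult_mat_0)
  qed
  have "smult_mat s (\<Sum>l<N. smult_mat (s ^ l) (X l)) - X (N - 1) ** P s =
      (\<Sum>l\<le>N - 1. smult_mat (s ^ l) (X' l - X (N - 1) ** C l))" for s
    unfolding shift C(2)
    by (subst cut[symmetric]) (use N in \<open>simp_all add: C(1) X'_def matrix_mul_rid mat_mult_sum smult_mat_mult smult_mat_diff sum_subtractf\<close>)
  then show "(\<lambda>s. smult_mat s (\<Sum>l<N. smult_mat (s ^ l) (X l)) - X (N - 1) ** P s) \<in> mat_polys (N - 1)"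
    unfolding mat_polys_def mem_Collect_eq by (intro exI ext)
  have "smult_mat s (\<Sum>l<N. smult_mat (s ^ l) (X l)) - P s ** X (N - 1) =
      (\<Sum>l\<le>N - 1. smult_mat (s ^ l) (X' l - C l ** X (N - 1)))" for s
    unfolding shift C(2)
    by (subst cut[symmetric]) (use N in \<open>simp_all add: C(1) X'_def matrix_mul_lid mat_mult_sum smult_mat_mult smult_mat_diff sum_subtractf\<close>)
  then show "(\<lambda>s. smult_mat s (\<Sum>l<N. smult_mat (s ^ l) (X l)) - P s ** X (N - 1)) \<in> mat_polys (N - 1)"
    unfolding mat_polys_def mem_Collect_eq by (intro exI ext)
qed

context linear_integral
begin

lemma mat_integral_unique: "mat_integral J F A \<Longrightarrow> mat_integral J F B \<Longrightarrow> A = B"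
  unfolding mat_integral_def vec_eq_iff using unique by blast

lemma mat_integral_add: "mat_integral J F A \<Longrightarrow> mat_integral J G B \<Longrightarrow> mat_integral J (\<lambda>s. F s + G s) (A + B)"
  unfolding mat_integral_def by (auto intro: add)

lemma mat_integral_sum:
  assumes "\<And>i. i \<in> S \<Longrightarrow> mat_integral J (F i) (A i)"
  shows "mat_integral J (\<lambda>s. \<Sum>i\<in>S. F i s) (\<Sum>i\<in>S. A i)"
  using assms unfolding mat_integral_def by (auto intro: sum)

lemma mat_integral_mult_left:
  assumes "mat_integral J F V"
  shows "mat_integral J (\<lambda>s. X ** F s) (X ** V)"
proof -
  have "J (\<lambda>s. \<Sum>k\<in>UNIV. X $ i $ k * F s $ k $ j) (\<Sum>k\<in>UNIV. X $ i $ k * V $ k $ j)" for i j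
    using assms unfolding mat_integral_def by (intro sum cmult) blast
  then show ?thesis unfolding mat_integral_def matrix_matrix_mult_def by simp
qed

lemma mat_integral_mult_right:
  assumes "mat_integral J F V"
  shows "mat_integral J (\<lambda>s. F s ** X) (V ** X)"
proof -
  have "J (\<lambda>s. \<Sum>k\<in>UNIV. F s $ i $ k * X $ k $ j) (\<Sum>k\<in>UNIV. V $ i $ k * X $ k $ j)" for i j
    using assms unfolding mat_integral_def
    by (intro sum) (subst (1 2) mult.commute, rule cmult, blast)
  then show ?thesis unfolding mat_integral_def matrix_matrix_mult_def by simp
qed

text \<open>The scalar argument has to be carried out on both sides at once, because matrices do not commute: the factor
  \<open>s\<close> in the integral of \<open>s R(w,s) W(s) R(s,z)\<close> is absorbed into \<open>R(w,s)\<close> for one evaluation and into \<open>R(s,z)\<close> for the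
  other. This is why reproducing properties on both sides are assumed.\<close>

lemma matrix_christoffel_darboux:
  fixes W PL PR QL QR :: "complex \<Rightarrow> complex^'r::finite^'r" and C :: "nat \<Rightarrow> nat \<Rightarrow> complex^'r^'r"
  assumes N: "N > 0"
    and R: "\<And>w z. R w z = (\<Sum>k<N. \<Sum>l<N. smult_mat (w ^ k * z ^ l) (C k l))"
    and left: "\<And>P. P \<in> mat_polys (N - 1) \<Longrightarrow> mat_integral J (\<lambda>s. P s ** W s ** R s z) (P z)"
    and right: "\<And>P. P \<in> mat_polys (N - 1) \<Longrightarrow> mat_integral J (\<lambda>s. R w s ** W s ** P s) (P w)"
    and PL: "is_PL J W N PL" and PR: "is_PR J W N PR" and QL: "is_QL J W N QL" and QR: "is_QR J W N QR"
  shows "smult_mat (z - w) (R w z) = QR w ** PL z - PR w ** QL z"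
proof -
  \<comment> \<open>The coefficients of the kernel as a polynomial in its second and in its first variable. The leading ones turn out to be \<open>QR\<close> and \<open>QL\<close>.\<close>
  define X where "X = (\<lambda>w l. \<Sum>k<N. smult_mat (w ^ k) (C k l))"
  define Y where "Y = (\<lambda>z k. \<Sum>l<N. smult_mat (z ^ l) (C k l))"
  have RX: "R w s = (\<Sum>l<N. smult_mat (s ^ l) (X w l))" for w s
    unfolding R X_def smult_mat_sum smult_mat_smult by (subst sum.swap) (simp add: mult.commute)
  have RY: "R s z = (\<Sum>k<N. smult_mat (s ^ k) (Y z k))" for s z
    unfolding R Y_def smult_mat_sum smult_mat_smult ..
  have row: "mat_integral J (\<lambda>s. P s ** W s ** R s z) (\<Sum>k<N. V k ** Y z k)"
    if "\<And>k. k < N \<Longrightarrow> pairing J W P (\<lambda>z. mat (z ^ k)) (V k)" for P V z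
  proof -
    have "mat_integral J (\<lambda>s. \<Sum>k<N. (P s ** W s ** mat (s ^ k)) ** Y z k) (\<Sum>k<N. V k ** Y z k)"
      using that unfolding pairing_def by (intro mat_integral_sum mat_integral_mult_right) auto
    then show ?thesis
      by (simp add: RY mat_mult_sum smult_mat_eq_mat_left matrix_mul_assoc)
  qed
  have col: "mat_integral J (\<lambda>s. R w s ** W s ** P s) (\<Sum>l<N. X w l ** V l)"
    if "\<And>k. k < N \<Longrightarrow> pairing J W (\<lambda>z. mat (z ^ k)) P (V k)" for P V w
  proof -
    have "mat_integral J (\<lambda>s. \<Sum>l<N. X w l ** (mat (s ^ l) ** W s ** P s)) (\<Sum>l<N. X w l ** V l)"
      using that unfolding pairing_def by (intro mat_integral_sum mat_integral_mult_left) auto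
    moreover have "X w l ** (mat (s ^ l) ** W s ** P s) = smult_mat (s ^ l) (X w l) ** W s ** P s" for l s
      by (simp only: matrix_mul_assoc smult_mat_eq_mat_left[symmetric] smult_mat_mult)
    ultimately show ?thesis by (simp add: RX mat_mult_sum)
  qed
  have delta: "(\<Sum>k<N. (if k = N - 1 then mat 1 else 0) ** Y z k) = Y z (N - 1)"
    "(\<Sum>l<N. X w l ** (if l = N - 1 then mat 1 else 0)) = X w (N - 1)" for w z
  proof -
    have "(\<Sum>k<N. (if k = N - 1 then mat 1 else 0) ** Y z k) = (\<Sum>k<N. if k = N - 1 then Y z k else 0)"
      by (intro sum.cong refl) (auto simp: matrix_mul_lid)
    then show "(\<Sum>k<N. (if k = N - 1 then mat 1 else 0) ** Y z k) = Y z (N - 1)" using N by simp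
    have "(\<Sum>l<N. X w l ** (if l = N - 1 then mat 1 else 0)) = (\<Sum>l<N. if l = N - 1 then X w l else 0)"
      by (intro sum.cong refl) (auto simp: matrix_mul_rid)
    then show "(\<Sum>l<N. X w l ** (if l = N - 1 then mat 1 else 0)) = X w (N - 1)" using N by simp
  qed
  have QLY: "QL z = Y z (N - 1)"
  proof -
    have "mat_integral J (\<lambda>s. QL s ** W s ** R s z) (\<Sum>k<N. (if k = N - 1 then mat 1 else 0) ** Y z k)"
      by (rule row) (use QL in \<open>simp add: is_QL_def\<close>)
    moreover have "mat_integral J (\<lambda>s. QL s ** W s ** R s z) (QL z)"
      by (rule left) (use QL in \<open>simp add: is_QL_def\<close>)
    ultimately show ?thesis using mat_integral_unique delta(1) by metis
  qed
  have QRX: "QR w = X w (N - 1)"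
  proof -
    have "mat_integral J (\<lambda>s. R w s ** W s ** QR s) (\<Sum>l<N. X w l ** (if l = N - 1 then mat 1 else 0))"
      by (rule col) (use QR in \<open>simp add: is_QR_def\<close>)
    moreover have "mat_integral J (\<lambda>s. R w s ** W s ** QR s) (QR w)"
      by (rule right) (use QR in \<open>simp add: is_QR_def\<close>)
    ultimately show ?thesis using mat_integral_unique delta(2) by metis
  qed
  define r where "r = (\<lambda>s. smult_mat s (R w s) - QR w ** PL s)"
  define t where "t = (\<lambda>s. smult_mat s (R s z) - PR s ** QL z)"
  have r: "r \<in> mat_polys (N - 1)"
    unfolding r_def RX QRX by (rule shifted_minus_monic(1)[OF N]) (use PL in \<open>simp add: is_PL_def\<close>)
  have t: "t \<in> mat_polys (N - 1)"
    unfolding t_def RY QLY by (rule shifted_minus_monic(2)[OF N]) (use PR in \<open>simp add: is_PR_def\<close>)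
  have PL0: "mat_integral J (\<lambda>s. PL s ** W s ** R s z) 0"
    using row[of PL "\<lambda>_. 0" z] PL by (simp add: is_PL_def)
  have PR0: "mat_integral J (\<lambda>s. R w s ** W s ** PR s) 0"
    using col[of PR "\<lambda>_. 0" w] PR by (simp add: is_PR_def)
  have "mat_integral J (\<lambda>s. QR w ** (PL s ** W s ** R s z) + r s ** W s ** R s z) (QR w ** 0 + r z)"
    by (intro mat_integral_add mat_integral_mult_left PL0 left r)
  moreover have "QR w ** (PL s ** W s ** R s z) + r s ** W s ** R s z = smult_mat s (R w s ** W s ** R s z)" for s
    by (simp add: r_def mat_mult_diff smult_mat_mult matrix_mul_assoc)
  ultimately have 1: "mat_integral J (\<lambda>s. smult_mat s (R w s ** W s ** R s z)) (r z)" by simp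
  have "mat_integral J (\<lambda>s. (R w s ** W s ** PR s) ** QL z + R w s ** W s ** t s) (0 ** QL z + t w)"
    by (intro mat_integral_add mat_integral_mult_right PR0 right t)
  moreover have "(R w s ** W s ** PR s) ** QL z + R w s ** W s ** t s = smult_mat s (R w s ** W s ** R s z)" for s
    by (simp add: t_def mat_mult_diff smult_mat_mult matrix_mul_assoc)
  ultimately have 2: "mat_integral J (\<lambda>s. smult_mat s (R w s ** W s ** R s z)) (t w)" by simp
  have "r z = t w" using mat_integral_unique[OF 1 2] .
  then show ?thesis by (simp add: r_def t_def smult_mat_left_diff algebra_simps)
qed

end

section \<open>Eigenvectors over generic points\<close>

lemma matrix_inv_both: "invertible A \<Longrightarrow> A ** matrix_inv A = mat 1 \<and> matrix_inv A ** A = mat 1"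
  unfolding invertible_def matrix_inv_def by (rule someI_ex)

locale eigen_covering = rational_covering M \<phi>
  for M :: "('m, 'r::finite) covering" and \<phi> :: "complex option \<Rightarrow> 'm" +
  fixes W E :: "complex \<Rightarrow> complex^'r^'r" and \<Lambda> :: "complex \<Rightarrow> complex^'r"
    and lam :: "'m \<Rightarrow> complex" and e eh :: "'m \<Rightarrow> complex^'r"
  assumes diagonalization:
      "finite {z. \<not> (invertible (E z) \<and> W z = E z ** diag_mat (\<Lambda> z) ** matrix_inv (E z))}"
    and meromorphic: "meromorphic_fun M lam" "meromorphic_vec M e" "meromorphic_vec M eh"
    and on_sheets:
      "finite {z. \<exists>k. \<not> (lam (sheet M k (Some z)) = \<Lambda> z $ k \<and>
                         e (sheet M k (Some z)) = column k (E z) \<and>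
                         eh (sheet M k (Some z)) = row k (matrix_inv (E z)))}"
begin

abbreviation f where "f \<equiv> phi_proj M \<phi>"

abbreviation ev where "ev \<zeta> \<equiv> e (\<phi> (Some \<zeta>))"

abbreviation ehv where "ehv \<zeta> \<equiv> eh (\<phi> (Some \<zeta>))"

abbreviation lamv where "lamv \<zeta> \<equiv> lam (\<phi> (Some \<zeta>))"

definition diagonal_at :: "complex \<Rightarrow> bool" where
  "diagonal_at z \<longleftrightarrow> invertible (E z) \<and> W z = E z ** diag_mat (\<Lambda> z) ** matrix_inv (E z) \<and>
     (\<forall>k. lam (sheet M k (Some z)) = \<Lambda> z $ k \<and> e (sheet M k (Some z)) = column k (E z) \<and>
          eh (sheet M k (Some z)) = row k (matrix_inv (E z)))"

lemma finite_not_diagonal: "finite {z. \<not> diagonal_at z}"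
proof -
  have "{z. \<not> diagonal_at z} \<subseteq>
    {z. \<not> (invertible (E z) \<and> W z = E z ** diag_mat (\<Lambda> z) ** matrix_inv (E z))} \<union>
    {z. \<exists>k. \<not> (lam (sheet M k (Some z)) = \<Lambda> z $ k \<and> e (sheet M k (Some z)) = column k (E z) \<and>
                         eh (sheet M k (Some z)) = row k (matrix_inv (E z)))}"
    unfolding diagonal_at_def by blast
  then show ?thesis using diagonalization on_sheets by (meson finite_UnI finite_subset)
qed

text \<open>The two matrix identities \<open>E E\<^sup>-\<^sup>1 = 1\<close> and \<open>E\<^sup>-\<^sup>1 E = 1\<close>, read as relations between the eigenvectors on the sheets, and the spectral
  decomposition of \<open>W\<close>.\<close>

lemma diagonal_at_sums:
  assumes "diagonal_at z"
  shows "(\<Sum>k\<in>UNIV. e (sheet M k (Some z)) $ i * eh (sheet M k (Some z)) $ j) = (if i = j then 1 else 0)"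
    and "(\<Sum>i\<in>UNIV. eh (sheet M k (Some z)) $ i * e (sheet M l (Some z)) $ i) = (if k = l then 1 else 0)"
    and "W z $ i $ j = (\<Sum>k\<in>UNIV. e (sheet M k (Some z)) $ i * lam (sheet M k (Some z)) * eh (sheet M k (Some z)) $ j)"
proof -
  have inv: "E z ** matrix_inv (E z) = mat 1" "matrix_inv (E z) ** E z = mat 1"
    using assms matrix_inv_both[of "E z"] by (simp_all add: diagonal_at_def)
  have vals: "lam (sheet M k (Some z)) = \<Lambda> z $ k" "e (sheet M k (Some z)) $ i = E z $ i $ k"
    "eh (sheet M k (Some z)) $ i = matrix_inv (E z) $ k $ i" for k i
    using assms by (auto simp: diagonal_at_def column_def row_def)
  have "(E z ** matrix_inv (E z)) $ i $ j = (if i = j then 1 else 0)"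
    by (simp add: inv mat_def)
  then show "(\<Sum>k\<in>UNIV. e (sheet M k (Some z)) $ i * eh (sheet M k (Some z)) $ j) = (if i = j then 1 else 0)"
    by (simp add: matrix_matrix_mult_def vals)
  have "(matrix_inv (E z) ** E z) $ k $ l = (if k = l then 1 else 0)"
    by (simp add: inv mat_def)
  then show "(\<Sum>i\<in>UNIV. eh (sheet M k (Some z)) $ i * e (sheet M l (Some z)) $ i) = (if k = l then 1 else 0)"
    by (simp add: matrix_matrix_mult_def vals)
  have "W z $ i $ j = (E z ** diag_mat (\<Lambda> z) ** matrix_inv (E z)) $ i $ j"
    using assms by (simp add: diagonal_at_def)
  also have "\<dots> = (\<Sum>k\<in>UNIV. (\<Sum>l\<in>UNIV. E z $ i $ l * (if l = k then \<Lambda> z $ l else 0)) * matrix_inv (E z) $ k $ j)"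
    by (simp add: matrix_matrix_mult_def diag_mat_def)
  also have "\<dots> = (\<Sum>k\<in>UNIV. E z $ i $ k * \<Lambda> z $ k * matrix_inv (E z) $ k $ j)"
    by (simp add: if_distrib[of "\<lambda>x. _ * x"] cong: if_cong)
  finally show "W z $ i $ j = (\<Sum>k\<in>UNIV. e (sheet M k (Some z)) $ i * lam (sheet M k (Some z)) * eh (sheet M k (Some z)) $ j)"
    by (simp add: vals)
qed

text \<open>Where sheets meet, a row and a column eigenvector would have pairing both \<open>0\<close> and \<open>1\<close>.\<close>

lemma finite_not_distinct: "finite {z. \<not> inj (\<lambda>k. sheet M k (Some z))}"
proof (rule finite_subset[OF _ finite_not_diagonal], safe)
  fix z assume d: "diagonal_at z" and "\<not> inj (\<lambda>k. sheet M k (Some z))"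
  then obtain k l where kl: "k \<noteq> l" "sheet M k (Some z) = sheet M l (Some z)" by (auto simp: inj_def)
  have "(\<Sum>i\<in>UNIV. eh (sheet M k (Some z)) $ i * e (sheet M k (Some z)) $ i) = 1"
    using diagonal_at_sums(2)[OF d, of k k] by simp
  moreover have "(\<Sum>i\<in>UNIV. eh (sheet M k (Some z)) $ i * e (sheet M l (Some z)) $ i) = 0"
    using diagonal_at_sums(2)[OF d, of k l] kl(1) by simp
  ultimately show False using kl(2) by simp
qed

lemma ex_nonzero_eigenvectors:
  obtains \<zeta> i j where "e (\<phi> (Some \<zeta>)) $ i \<noteq> 0" "eh (\<phi> (Some \<zeta>)) $ j \<noteq> 0"
proof -
  have "finite ({z. \<not> diagonal_at z} \<union> {z. proj M (\<phi> None) = Some z})"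
  proof (rule finite_UnI[OF finite_not_diagonal])
    have "{z. proj M (\<phi> None) = Some z} \<subseteq> {the (proj M (\<phi> None))}" by auto
    then show "finite {z. proj M (\<phi> None) = Some z}" using finite_subset by blast
  qed
  then obtain z where z: "diagonal_at z" "proj M (\<phi> None) \<noteq> Some z"
    using ex_new_if_finite[OF infinite_UNIV_char_0] by blast
  define k where "k = (undefined :: 'r)"
  obtain x where x: "sheet M k (Some z) = \<phi> x" using phi_surj[OF sheet_in] by blast
  have "x \<noteq> None"
  proof
    assume "x = None"
    then show False using proj_sheet[of k "Some z"] z(2) x by simp
  qed
  then obtain \<zeta> where \<zeta>: "sheet M k (Some z) = \<phi> (Some \<zeta>)" using x by auto
  have "(\<Sum>i\<in>UNIV. eh (sheet M k (Some z)) $ i * e (sheet M k (Some z)) $ i) \<noteq> 0"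
    using diagonal_at_sums(2)[OF z(1), of k k] by simp
  then obtain i where "eh (sheet M k (Some z)) $ i * e (sheet M k (Some z)) $ i \<noteq> 0"
    by (metis (no_types, lifting) sum.neutral)
  then show thesis by (intro that[of \<zeta> i i]) (auto simp: \<zeta>)
qed

end

text \<open>The polynomials to which the data are reduced: the projection is \<open>A / D\<close>, the eigenvectors are \<open>(g / q) u\<close> and
  \<open>(gh / qh) v\<close>. The coefficients \<open>su\<close> and \<open>sh\<close> witness that \<open>u\<close> and \<open>v\<close> have no zeros.\<close>

locale eigen_normal = eigen_covering M \<phi> W E \<Lambda> lam e eh
  for M :: "('m, 'r::finite) covering" and \<phi> W E \<Lambda> lam e eh +
  fixes A D g q gh qh :: "complex poly" and u su v sh :: "'r \<Rightarrow> complex poly"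
  assumes D0: "D \<noteq> 0" and cop: "coprime A D"
    and f_eq: "\<And>z. poly D z \<noteq> 0 \<Longrightarrow> f z = poly A z / poly D z"
    and Dz: "\<And>z. poly D z = 0 \<longleftrightarrow> proj M (\<phi> (Some z)) = None"
    and D_prod: "\<And>z. poly D z = (\<Prod>j | sheet M j None \<noteq> \<phi> None. z - phi_inv \<phi> (sheet M j None))"
    and g0: "g \<noteq> 0" and q0: "q \<noteq> 0" and bez_u: "(\<Sum>i\<in>UNIV. su i * u i) = 1"
    and e_eq: "\<And>\<zeta> i. poly q \<zeta> \<noteq> 0 \<Longrightarrow> ev \<zeta> $ i = poly g \<zeta> * poly (u i) \<zeta> / poly q \<zeta>"
    and e_sing: "\<And>\<zeta>. \<phi> (Some \<zeta>) \<in> zeros_of M e \<union> poles_of M e \<longleftrightarrow> poly g \<zeta> = 0 \<or> poly q \<zeta> = 0"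
    and e_ord: "\<And>\<zeta>. \<phi> (Some \<zeta>) \<in> zeros_of M e \<union> poles_of M e \<Longrightarrow>
       vec_order M e (\<phi> (Some \<zeta>)) = int (order \<zeta> g) - int (order \<zeta> q)"
    and gh0: "gh \<noteq> 0" and qh0: "qh \<noteq> 0" and bez_v: "(\<Sum>i\<in>UNIV. sh i * v i) = 1"
    and eh_eq: "\<And>\<zeta> i. poly qh \<zeta> \<noteq> 0 \<Longrightarrow> ehv \<zeta> $ i = poly gh \<zeta> * poly (v i) \<zeta> / poly qh \<zeta>"
    and eh_sing: "\<And>\<zeta>. \<phi> (Some \<zeta>) \<in> zeros_of M eh \<union> poles_of M eh \<longleftrightarrow> poly gh \<zeta> = 0 \<or> poly qh \<zeta> = 0"
    and eh_ord: "\<And>\<zeta>. \<phi> (Some \<zeta>) \<in> zeros_of M eh \<union> poles_of M eh \<Longrightarrow>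
       vec_order M eh (\<phi> (Some \<zeta>)) = int (order \<zeta> gh) - int (order \<zeta> qh)"

lemma (in eigen_covering) ex_eigen_normal:
  obtains A D g q gh qh u su v sh where "eigen_normal M \<phi> W E \<Lambda> lam e eh A D g q gh qh u su v sh"
proof -
  obtain A D where AD: "D \<noteq> 0" "coprime A D" "\<And>z. poly D z \<noteq> 0 \<Longrightarrow> f z = poly A z / poly D z"
    "\<And>z. poly D z = 0 \<longleftrightarrow> proj M (\<phi> (Some z)) = None"
    "\<And>z. poly D z = (\<Prod>j | sheet M j None \<noteq> \<phi> None. z - phi_inv \<phi> (sheet M j None))"
    by (rule proj_rational, rule that; (assumption | blast))
  obtain \<zeta>0 i0 j0 where nz: "e (\<phi> (Some \<zeta>0)) $ i0 \<noteq> 0" "eh (\<phi> (Some \<zeta>0)) $ j0 \<noteq> 0"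
    by (rule ex_nonzero_eigenvectors)
  obtain g q u su where F: "g \<noteq> 0" "q \<noteq> 0" "(\<Sum>i\<in>UNIV. su i * u i) = 1"
    "\<And>\<zeta> i. poly q \<zeta> \<noteq> 0 \<Longrightarrow> e (\<phi> (Some \<zeta>)) $ i = poly g \<zeta> * poly (u i) \<zeta> / poly q \<zeta>"
    "\<And>\<zeta>. \<phi> (Some \<zeta>) \<in> zeros_of M e \<union> poles_of M e \<longleftrightarrow> poly g \<zeta> = 0 \<or> poly q \<zeta> = 0"
    "\<And>\<zeta>. \<phi> (Some \<zeta>) \<in> zeros_of M e \<union> poles_of M e \<Longrightarrow>
       vec_order M e (\<phi> (Some \<zeta>)) = int (order \<zeta> g) - int (order \<zeta> q)"
    by (rule eigenvector_factorization[OF meromorphic(2) nz(1)]) blast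
  obtain gh qh v sh where G: "gh \<noteq> 0" "qh \<noteq> 0" "(\<Sum>i\<in>UNIV. sh i * v i) = 1"
    "\<And>\<zeta> i. poly qh \<zeta> \<noteq> 0 \<Longrightarrow> eh (\<phi> (Some \<zeta>)) $ i = poly gh \<zeta> * poly (v i) \<zeta> / poly qh \<zeta>"
    "\<And>\<zeta>. \<phi> (Some \<zeta>) \<in> zeros_of M eh \<union> poles_of M eh \<longleftrightarrow> poly gh \<zeta> = 0 \<or> poly qh \<zeta> = 0"
    "\<And>\<zeta>. \<phi> (Some \<zeta>) \<in> zeros_of M eh \<union> poles_of M eh \<Longrightarrow>
       vec_order M eh (\<phi> (Some \<zeta>)) = int (order \<zeta> gh) - int (order \<zeta> qh)"
    by (rule eigenvector_factorization[OF meromorphic(3) nz(2)]) blast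
  have "eigen_normal M \<phi> W E \<Lambda> lam e eh A D g q gh qh u su v sh"
    by unfold_locales (fact AD F G)+
  then show thesis by (rule that)
qed

context eigen_normal
begin

definition branch :: "complex \<Rightarrow> 'r \<Rightarrow> complex" where "branch z k = phi_inv \<phi> (sheet M k (Some z))"

definition Wr :: "complex poly" where "Wr = pderiv A * D - A * pderiv D"

text \<open>The points over \<open>z\<close> lie in the affine part and are distinct, unramified, and away from all zeros and poles of the eigenvectors, and the
  spectral decomposition holds there.\<close>

definition generic :: "complex \<Rightarrow> bool" where
  "generic z \<longleftrightarrow> diagonal_at z \<and> (\<forall>k. sheet M k (Some z) = \<phi> (Some (branch z k))) \<and> inj (branch z) \<and>
     {x. poly A x = z * poly D x} = range (branch z) \<and> degree (A - smult z D) = CARD('r) \<and>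
     (\<forall>k. deriv f (branch z k) \<noteq> 0) \<and> (\<forall>k. poly (g * q * gh * qh) (branch z k) \<noteq> 0)"

lemma D_root: "poly A x = z * poly D x \<Longrightarrow> poly D x \<noteq> 0"
  using cop coprime_poly_0 by force

lemma degrees_and_genericity:
  shows degA: "degree A \<le> CARD('r)" and degD: "degree D \<le> CARD('r)"
    and degAD: "degree A = CARD('r) \<or> degree D = CARD('r)"
    and Wr0: "Wr \<noteq> 0"
    and deriv_f: "\<And>z. poly D z \<noteq> 0 \<Longrightarrow> deriv f z = poly Wr z / poly D z ^ 2"
    and finite_not_generic: "finite {z. \<not> generic z}"
proof -
  obtain Z where Z: "finite Z" "degree A \<le> CARD('r)" "degree D \<le> CARD('r)" "degree A = CARD('r) \<or> degree D = CARD('r)"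
    "pderiv A * D - A * pderiv D \<noteq> 0"
    "\<And>z k. z \<notin> Z \<Longrightarrow> sheet M k (Some z) = \<phi> (Some (phi_inv \<phi> (sheet M k (Some z))))"
    "\<And>z. z \<notin> Z \<Longrightarrow> inj (\<lambda>k. phi_inv \<phi> (sheet M k (Some z)))"
    "\<And>z. z \<notin> Z \<Longrightarrow> {x. poly A x = z * poly D x} = range (\<lambda>k. phi_inv \<phi> (sheet M k (Some z)))"
    "\<And>z. z \<notin> Z \<Longrightarrow> degree (A - smult z D) = CARD('r)"
    "\<And>z k. z \<notin> Z \<Longrightarrow> deriv f (phi_inv \<phi> (sheet M k (Some z))) \<noteq> 0"
    "\<And>z. poly D z \<noteq> 0 \<Longrightarrow> deriv f z = poly (pderiv A * D - A * pderiv D) z / poly D z ^ 2"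
    by (rule generic_fibres[OF D0 cop f_eq Dz finite_not_distinct], assumption, rule that; (assumption | blast))
  show "degree A \<le> CARD('r)" "degree D \<le> CARD('r)" "degree A = CARD('r) \<or> degree D = CARD('r)" "Wr \<noteq> 0"
    using Z(2-5) by (simp_all add: Wr_def)
  show "\<And>z. poly D z \<noteq> 0 \<Longrightarrow> deriv f z = poly Wr z / poly D z ^ 2" using Z(11) by (simp add: Wr_def)
  \<comment> \<open>The values of \<open>f\<close> at the zeros and poles of the eigenvectors.\<close>
  define B where "B = (\<lambda>x. poly A x / poly D x) ` {x. poly (g * q * gh * qh) x = 0}"
  have "finite B" unfolding B_def by (intro finite_imageI poly_roots_finite) (simp add: g0 q0 gh0 qh0)
  have "{z. \<not> generic z} \<subseteq> Z \<union> {z. \<not> diagonal_at z} \<union> B"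
  proof (rule subsetI, rule ccontr)
    fix z assume z: "z \<in> {z. \<not> generic z}" and "z \<notin> Z \<union> {z. \<not> diagonal_at z} \<union> B"
    then have zZ: "z \<notin> Z" and d: "diagonal_at z" and zB: "z \<notin> B" by auto
    have branch_eq: "branch z = (\<lambda>k. phi_inv \<phi> (sheet M k (Some z)))" by (auto simp: branch_def)
    have roots: "{x. poly A x = z * poly D x} = range (branch z)" using Z(8)[OF zZ] by (simp add: branch_eq)
    have "poly (g * q * gh * qh) (branch z k) \<noteq> 0" for k
    proof
      assume 0: "poly (g * q * gh * qh) (branch z k) = 0"
      have r: "poly A (branch z k) = z * poly D (branch z k)" using roots by auto
      have "poly D (branch z k) \<noteq> 0" by (rule D_root[OF r])
      then have "z = poly A (branch z k) / poly D (branch z k)" using r by simp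
      then show False using zB 0 unfolding B_def by blast
    qed
    then have "generic z"
      unfolding generic_def using d roots Z(6,7,9,10)[OF zZ] by (simp add: branch_eq)
    then show False using z by simp
  qed
  then show "finite {z. \<not> generic z}"
    using Z(1) finite_not_diagonal \<open>finite B\<close> by (meson finite_UnI finite_subset)
qed

end

section \<open>Polynomials spanned by the eigenvectors\<close>

lemma remove_sings_eq_poly:
  assumes "finite Z" "\<And>\<zeta>. \<zeta> \<notin> Z \<Longrightarrow> F \<zeta> = poly p \<zeta>"
  shows "remove_sings F = poly p"
proof
  fix a
  have "\<forall>\<^sub>F \<zeta> in at a. \<zeta> \<notin> Z"
    using islimpt_finite[OF assms(1), of a] by (simp add: islimpt_iff_eventually)
  then have "\<forall>\<^sub>F \<zeta> in at a. poly p \<zeta> = F \<zeta>" by eventually_elim (simp add: assms(2))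
  moreover have "poly p \<midarrow>a\<rightarrow> poly p a" by (intro tendsto_intros)
  ultimately have "F \<midarrow>a\<rightarrow> poly p a" by (rule Lim_transform_eventually[rotated])
  then show "remove_sings F a = poly p a" by (rule remove_sings_eqI)
qed

lemma poly_eqI_fun: "poly p = poly q \<Longrightarrow> p = (q :: complex poly)"
  by (rule poly_eq_off_finite[of "{}"]) auto

locale eigen_space = eigen_normal M \<phi> W E \<Lambda> lam e eh A D g q gh qh u su v sh
  for M :: "('m, 'r::finite) covering" and \<phi> W E \<Lambda> lam e eh A D g q gh qh u su v sh +
  fixes N n :: nat
  assumes N: "N > 0" and n_eq: "n = CARD('r) * N"
    and V: "V_space M \<phi> N e = {poly p | p. degree p \<le> n - 1}"
begin

abbreviation h where "h \<equiv> h_fun M \<phi> N e"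

abbreviation hh where "hh \<equiv> h_fun M \<phi> N eh"

definition \<kappa> :: complex where "\<kappa> = lead_coeff g / lead_coeff q"

definition \<kappa>h :: complex where "\<kappa>h = lead_coeff gh / lead_coeff qh"

text \<open>Up to removable singularities, \<open>h\<close> times entry \<open>i\<close> of \<open>f^l e\<close> (see \<open>poly_row_gen\<close>).\<close>

definition row_gen :: "nat \<Rightarrow> 'r \<Rightarrow> complex poly" where "row_gen l i = smult \<kappa> (A ^ l * D ^ (N - 1 - l) * u i)"

definition col_gen :: "nat \<Rightarrow> 'r \<Rightarrow> complex poly" where "col_gen l i = smult \<kappa>h (A ^ l * D ^ (N - 1 - l) * v i)"

text \<open>The polynomial \<open>h P(f) e\<close>, where \<open>P\<close> is the row of polynomials with coefficients \<open>c\<close> (see \<open>poly_rowpoly\<close>).\<close>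

definition rowpoly :: "(nat \<Rightarrow> 'r \<Rightarrow> complex) \<Rightarrow> complex poly" where
  "rowpoly c = (\<Sum>l<N. \<Sum>i\<in>UNIV. smult (c l i) (row_gen l i))"

text \<open>The polynomial \<open>hh eh P(f)\<close>, where \<open>P\<close> is the column of polynomials with coefficients \<open>c\<close>.\<close>

definition colpoly :: "(nat \<Rightarrow> 'r \<Rightarrow> complex) \<Rightarrow> complex poly" where
  "colpoly c = (\<Sum>l<N. \<Sum>i\<in>UNIV. smult (c l i) (col_gen l i))"

definition polyvec :: "(nat \<Rightarrow> 'r \<Rightarrow> complex) \<Rightarrow> complex \<Rightarrow> 'r \<Rightarrow> complex" where
  "polyvec c z i = (\<Sum>l<N. c l i * z ^ l)"

lemma n_pos: "n > 0" using N by (simp add: n_eq)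

lemma \<kappa>0: "\<kappa> \<noteq> 0" "\<kappa>h \<noteq> 0" using g0 q0 gh0 qh0 by (simp_all add: \<kappa>_def \<kappa>h_def)

lemma h_eq: "poly g \<zeta> \<noteq> 0 \<Longrightarrow> poly q \<zeta> \<noteq> 0 \<Longrightarrow> h \<zeta> = \<kappa> * poly D \<zeta> ^ (N - 1) * poly q \<zeta> / poly g \<zeta>"
  unfolding \<kappa>_def by (rule h_fun_factorization[OF g0 q0 e_sing e_ord D_prod])

lemma hh_eq: "poly gh \<zeta> \<noteq> 0 \<Longrightarrow> poly qh \<zeta> \<noteq> 0 \<Longrightarrow> hh \<zeta> = \<kappa>h * poly D \<zeta> ^ (N - 1) * poly qh \<zeta> / poly gh \<zeta>"
  unfolding \<kappa>h_def by (rule h_fun_factorization[OF gh0 qh0 eh_sing eh_ord D_prod])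

lemma e_h: "poly g \<zeta> \<noteq> 0 \<Longrightarrow> poly q \<zeta> \<noteq> 0 \<Longrightarrow> ev \<zeta> $ i * h \<zeta> = \<kappa> * poly D \<zeta> ^ (N - 1) * poly (u i) \<zeta>"
  by (simp add: h_eq e_eq)

lemma eh_hh: "poly gh \<zeta> \<noteq> 0 \<Longrightarrow> poly qh \<zeta> \<noteq> 0 \<Longrightarrow> ehv \<zeta> $ i * hh \<zeta> = \<kappa>h * poly D \<zeta> ^ (N - 1) * poly (v i) \<zeta>"
  by (simp add: hh_eq eh_eq)

lemma A_power_D_power:
  assumes "poly D \<zeta> \<noteq> 0" "l < N"
  shows "poly A \<zeta> ^ l * poly D \<zeta> ^ (N - 1 - l) = f \<zeta> ^ l * poly D \<zeta> ^ (N - 1)"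
proof -
  have "poly D \<zeta> ^ (N - 1) = poly D \<zeta> ^ l * poly D \<zeta> ^ (N - 1 - l)"
    using assms(2) by (simp flip: power_add)
  then show ?thesis using assms(1) by (simp add: f_eq power_divide)
qed

lemma poly_row_gen: "poly D \<zeta> \<noteq> 0 \<Longrightarrow> l < N \<Longrightarrow> poly (row_gen l i) \<zeta> = f \<zeta> ^ l * (\<kappa> * poly D \<zeta> ^ (N - 1) * poly (u i) \<zeta>)"
  using A_power_D_power[of \<zeta> l] by (simp add: row_gen_def)

lemma poly_col_gen: "poly D \<zeta> \<noteq> 0 \<Longrightarrow> l < N \<Longrightarrow> poly (col_gen l i) \<zeta> = f \<zeta> ^ l * (\<kappa>h * poly D \<zeta> ^ (N - 1) * poly (v i) \<zeta>)"
  using A_power_D_power[of \<zeta> l] by (simp add: col_gen_def)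

lemma poly_rowpoly: "poly D \<zeta> \<noteq> 0 \<Longrightarrow>
  poly (rowpoly c) \<zeta> = (\<Sum>i\<in>UNIV. polyvec c (f \<zeta>) i * (\<kappa> * poly D \<zeta> ^ (N - 1) * poly (u i) \<zeta>))"
  unfolding rowpoly_def polyvec_def sum_distrib_right poly_sum
  by (subst sum.swap) (intro sum.cong refl, simp add: poly_row_gen)

lemma poly_colpoly: "poly D \<zeta> \<noteq> 0 \<Longrightarrow>
  poly (colpoly c) \<zeta> = (\<Sum>i\<in>UNIV. polyvec c (f \<zeta>) i * (\<kappa>h * poly D \<zeta> ^ (N - 1) * poly (v i) \<zeta>))"
  unfolding colpoly_def polyvec_def sum_distrib_right poly_sum
  by (subst sum.swap) (intro sum.cong refl, simp add: poly_col_gen)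

text \<open>At the zeros of \<open>D\<close>, \<open>g\<close> and \<open>q\<close> the left-hand expression contains conventional values, which \<open>remove_sings\<close>
  replaces by the values of the polynomial.\<close>

lemma V_member_rowpoly:
  fixes C :: "nat \<Rightarrow> complex^'r^1"
  shows "remove_sings (\<lambda>\<zeta>. ((\<Sum>l\<le>N - 1. smult_mat (f \<zeta> ^ l) (C l)) *v ev \<zeta>) $ 1 * h \<zeta>)
     = poly (rowpoly (\<lambda>l i. C l $ 1 $ i))"
proof (rule remove_sings_eq_poly)
  show "finite {\<zeta>. poly (D * g * q) \<zeta> = 0}"
    by (rule poly_roots_finite) (simp add: D0 g0 q0)
  fix \<zeta> assume "\<zeta> \<notin> {\<zeta>. poly (D * g * q) \<zeta> = 0}"
  then have nz: "poly D \<zeta> \<noteq> 0" "poly g \<zeta> \<noteq> 0" "poly q \<zeta> \<noteq> 0" by auto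
  have set: "{..N - 1} = {..<N}" using N by auto
  have "((\<Sum>l\<le>N - 1. smult_mat (f \<zeta> ^ l) (C l)) *v ev \<zeta>) $ 1 * h \<zeta> =
      (\<Sum>i\<in>UNIV. polyvec (\<lambda>l i. C l $ 1 $ i) (f \<zeta>) i * (ev \<zeta> $ i * h \<zeta>))"
  proof -
    have "((\<Sum>l<N. smult_mat (f \<zeta> ^ l) (C l)) *v ev \<zeta>) $ 1 = (\<Sum>i\<in>UNIV. polyvec (\<lambda>l i. C l $ 1 $ i) (f \<zeta>) i * ev \<zeta> $ i)"
      by (simp add: matrix_vector_mult_def polyvec_def mult.commute)
    then show ?thesis unfolding set by (simp only: sum_distrib_right mult.assoc)
  qed
  then show "((\<Sum>l\<le>N - 1. smult_mat (f \<zeta> ^ l) (C l)) *v ev \<zeta>) $ 1 * h \<zeta> = poly (rowpoly (\<lambda>l i. C l $ 1 $ i)) \<zeta>"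
    by (simp add: e_h nz poly_rowpoly)
qed

lemma V_space_eq: "V_space M \<phi> N e = {poly (rowpoly c) | c. True}"
proof (intro equalityI subsetI)
  fix F assume "F \<in> V_space M \<phi> N e"
  then obtain P :: "complex \<Rightarrow> complex^'r^1" where P: "P \<in> mat_polys (N - 1)"
    and F: "F = remove_sings (\<lambda>\<zeta>. (P (f \<zeta>) *v ev \<zeta>) $ 1 * h \<zeta>)"
    unfolding V_space_def by blast
  obtain C :: "nat \<Rightarrow> complex^'r^1" where "P = (\<lambda>z. \<Sum>l\<le>N - 1. smult_mat (z ^ l) (C l))"
    using P unfolding mat_polys_def by blast
  then show "F \<in> {poly (rowpoly c) | c. True}" using V_member_rowpoly[of C] F by auto
next
  fix F assume "F \<in> {poly (rowpoly c) | c. True}"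
  then obtain c where F: "F = poly (rowpoly c)" by blast
  define C :: "nat \<Rightarrow> complex^'r^1" where "C = (\<lambda>l. \<chi> a i. c l i)"
  have "(\<lambda>z. \<Sum>l\<le>N - 1. smult_mat (z ^ l) (C l)) \<in> mat_polys (N - 1)"
    unfolding mat_polys_def by blast
  moreover have "F = remove_sings (\<lambda>\<zeta>. ((\<Sum>l\<le>N - 1. smult_mat (f \<zeta> ^ l) (C l)) *v ev \<zeta>) $ 1 * h \<zeta>)"
  proof -
    have "(\<lambda>l i. C l $ 1 $ i) = c" by (auto simp: C_def fun_eq_iff)
    then show ?thesis unfolding V_member_rowpoly F by simp
  qed
  ultimately show "F \<in> V_space M \<phi> N e" unfolding V_space_def mem_Collect_eq
    by (intro exI[of _ "\<lambda>z. \<Sum>l\<le>N - 1. smult_mat (z ^ l) (C l)"] conjI)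
qed

lemma degree_rowpoly: "degree (rowpoly c) < n"
proof -
  have "poly (rowpoly c) \<in> {poly p | p. degree p \<le> n - 1}" using V_space_eq V by blast
  then obtain p where "poly (rowpoly c) = poly p" "degree p \<le> n - 1" by blast
  then show ?thesis using poly_eqI_fun n_pos by fastforce
qed

lemma ex_rowpoly: "degree p < n \<Longrightarrow> \<exists>c. p = rowpoly c"
proof -
  assume "degree p < n"
  then have "poly p \<in> V_space M \<phi> N e" unfolding V by (intro CollectI exI[of _ p]) auto
  then obtain c where "poly p = poly (rowpoly c)" unfolding V_space_eq by blast
  then show ?thesis using poly_eqI_fun by blast
qed

lemma rowpoly_unit: "l < N \<Longrightarrow> rowpoly (\<lambda>l' i'. if l' = l \<and> i' = i then 1 else 0) = row_gen l i"
proof -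
  assume l: "l < N"
  have "rowpoly (\<lambda>l' i'. if l' = l \<and> i' = i then 1 else 0) = (\<Sum>l'<N. if l' = l then row_gen l i else 0)"
    unfolding rowpoly_def
  proof (intro sum.cong refl)
    fix l'
    have "(\<Sum>i'\<in>UNIV. smult (if l' = l \<and> i' = i then 1 else 0) (row_gen l' i')) =
      (\<Sum>i'\<in>UNIV. if i' = i then (if l' = l then row_gen l i else 0) else 0)"
      by (intro sum.cong refl) auto
    then show "(\<Sum>i'\<in>UNIV. smult (if l' = l \<and> i' = i then 1 else 0) (row_gen l' i')) = (if l' = l then row_gen l i else 0)"
      by simp
  qed
  then show ?thesis using l by simp
qed

text \<open>Whichever of \<open>A\<close> and \<open>D\<close> has degree \<open>r\<close>, its power of exponent \<open>N - 1\<close> times \<open>u i\<close> is, up to a constant, in \<open>V\<close>.\<close>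

lemma degree_u: "degree (u i) \<le> CARD('r) - 1"
proof (cases "u i = 0")
  case False
  have row_gen: "degree (row_gen l i) < n" if "l < N" for l
    using degree_rowpoly[of "\<lambda>l' i'. if l' = l \<and> i' = i then 1 else 0"] rowpoly_unit[OF that] by simp
  have "(N - 1) * CARD('r) + degree (u i) < n"
  proof (cases "degree A = CARD('r)")
    case True
    then have "A \<noteq> 0" by auto
    then have "degree (row_gen (N - 1) i) = (N - 1) * CARD('r) + degree (u i)"
      using True False \<kappa>0 by (simp add: row_gen_def degree_mult_eq degree_power_eq)
    then show ?thesis using row_gen[of "N - 1"] N by simp
  next
    case A: False
    then have "degree D = CARD('r)" using degAD by simp
    then have "degree (row_gen 0 i) = (N - 1) * CARD('r) + degree (u i)"
      using False \<kappa>0 D0 by (simp add: row_gen_def degree_mult_eq degree_power_eq)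
    then show ?thesis using row_gen[of 0] N by simp
  qed
  moreover have "n = (N - 1) * CARD('r) + CARD('r)"
    using N unfolding n_eq by (cases N) (simp_all add: algebra_simps)
  ultimately show ?thesis by linarith
qed simp

lemma generic_points:
  assumes "generic z"
  shows "poly A (branch z k) = z * poly D (branch z k)" "poly D (branch z k) \<noteq> 0" "f (branch z k) = z"
    "poly g (branch z k) \<noteq> 0" "poly q (branch z k) \<noteq> 0" "poly gh (branch z k) \<noteq> 0" "poly qh (branch z k) \<noteq> 0"
    "deriv f (branch z k) \<noteq> 0" "sheet M k (Some z) = \<phi> (Some (branch z k))"
    "h (branch z k) \<noteq> 0" "hh (branch z k) \<noteq> 0"
proof -
  have "branch z k \<in> {x. poly A x = z * poly D x}" using assms by (auto simp: generic_def)
  then show r: "poly A (branch z k) = z * poly D (branch z k)" by simp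
  show d: "poly D (branch z k) \<noteq> 0" by (rule D_root[OF r])
  show "f (branch z k) = z" using f_eq[OF d] r d by simp
  have "poly (g * q * gh * qh) (branch z k) \<noteq> 0" using assms by (simp add: generic_def)
  then show nz: "poly g (branch z k) \<noteq> 0" "poly q (branch z k) \<noteq> 0" "poly gh (branch z k) \<noteq> 0" "poly qh (branch z k) \<noteq> 0" by auto
  show "deriv f (branch z k) \<noteq> 0" "sheet M k (Some z) = \<phi> (Some (branch z k))" using assms by (auto simp: generic_def)
  show "h (branch z k) \<noteq> 0" "hh (branch z k) \<noteq> 0" using nz d \<kappa>0 by (simp_all add: h_eq hh_eq)
qed

lemma generic_sums:
  assumes z: "generic z"
  shows "(\<Sum>k\<in>UNIV. ev (branch z k) $ i * ehv (branch z k) $ j) = (if i = j then 1 else 0)"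
    and "(\<Sum>i\<in>UNIV. ehv (branch z k) $ i * ev (branch z l) $ i) = (if k = l then 1 else 0)"
    and "W z $ i $ j = (\<Sum>k\<in>UNIV. ev (branch z k) $ i * lamv (branch z k) * ehv (branch z k) $ j)"
proof -
  have d: "diagonal_at z" using z by (simp add: generic_def)
  show "(\<Sum>k\<in>UNIV. ev (branch z k) $ i * ehv (branch z k) $ j) = (if i = j then 1 else 0)"
    "(\<Sum>i\<in>UNIV. ehv (branch z k) $ i * ev (branch z l) $ i) = (if k = l then 1 else 0)"
    "W z $ i $ j = (\<Sum>k\<in>UNIV. ev (branch z k) $ i * lamv (branch z k) * ehv (branch z k) $ j)"
    using diagonal_at_sums[OF d] by (simp_all only: generic_points(9)[OF z])
qed

text \<open>The Bezoutian argument applies on generic fibres: there the scalar factors of the eigenvectors are nonzero and can be divided out or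
  absorbed into the coefficients \<open>d\<close>.\<close>

lemma duality:
  obtains c H where "c \<noteq> 0" "\<And>x. (\<Sum>i\<in>UNIV. poly (u i) x * poly (v i) x) = c * poly Wr x"
    "\<And>i. degree (v i) \<le> CARD('r) - 1" "\<And>i x. poly (u i) x = (\<Sum>j\<in>UNIV. H i j * poly (v j) x)"
proof -
  have Wr': "pderiv A * D - A * pderiv D \<noteq> 0" using Wr0 by (simp add: Wr_def)
  have eu: "ev (branch z k) $ i = poly g (branch z k) / poly q (branch z k) * poly (u i) (branch z k)"
    and ev: "ehv (branch z k) $ i = poly gh (branch z k) / poly qh (branch z k) * poly (v i) (branch z k)" if "generic z" for z k i
    using generic_points[OF that, of k] by (simp_all add: e_eq eh_eq)
  have orth: "(\<Sum>i\<in>UNIV. poly (u i) (branch z j) * poly (v i) (branch z k)) = 0" if z: "generic z" and "j \<noteq> k" for z j k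
  proof -
    have "poly g (branch z j) / poly q (branch z j) * (poly gh (branch z k) / poly qh (branch z k)) *
        (\<Sum>i\<in>UNIV. poly (u i) (branch z j) * poly (v i) (branch z k)) = (\<Sum>i\<in>UNIV. ehv (branch z k) $ i * ev (branch z j) $ i)"
      unfolding sum_distrib_left by (intro sum.cong refl) (simp only: eu[OF z] ev[OF z] mult_ac)
    also have "\<dots> = 0" using generic_sums(2)[OF z, of k j] that by simp
    finally show ?thesis using generic_points[OF z, of j] generic_points[OF z, of k] by simp
  qed
  have dual: "\<exists>d. \<forall>i j. (\<Sum>k\<in>UNIV. d k * poly (u i) (branch z k) * poly (v j) (branch z k)) = (if i = j then 1 else 0)" if z: "generic z" for z
  proof (intro exI allI)
    fix i j
    have "(\<Sum>k\<in>UNIV. (poly g (branch z k) / poly q (branch z k) * (poly gh (branch z k) / poly qh (branch z k))) * poly (u i) (branch z k) * poly (v j) (branch z k)) =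
      (\<Sum>k\<in>UNIV. ev (branch z k) $ i * ehv (branch z k) $ j)"
      by (intro sum.cong refl) (simp only: eu[OF z] ev[OF z] mult_ac)
    then show "(\<Sum>k\<in>UNIV. (poly g (branch z k) / poly q (branch z k) * (poly gh (branch z k) / poly qh (branch z k))) * poly (u i) (branch z k) * poly (v j) (branch z k)) = (if i = j then 1 else 0)"
      using generic_sums(1)[OF z] by simp
  qed
  have pts: "inj (branch z)" "{x. poly A x = z * poly D x} = range (branch z)" "degree (A - smult z D) = CARD('r)" if "generic z" for z
    using that by (auto simp: generic_def)
  show thesis
  proof (rule bezoutian_duality[where Z = "{z. \<not> generic z}" and w = branch and A = A and D = D and u = u and v = v and s = sh])
    show "finite {z. \<not> generic z}" by (rule finite_not_generic)
    show "coprime A D" by (rule cop)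
    show "pderiv A * D - A * pderiv D \<noteq> 0" by (rule Wr')
    show "degree A \<le> CARD('r)" "degree D \<le> CARD('r)" by (rule degA, rule degD)
    show "inj (branch z)" if "z \<notin> {z. \<not> generic z}" for z using that pts by simp
    show "{x. poly A x = z * poly D x} = range (branch z)" if "z \<notin> {z. \<not> generic z}" for z using that pts by simp
    show "degree (A - smult z D) = CARD('r)" if "z \<notin> {z. \<not> generic z}" for z using that pts by simp
    show "degree (u i) \<le> CARD('r) - 1" for i by (rule degree_u)
    show "(\<Sum>i\<in>UNIV. poly (u i) (branch z j) * poly (v i) (branch z k)) = 0" if "z \<notin> {z. \<not> generic z}" "j \<noteq> k" for z j k
      using that by (intro orth) auto
    show "\<exists>d. \<forall>i j. (\<Sum>k\<in>UNIV. d k * poly (u i) (branch z k) * poly (v j) (branch z k)) = (if i = j then 1 else 0)"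
      if "z \<notin> {z. \<not> generic z}" for z using that by (intro dual) simp
    show "(\<Sum>i\<in>UNIV. sh i * v i) = 1" by (rule bez_v)
    fix c H
    assume c: "c \<noteq> 0" and diag: "\<And>x. (\<Sum>i\<in>UNIV. poly (u i) x * poly (v i) x) = c * poly (pderiv A * D - A * pderiv D) x"
      and degv: "\<And>i. degree (v i) \<le> CARD('r) - 1" and H: "\<And>i x. poly (u i) x = (\<Sum>j\<in>UNIV. H i j * poly (v j) x)"
    show thesis by (rule that[OF c _ degv H]) (simp only: diag Wr_def)
  qed
qed

text \<open>For the columns the degree bound on \<open>v\<close> comes from duality, as the hypothesis on \<open>V\<close> only concerns \<open>u\<close>.\<close>

lemma degree_row_col_gen:
  assumes "l < N"
  shows "degree (row_gen l i) < n" "degree (col_gen l i) < n"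
proof -
  have *: "degree (smult k (A ^ l * D ^ (N - 1 - l) * p)) < n" if "degree p \<le> CARD('r) - 1" for k p
  proof -
    have "degree (smult k (A ^ l * D ^ (N - 1 - l) * p)) \<le> degree (A ^ l) + degree (D ^ (N - 1 - l)) + degree p"
      by (rule order_trans[OF degree_smult_le order_trans[OF degree_mult_le add_right_mono[OF degree_mult_le]]])
    also have "\<dots> \<le> l * CARD('r) + (N - 1 - l) * CARD('r) + (CARD('r) - 1)"
      using degA degD that degree_power_le[of A l] degree_power_le[of D "N - 1 - l"]
      by (intro add_mono order_trans[OF degree_power_le]) (simp_all add: mult.commute)
    also have "\<dots> = (N - 1) * CARD('r) + (CARD('r) - 1)"
      using assms by (simp add: distrib_right[symmetric] del: distrib_right)
    also have "\<dots> < (N - 1) * CARD('r) + CARD('r)" by simp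
    also have "\<dots> = n" using N unfolding n_eq by (cases N) (simp_all add: algebra_simps)
    finally show ?thesis .
  qed
  show "degree (row_gen l i) < n" unfolding row_gen_def by (rule *[OF degree_u])
  obtain c H where "degree (v i) \<le> CARD('r) - 1" using duality by metis
  then show "degree (col_gen l i) < n" unfolding col_gen_def by (rule *)
qed

text \<open>Since \<open>u\<close> is a constant matrix times \<open>v\<close>, a combination of the rows is a combination of the columns.\<close>

lemma ex_colpoly: "degree p < n \<Longrightarrow> \<exists>c. p = colpoly c"
proof -
  assume "degree p < n"
  then obtain c where p: "p = rowpoly c" using ex_rowpoly by blast
  obtain k H where H: "\<And>i x. poly (u i) x = (\<Sum>j\<in>UNIV. H i j * poly (v j) x)" using duality by metis
  define c' where "c' = (\<lambda>l j. \<Sum>i\<in>UNIV. c l i * H i j * (\<kappa> / \<kappa>h))"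
  have "rowpoly c = colpoly c'"
  proof (rule poly_eq_off_finite[of "{}"])
    fix x
    have "poly (row_gen l i) x = (\<Sum>j\<in>UNIV. H i j * (\<kappa> / \<kappa>h) * poly (col_gen l j) x)" for l i
      using \<kappa>0 by (simp add: row_gen_def col_gen_def H sum_distrib_left mult_ac)
    then have "poly (rowpoly c) x = (\<Sum>l<N. \<Sum>i\<in>UNIV. \<Sum>j\<in>UNIV. c l i * H i j * (\<kappa> / \<kappa>h) * poly (col_gen l j) x)"
      by (simp add: rowpoly_def poly_sum sum_distrib_left mult.assoc)
    also have "\<dots> = (\<Sum>l<N. \<Sum>j\<in>UNIV. \<Sum>i\<in>UNIV. c l i * H i j * (\<kappa> / \<kappa>h) * poly (col_gen l j) x)"
      by (intro sum.cong refl sum.swap)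
    also have "\<dots> = poly (colpoly c') x"
      by (simp add: colpoly_def c'_def poly_sum sum_distrib_right)
    finally show "poly (rowpoly c) x = poly (colpoly c') x" .
  qed simp
  then show ?thesis using p by blast
qed

end

section \<open>Matrix pairings as scalar pairings\<close>

text \<open>This lemma and the next one show that the pulled back matrix kernel is a kernel of degree less than \<open>n\<close> in each variable,
  without computing its coefficients.\<close>

lemma kernel_fun_sum:
  assumes "\<And>i. i \<in> S \<Longrightarrow> \<exists>c. \<forall>\<omega> \<zeta>. F i \<omega> \<zeta> = kernel_fun n c \<omega> \<zeta>"
  shows "\<exists>c. \<forall>\<omega> \<zeta>. (\<Sum>i\<in>S. F i \<omega> \<zeta>) = kernel_fun n c \<omega> \<zeta>"
proof -
  obtain c where c: "\<And>i \<omega> \<zeta>. i \<in> S \<Longrightarrow> F i \<omega> \<zeta> = kernel_fun n (c i) \<omega> \<zeta>" using assms by metis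
  have "(\<Sum>i\<in>S. F i \<omega> \<zeta>) = kernel_fun n (\<lambda>k l. \<Sum>i\<in>S. c i k l) \<omega> \<zeta>" for \<omega> \<zeta>
  proof -
    have "kernel_fun n (\<lambda>k l. \<Sum>i\<in>S. c i k l) \<omega> \<zeta> = (\<Sum>k<n. \<Sum>i\<in>S. \<Sum>l<n. c i k l * \<omega> ^ k * \<zeta> ^ l)"
      unfolding kernel_fun_def sum_distrib_right by (intro sum.cong refl sum.swap)
    also have "\<dots> = (\<Sum>i\<in>S. kernel_fun n (c i) \<omega> \<zeta>)"
      unfolding kernel_fun_def by (rule sum.swap)
    finally show ?thesis by (simp add: c)
  qed
  then show ?thesis by blast
qed

lemma kernel_fun_product:
  assumes "degree p < n" "degree q < n"
  shows "\<exists>c. \<forall>\<omega> \<zeta>. x * poly p \<omega> * poly q \<zeta> = kernel_fun n c \<omega> \<zeta>"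
proof (intro exI allI)
  fix \<omega> \<zeta>
  show "x * poly p \<omega> * poly q \<zeta> = kernel_fun n (\<lambda>k l. x * coeff p k * coeff q l) \<omega> \<zeta>"
    unfolding kernel_fun_def poly_as_sum_lessThan[OF assms(1)] poly_as_sum_lessThan[OF assms(2)] sum_distrib_left sum_distrib_right
    by (subst sum.swap) (intro sum.cong refl, simp only: mult_ac)
qed

context eigen_space
begin

abbreviation w where "w \<equiv> scalar_weight M \<phi> N lam e eh"

text \<open>On a generic fibre the factors \<open>h\<close>, \<open>hh\<close> and the derivative of \<open>f\<close> cancel against those in the scalar weight, and
  what remains of the sum over the fibre is the spectral decomposition of \<open>W\<close>.\<close>

lemma lifted_integral_iff:
  assumes curves: "\<forall>C\<in>set \<gamma>. piecewise_smooth_curve C"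
  shows "has_lifted_integral M \<phi> \<gamma> (\<lambda>\<omega>. poly (rowpoly c) \<omega> * w \<omega> * poly (colpoly c') \<omega>) val \<longleftrightarrow>
    has_curve_integral \<gamma> (\<lambda>z. \<Sum>i\<in>UNIV. \<Sum>j\<in>UNIV. polyvec c z i * W z $ i $ j * polyvec c' z j) val"
  unfolding has_lifted_integral_def
proof (rule has_curve_integral_cong_off_finite[OF curves finite_not_generic])
  fix z assume "z \<notin> {z. \<not> generic z}"
  then have z: "generic z" by simp
  note gp = generic_points[OF z]
  define a where "a = (\<lambda>k. \<Sum>i\<in>UNIV. polyvec c z i * ev (branch z k) $ i)"
  define b where "b = (\<lambda>k. \<Sum>j\<in>UNIV. polyvec c' z j * ehv (branch z k) $ j)"
  have row: "poly (rowpoly c) (branch z k) = a k * h (branch z k)" for k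
    using poly_rowpoly[OF gp(2), of c k] unfolding gp(3) e_h[OF gp(4,5), symmetric] by (simp add: a_def sum_distrib_right mult.assoc)
  have col: "poly (colpoly c') (branch z k) = b k * hh (branch z k)" for k
    using poly_colpoly[OF gp(2), of c' k] unfolding gp(3) eh_hh[OF gp(6,7), symmetric] by (simp add: b_def sum_distrib_right mult.assoc)
  have "poly (rowpoly c) (branch z k) * w (branch z k) * poly (colpoly c') (branch z k) / deriv f (branch z k) = a k * lamv (branch z k) * b k" for k
    unfolding row col scalar_weight_def using gp(8,10,11)[of k] by simp
  then have "(\<Sum>k\<in>UNIV. poly (rowpoly c) (branch z k) * w (branch z k) * poly (colpoly c') (branch z k) / deriv f (branch z k)) =
      (\<Sum>k\<in>UNIV. a k * lamv (branch z k) * b k)" by simp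
  also have "\<dots> = (\<Sum>k\<in>UNIV. \<Sum>i\<in>UNIV. \<Sum>j\<in>UNIV. polyvec c z i * (ev (branch z k) $ i * lamv (branch z k) * ehv (branch z k) $ j) * polyvec c' z j)"
    unfolding a_def b_def sum_distrib_right unfolding sum_distrib_left by (intro sum.cong refl) (simp only: mult_ac)
  also have "\<dots> = (\<Sum>i\<in>UNIV. \<Sum>k\<in>UNIV. \<Sum>j\<in>UNIV. polyvec c z i * (ev (branch z k) $ i * lamv (branch z k) * ehv (branch z k) $ j) * polyvec c' z j)"
    by (rule sum.swap)
  also have "\<dots> = (\<Sum>i\<in>UNIV. \<Sum>j\<in>UNIV. \<Sum>k\<in>UNIV. polyvec c z i * (ev (branch z k) $ i * lamv (branch z k) * ehv (branch z k) $ j) * polyvec c' z j)"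
    by (intro sum.cong refl sum.swap)
  also have "\<dots> = (\<Sum>i\<in>UNIV. \<Sum>j\<in>UNIV. polyvec c z i * W z $ i $ j * polyvec c' z j)"
    by (simp only: generic_sums(3)[OF z] sum_distrib_left sum_distrib_right)
  finally show "(\<Sum>j\<in>UNIV. poly (rowpoly c) (phi_inv \<phi> (sheet M j (Some z))) * w (phi_inv \<phi> (sheet M j (Some z))) *
      poly (colpoly c') (phi_inv \<phi> (sheet M j (Some z))) / deriv f (phi_inv \<phi> (sheet M j (Some z)))) =
    (\<Sum>i\<in>UNIV. \<Sum>j\<in>UNIV. polyvec c z i * W z $ i $ j * polyvec c' z j)"
    unfolding branch_def .
qed

text \<open>The polynomial \<open>hh \<omega> * eh \<omega> * R (f \<omega>) (f \<zeta>) * e \<zeta> * h \<zeta>\<close> for the matrix kernel \<open>R\<close> with coefficients \<open>C\<close>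
  (see \<open>kernel_value\<close>). It is a combination of columns in \<open>\<omega>\<close> and of rows in \<open>\<zeta>\<close>.\<close>

definition pullback_kernel :: "(nat \<Rightarrow> nat \<Rightarrow> complex^'r^'r) \<Rightarrow> complex \<Rightarrow> complex \<Rightarrow> complex" where
  "pullback_kernel C \<omega> \<zeta> = (\<Sum>k<N. \<Sum>l<N. \<Sum>i\<in>UNIV. \<Sum>j\<in>UNIV. C k l $ i $ j * poly (col_gen k i) \<omega> * poly (row_gen l j) \<zeta>)"

definition matrix_kernel :: "(nat \<Rightarrow> nat \<Rightarrow> complex^'r^'r) \<Rightarrow> complex \<Rightarrow> complex \<Rightarrow> complex^'r^'r" where
  "matrix_kernel C s z = (\<Sum>k<N. \<Sum>l<N. smult_mat (s ^ k * z ^ l) (C k l))"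

text \<open>Off the zeros of \<open>g\<close> and \<open>q\<close> this is entry \<open>j\<close> of \<open>h e\<close>, but it is a polynomial.\<close>

definition urow :: "complex \<Rightarrow> 'r \<Rightarrow> complex" where "urow \<zeta> j = \<kappa> * poly D \<zeta> ^ (N - 1) * poly (u j) \<zeta>"

text \<open>Off the zeros of \<open>gh\<close> and \<open>qh\<close> this is entry \<open>i\<close> of \<open>hh eh\<close>, but it is a polynomial.\<close>

definition vcol :: "complex \<Rightarrow> 'r \<Rightarrow> complex" where "vcol \<omega> i = \<kappa>h * poly D \<omega> ^ (N - 1) * poly (v i) \<omega>"

definition Kcol :: "(nat \<Rightarrow> nat \<Rightarrow> complex^'r^'r) \<Rightarrow> complex \<Rightarrow> nat \<Rightarrow> 'r \<Rightarrow> complex" where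
  "Kcol C \<zeta> k i = (\<Sum>l<N. \<Sum>j\<in>UNIV. C k l $ i $ j * poly (row_gen l j) \<zeta>)"

definition Krow :: "(nat \<Rightarrow> nat \<Rightarrow> complex^'r^'r) \<Rightarrow> complex \<Rightarrow> nat \<Rightarrow> 'r \<Rightarrow> complex" where
  "Krow C \<omega> l j = (\<Sum>k<N. \<Sum>i\<in>UNIV. C k l $ i $ j * poly (col_gen k i) \<omega>)"

lemma pullback_kernel_colpoly: "pullback_kernel C \<omega> \<zeta> = poly (colpoly (Kcol C \<zeta>)) \<omega>"
proof -
  have "poly (colpoly (Kcol C \<zeta>)) \<omega> = (\<Sum>k<N. \<Sum>i\<in>UNIV. \<Sum>l<N. \<Sum>j\<in>UNIV. C k l $ i $ j * poly (col_gen k i) \<omega> * poly (row_gen l j) \<zeta>)"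
    unfolding colpoly_def Kcol_def poly_sum poly_smult sum_distrib_right
    by (intro sum.cong refl) (simp only: mult_ac)
  also have "\<dots> = pullback_kernel C \<omega> \<zeta>"
    unfolding pullback_kernel_def by (intro sum.cong refl sum.swap)
  finally show ?thesis by simp
qed

lemma pullback_kernel_rowpoly: "pullback_kernel C \<omega> \<zeta> = poly (rowpoly (Krow C \<omega>)) \<zeta>"
proof -
  have "poly (rowpoly (Krow C \<omega>)) \<zeta> = (\<Sum>l<N. \<Sum>j\<in>UNIV. \<Sum>k<N. \<Sum>i\<in>UNIV. C k l $ i $ j * poly (col_gen k i) \<omega> * poly (row_gen l j) \<zeta>)"
    unfolding rowpoly_def Krow_def poly_sum poly_smult sum_distrib_right ..
  also have "\<dots> = (\<Sum>l<N. \<Sum>k<N. \<Sum>j\<in>UNIV. \<Sum>i\<in>UNIV. C k l $ i $ j * poly (col_gen k i) \<omega> * poly (row_gen l j) \<zeta>)"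
    by (intro sum.cong refl sum.swap)
  also have "\<dots> = (\<Sum>l<N. \<Sum>k<N. \<Sum>i\<in>UNIV. \<Sum>j\<in>UNIV. C k l $ i $ j * poly (col_gen k i) \<omega> * poly (row_gen l j) \<zeta>)"
    by (intro sum.cong refl sum.swap)
  also have "\<dots> = pullback_kernel C \<omega> \<zeta>"
    unfolding pullback_kernel_def by (rule sum.swap)
  finally show ?thesis by simp
qed

lemma pullback_kernel_kernel_fun: "\<exists>c0. pullback_kernel C = kernel_fun n c0"
proof -
  have "\<exists>c. \<forall>\<omega> \<zeta>. (\<Sum>k<N. \<Sum>l<N. \<Sum>i\<in>UNIV. \<Sum>j\<in>UNIV. C k l $ i $ j * poly (col_gen k i) \<omega> * poly (row_gen l j) \<zeta>) = kernel_fun n c \<omega> \<zeta>"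
    by (intro kernel_fun_sum kernel_fun_product degree_row_col_gen) auto
  then show ?thesis by (auto simp: pullback_kernel_def fun_eq_iff)
qed

lemma matrix_kernel_component: "matrix_kernel C s z $ i $ j = (\<Sum>k<N. \<Sum>l<N. s ^ k * z ^ l * C k l $ i $ j)"
  by (simp add: matrix_kernel_def)

lemma polyvec_Kcol:
  assumes "poly D \<zeta> \<noteq> 0"
  shows "polyvec (Kcol C \<zeta>) s i = (\<Sum>j\<in>UNIV. matrix_kernel C s (f \<zeta>) $ i $ j * urow \<zeta> j)"
proof -
  have row_gen: "poly (row_gen l j) \<zeta> = f \<zeta> ^ l * urow \<zeta> j" if "l < N" for l j
    using poly_row_gen[OF assms that, of j] by (simp add: urow_def)
  have "polyvec (Kcol C \<zeta>) s i = (\<Sum>k<N. \<Sum>l<N. \<Sum>j\<in>UNIV. (s ^ k * f \<zeta> ^ l * C k l $ i $ j) * urow \<zeta> j)"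
    unfolding polyvec_def Kcol_def sum_distrib_right by (intro sum.cong refl) (simp add: row_gen)
  also have "\<dots> = (\<Sum>k<N. \<Sum>j\<in>UNIV. \<Sum>l<N. (s ^ k * f \<zeta> ^ l * C k l $ i $ j) * urow \<zeta> j)"
    by (intro sum.cong refl sum.swap)
  also have "\<dots> = (\<Sum>j\<in>UNIV. \<Sum>k<N. \<Sum>l<N. (s ^ k * f \<zeta> ^ l * C k l $ i $ j) * urow \<zeta> j)"
    by (rule sum.swap)
  finally show ?thesis by (simp only: matrix_kernel_component sum_distrib_right)
qed

lemma polyvec_Krow:
  assumes "poly D \<omega> \<noteq> 0"
  shows "polyvec (Krow C \<omega>) s j = (\<Sum>i\<in>UNIV. vcol \<omega> i * matrix_kernel C (f \<omega>) s $ i $ j)"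
proof -
  have col_gen: "poly (col_gen k i) \<omega> = f \<omega> ^ k * vcol \<omega> i" if "k < N" for k i
    using poly_col_gen[OF assms that, of i] by (simp add: vcol_def)
  have "polyvec (Krow C \<omega>) s j = (\<Sum>l<N. \<Sum>k<N. \<Sum>i\<in>UNIV. vcol \<omega> i * (f \<omega> ^ k * s ^ l * C k l $ i $ j))"
    unfolding polyvec_def Krow_def sum_distrib_right by (intro sum.cong refl) (simp add: col_gen)
  also have "\<dots> = (\<Sum>k<N. \<Sum>l<N. \<Sum>i\<in>UNIV. vcol \<omega> i * (f \<omega> ^ k * s ^ l * C k l $ i $ j))"
    by (rule sum.swap)
  also have "\<dots> = (\<Sum>k<N. \<Sum>i\<in>UNIV. \<Sum>l<N. vcol \<omega> i * (f \<omega> ^ k * s ^ l * C k l $ i $ j))"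
    by (intro sum.cong refl sum.swap)
  also have "\<dots> = (\<Sum>i\<in>UNIV. \<Sum>k<N. \<Sum>l<N. vcol \<omega> i * (f \<omega> ^ k * s ^ l * C k l $ i $ j))"
    by (rule sum.swap)
  finally show ?thesis by (simp only: matrix_kernel_component sum_distrib_left)
qed

text \<open>For fixed \<open>\<zeta>\<close> the pulled back kernel is the column polynomial belonging to \<open>R(s, f \<zeta>) e(\<zeta>) h(\<zeta>)\<close>.\<close>

lemma left_pairing_iff:
  assumes curves: "\<forall>C\<in>set \<gamma>. piecewise_smooth_curve C" and D: "poly D \<zeta> \<noteq> 0"
    and P: "\<And>s i. P s $ a $ i = polyvec c s i"
  shows "has_lifted_integral M \<phi> \<gamma> (\<lambda>\<omega>. poly (rowpoly c) \<omega> * w \<omega> * pullback_kernel C \<omega> \<zeta>) val \<longleftrightarrow>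
    has_curve_integral \<gamma> (\<lambda>s. \<Sum>b\<in>UNIV. (P s ** W s ** matrix_kernel C s (f \<zeta>)) $ a $ b * urow \<zeta> b) val"
proof -
  have "(\<Sum>i\<in>UNIV. \<Sum>j\<in>UNIV. polyvec c s i * W s $ i $ j * polyvec (Kcol C \<zeta>) s j) =
      (\<Sum>b\<in>UNIV. (P s ** W s ** matrix_kernel C s (f \<zeta>)) $ a $ b * urow \<zeta> b)" for s
  proof -
    have "(\<Sum>i\<in>UNIV. \<Sum>j\<in>UNIV. polyvec c s i * W s $ i $ j * polyvec (Kcol C \<zeta>) s j) =
       (\<Sum>j\<in>UNIV. (\<Sum>i\<in>UNIV. polyvec c s i * W s $ i $ j) * polyvec (Kcol C \<zeta>) s j)"
      by (subst sum.swap) (simp only: sum_distrib_right)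
    also have "\<dots> = (\<Sum>j\<in>UNIV. (P s ** W s) $ a $ j * polyvec (Kcol C \<zeta>) s j)"
      by (simp add: matrix_matrix_mult_def P)
    also have "\<dots> = (\<Sum>j\<in>UNIV. \<Sum>b\<in>UNIV. (P s ** W s) $ a $ j * (matrix_kernel C s (f \<zeta>) $ j $ b * urow \<zeta> b))"
      by (simp only: polyvec_Kcol[OF D] sum_distrib_left)
    also have "\<dots> = (\<Sum>b\<in>UNIV. (\<Sum>j\<in>UNIV. (P s ** W s) $ a $ j * matrix_kernel C s (f \<zeta>) $ j $ b) * urow \<zeta> b)"
      by (subst sum.swap) (simp only: sum_distrib_right mult.assoc)
    also have "\<dots> = (\<Sum>b\<in>UNIV. (P s ** W s ** matrix_kernel C s (f \<zeta>)) $ a $ b * urow \<zeta> b)"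
      by (simp add: matrix_matrix_mult_def)
    finally show ?thesis .
  qed
  then show ?thesis unfolding pullback_kernel_colpoly lifted_integral_iff[OF curves] by simp
qed

text \<open>For fixed \<open>\<omega>\<close> the pulled back kernel is the row polynomial belonging to \<open>hh(\<omega>) eh(\<omega>) R(f \<omega>, s)\<close>.\<close>

lemma right_pairing_iff:
  assumes curves: "\<forall>C\<in>set \<gamma>. piecewise_smooth_curve C" and D: "poly D \<omega> \<noteq> 0"
    and P: "\<And>s i. P s $ i $ b = polyvec c s i"
  shows "has_lifted_integral M \<phi> \<gamma> (\<lambda>\<zeta>. pullback_kernel C \<omega> \<zeta> * w \<zeta> * poly (colpoly c) \<zeta>) val \<longleftrightarrow>
    has_curve_integral \<gamma> (\<lambda>s. \<Sum>a\<in>UNIV. vcol \<omega> a * (matrix_kernel C (f \<omega>) s ** W s ** P s) $ a $ b) val"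
proof -
  have "(\<Sum>i\<in>UNIV. \<Sum>j\<in>UNIV. polyvec (Krow C \<omega>) s i * W s $ i $ j * polyvec c s j) =
      (\<Sum>a\<in>UNIV. vcol \<omega> a * (matrix_kernel C (f \<omega>) s ** W s ** P s) $ a $ b)" for s
  proof -
    have "(\<Sum>i\<in>UNIV. \<Sum>j\<in>UNIV. polyvec (Krow C \<omega>) s i * W s $ i $ j * polyvec c s j) =
       (\<Sum>i\<in>UNIV. polyvec (Krow C \<omega>) s i * (\<Sum>j\<in>UNIV. W s $ i $ j * polyvec c s j))"
      by (simp only: sum_distrib_left mult.assoc)
    also have "\<dots> = (\<Sum>i\<in>UNIV. polyvec (Krow C \<omega>) s i * (W s ** P s) $ i $ b)"
      by (simp add: matrix_matrix_mult_def P)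
    also have "\<dots> = (\<Sum>i\<in>UNIV. \<Sum>a\<in>UNIV. vcol \<omega> a * (matrix_kernel C (f \<omega>) s $ a $ i * (W s ** P s) $ i $ b))"
      by (simp only: polyvec_Krow[OF D] sum_distrib_right mult.assoc)
    also have "\<dots> = (\<Sum>a\<in>UNIV. vcol \<omega> a * (\<Sum>i\<in>UNIV. matrix_kernel C (f \<omega>) s $ a $ i * (W s ** P s) $ i $ b))"
      by (subst sum.swap) (simp only: sum_distrib_left)
    also have "\<dots> = (\<Sum>a\<in>UNIV. vcol \<omega> a * (matrix_kernel C (f \<omega>) s ** W s ** P s) $ a $ b)"
      by (simp add: matrix_mul_assoc[symmetric]) (simp add: matrix_matrix_mult_def)
    finally show ?thesis .
  qed
  then show ?thesis unfolding pullback_kernel_rowpoly lifted_integral_iff[OF curves] by simp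
qed

lemma poly_rowpoly_urow: "poly D \<zeta> \<noteq> 0 \<Longrightarrow> poly (rowpoly c) \<zeta> = (\<Sum>i\<in>UNIV. polyvec c (f \<zeta>) i * urow \<zeta> i)"
  unfolding urow_def by (rule poly_rowpoly)

lemma poly_colpoly_vcol: "poly D \<zeta> \<noteq> 0 \<Longrightarrow> poly (colpoly c) \<zeta> = (\<Sum>i\<in>UNIV. vcol \<zeta> i * polyvec c (f \<zeta>) i)"
proof -
  assume "poly D \<zeta> \<noteq> 0"
  then show ?thesis
    unfolding vcol_def poly_colpoly[OF \<open>poly D \<zeta> \<noteq> 0\<close>] by (intro sum.cong refl mult.commute)
qed

lemma mat_polys_rows:
  fixes P :: "complex \<Rightarrow> complex^'r^'r"
  assumes "P \<in> mat_polys (N - 1)"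
  shows "\<exists>c. \<forall>s. P s $ a $ b = (\<Sum>l<N. c l a b * s ^ l)"
proof -
  have set: "{..N - 1} = {..<N}" using N by auto
  obtain C :: "nat \<Rightarrow> complex^'r^'r" where "P = (\<lambda>z. \<Sum>l<N. smult_mat (z ^ l) (C l))"
    using assms unfolding mat_polys_def set by blast
  then have "\<forall>s. P s $ a $ b = (\<Sum>l<N. C l $ a $ b * s ^ l)" by (simp add: mult.commute)
  then show ?thesis by (intro exI[of _ "\<lambda>l a b. C l $ a $ b"])
qed

lemma polyvec_mat_polys:
  fixes c :: "nat \<Rightarrow> 'r \<Rightarrow> complex"
  shows "(\<lambda>s. (\<chi> a i. polyvec c s i) :: complex^'r^'r) \<in> mat_polys (N - 1)"
    "(\<lambda>s. (\<chi> i b. polyvec c s i) :: complex^'r^'r) \<in> mat_polys (N - 1)"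
proof -
  have set: "{..N - 1} = {..<N}" using N by auto
  have "((\<chi> a i. polyvec c s i) :: complex^'r^'r) = (\<Sum>l\<le>N - 1. smult_mat (s ^ l) (\<chi> a i. c l i))" for s
    unfolding set by (simp add: vec_eq_iff polyvec_def mult.commute)
  then show "(\<lambda>s. (\<chi> a i. polyvec c s i) :: complex^'r^'r) \<in> mat_polys (N - 1)"
    unfolding mat_polys_def mem_Collect_eq by (intro exI[of _ "\<lambda>l. \<chi> a i. c l i"] ext)
  have "((\<chi> i b. polyvec c s i) :: complex^'r^'r) = (\<Sum>l\<le>N - 1. smult_mat (s ^ l) (\<chi> i b. c l i))" for s
    unfolding set by (simp add: vec_eq_iff polyvec_def mult.commute)
  then show "(\<lambda>s. (\<chi> i b. polyvec c s i) :: complex^'r^'r) \<in> mat_polys (N - 1)"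
    unfolding mat_polys_def mem_Collect_eq by (intro exI[of _ "\<lambda>l. \<chi> i b. c l i"] ext)
qed

text \<open>A row of polynomials is the first factor of a pairing; repeated in all rows it becomes a square matrix to which the
  matrix reproducing property applies.\<close>

lemma left_transfer:
  assumes curves: "\<forall>C\<in>set \<gamma>. piecewise_smooth_curve C" and D: "poly D \<zeta> \<noteq> 0"
    and left: "\<And>P. P \<in> mat_polys (N - 1) \<Longrightarrow> mat_integral (has_curve_integral \<gamma>) (\<lambda>s. P s ** W s ** matrix_kernel C s (f \<zeta>)) (P (f \<zeta>))"
  shows "has_lifted_integral M \<phi> \<gamma> (\<lambda>\<omega>. poly (rowpoly c) \<omega> * w \<omega> * pullback_kernel C \<omega> \<zeta>) (poly (rowpoly c) \<zeta>)"
proof -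
  interpret J: linear_integral "has_curve_integral \<gamma>" by (rule linear_curve_integral)
  define P :: "complex \<Rightarrow> complex^'r^'r" where "P = (\<lambda>s. \<chi> a i. polyvec c s i)"
  define a where "a = (undefined :: 'r)"
  have P: "P s $ a $ i = polyvec c s i" for s i by (simp add: P_def)
  have "mat_integral (has_curve_integral \<gamma>) (\<lambda>s. P s ** W s ** matrix_kernel C s (f \<zeta>)) (P (f \<zeta>))"
    unfolding P_def by (rule left, rule polyvec_mat_polys(1))
  then have "has_curve_integral \<gamma> (\<lambda>s. \<Sum>b\<in>UNIV. urow \<zeta> b * (P s ** W s ** matrix_kernel C s (f \<zeta>)) $ a $ b) (\<Sum>b\<in>UNIV. urow \<zeta> b * P (f \<zeta>) $ a $ b)"
    unfolding mat_integral_def by (intro J.sum J.cmult) blast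
  then show ?thesis
    unfolding left_pairing_iff[OF curves D P] poly_rowpoly_urow[OF D] by (simp only: P mult.commute)
qed

lemma right_transfer:
  assumes curves: "\<forall>C\<in>set \<gamma>. piecewise_smooth_curve C" and D: "poly D \<omega> \<noteq> 0"
    and right: "\<And>P. P \<in> mat_polys (N - 1) \<Longrightarrow> mat_integral (has_curve_integral \<gamma>) (\<lambda>s. matrix_kernel C (f \<omega>) s ** W s ** P s) (P (f \<omega>))"
  shows "has_lifted_integral M \<phi> \<gamma> (\<lambda>\<zeta>. pullback_kernel C \<omega> \<zeta> * w \<zeta> * poly (colpoly c) \<zeta>) (poly (colpoly c) \<omega>)"
proof -
  interpret J: linear_integral "has_curve_integral \<gamma>" by (rule linear_curve_integral)
  define P :: "complex \<Rightarrow> complex^'r^'r" where "P = (\<lambda>s. \<chi> i b. polyvec c s i)"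
  define b where "b = (undefined :: 'r)"
  have P: "P s $ i $ b = polyvec c s i" for s i by (simp add: P_def)
  have "mat_integral (has_curve_integral \<gamma>) (\<lambda>s. matrix_kernel C (f \<omega>) s ** W s ** P s) (P (f \<omega>))"
    unfolding P_def by (rule right, rule polyvec_mat_polys(2))
  then have "has_curve_integral \<gamma> (\<lambda>s. \<Sum>a\<in>UNIV. vcol \<omega> a * (matrix_kernel C (f \<omega>) s ** W s ** P s) $ a $ b) (\<Sum>a\<in>UNIV. vcol \<omega> a * P (f \<omega>) $ a $ b)"
    unfolding mat_integral_def by (intro J.sum J.cmult) blast
  then show ?thesis
    unfolding right_pairing_iff[OF curves D P] poly_colpoly_vcol[OF D] by (simp only: P)
qed

lemma urow_eq: "generic z \<Longrightarrow> urow (branch z k) j = ev (branch z k) $ j * h (branch z k)"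
  by (simp add: urow_def e_h generic_points(4,5))

lemma vcol_eq: "generic z \<Longrightarrow> vcol (branch z k) j = ehv (branch z k) $ j * hh (branch z k)"
  by (simp add: vcol_def eh_hh generic_points(6,7))

text \<open>The scalar property at the \<open>r\<close> points over \<open>z\<close> is the matrix property contracted with \<open>r\<close> eigenvectors.
  As these form a basis with dual basis \<open>ehv\<close>, the matrix entries are recovered.\<close>

lemma left_transfer_back:
  assumes curves: "\<forall>C\<in>set \<gamma>. piecewise_smooth_curve C" and z: "generic z"
    and left: "\<And>c \<zeta>. has_lifted_integral M \<phi> \<gamma> (\<lambda>\<omega>. poly (rowpoly c) \<omega> * w \<omega> * pullback_kernel C \<omega> \<zeta>) (poly (rowpoly c) \<zeta>)"
    and P: "P \<in> mat_polys (N - 1)"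
  shows "mat_integral (has_curve_integral \<gamma>) (\<lambda>s. P s ** W s ** matrix_kernel C s z) (P z)"
  unfolding mat_integral_def
proof (intro allI)
  interpret J: linear_integral "has_curve_integral \<gamma>" by (rule linear_curve_integral)
  fix a b
  have "\<exists>c. \<forall>s i. P s $ a $ i = polyvec c s i"
  proof -
    have "\<forall>i. \<exists>c. \<forall>s. P s $ a $ i = (\<Sum>l<N. c l * s ^ l)" using mat_polys_rows[OF P] by metis
    then obtain c where "\<forall>i s. P s $ a $ i = (\<Sum>l<N. c i l * s ^ l)" by metis
    then show ?thesis by (intro exI[of _ "\<lambda>l i. c i l"]) (simp add: polyvec_def)
  qed
  then obtain c where c: "\<And>s i. P s $ a $ i = polyvec c s i" by blast
  define F where "F = (\<lambda>s j. (P s ** W s ** matrix_kernel C s z) $ a $ j)"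
  \<comment> \<open>Summation against \<open>t\<close> extracts entry \<open>b\<close>, because the dual basis undoes the contraction with the eigenvectors.\<close>
  define t where "t = (\<lambda>k. ehv (branch z k) $ b / h (branch z k))"
  have delta: "(\<Sum>k\<in>UNIV. t k * (\<Sum>j\<in>UNIV. y j * urow (branch z k) j)) = y b" for y
  proof -
    have "(\<Sum>k\<in>UNIV. t k * (\<Sum>j\<in>UNIV. y j * urow (branch z k) j)) =
        (\<Sum>k\<in>UNIV. \<Sum>j\<in>UNIV. y j * (ev (branch z k) $ j * ehv (branch z k) $ b))"
      unfolding sum_distrib_left t_def urow_eq[OF z] using generic_points(10)[OF z] by (intro sum.cong refl) (simp add: field_simps)
    also have "\<dots> = (\<Sum>j\<in>UNIV. y j * (if j = b then 1 else 0))"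
      by (subst sum.swap) (simp only: sum_distrib_left[symmetric] generic_sums(1)[OF z])
    also have "\<dots> = y b" by (simp add: if_distrib[of "\<lambda>x. _ * x"] cong: if_cong)
    finally show ?thesis .
  qed
  have step: "has_curve_integral \<gamma> (\<lambda>s. \<Sum>j\<in>UNIV. F s j * urow (branch z k) j) (\<Sum>j\<in>UNIV. polyvec c z j * urow (branch z k) j)" for k
    using left[of c "branch z k"] generic_points(2,3)[OF z, of k]
    unfolding left_pairing_iff[OF curves generic_points(2)[OF z] c] poly_rowpoly_urow[OF generic_points(2)[OF z]] F_def by simp
  have "has_curve_integral \<gamma> (\<lambda>s. \<Sum>k\<in>UNIV. t k * (\<Sum>j\<in>UNIV. F s j * urow (branch z k) j)) (\<Sum>k\<in>UNIV. t k * (\<Sum>j\<in>UNIV. polyvec c z j * urow (branch z k) j))"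
    by (rule J.sum, rule J.cmult, rule step)
  then show "has_curve_integral \<gamma> (\<lambda>s. (P s ** W s ** matrix_kernel C s z) $ a $ b) (P z $ a $ b)"
    unfolding delta by (simp only: F_def c)
qed

lemma right_transfer_back:
  assumes curves: "\<forall>C\<in>set \<gamma>. piecewise_smooth_curve C" and z: "generic z"
    and right: "\<And>c \<omega>. has_lifted_integral M \<phi> \<gamma> (\<lambda>\<zeta>. pullback_kernel C \<omega> \<zeta> * w \<zeta> * poly (colpoly c) \<zeta>) (poly (colpoly c) \<omega>)"
    and P: "P \<in> mat_polys (N - 1)"
  shows "mat_integral (has_curve_integral \<gamma>) (\<lambda>s. matrix_kernel C z s ** W s ** P s) (P z)"
  unfolding mat_integral_def
proof (intro allI)
  interpret J: linear_integral "has_curve_integral \<gamma>" by (rule linear_curve_integral)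
  fix a b
  have "\<exists>c. \<forall>s i. P s $ i $ b = polyvec c s i"
  proof -
    have "\<forall>i. \<exists>c. \<forall>s. P s $ i $ b = (\<Sum>l<N. c l * s ^ l)" using mat_polys_rows[OF P] by metis
    then obtain c where "\<forall>i s. P s $ i $ b = (\<Sum>l<N. c i l * s ^ l)" by metis
    then show ?thesis by (intro exI[of _ "\<lambda>l i. c i l"]) (simp add: polyvec_def)
  qed
  then obtain c where c: "\<And>s i. P s $ i $ b = polyvec c s i" by blast
  define F where "F = (\<lambda>s i. (matrix_kernel C z s ** W s ** P s) $ i $ b)"
  define t where "t = (\<lambda>k. ev (branch z k) $ a / hh (branch z k))"
  have delta: "(\<Sum>k\<in>UNIV. t k * (\<Sum>j\<in>UNIV. vcol (branch z k) j * y j)) = y a" for y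
  proof -
    have "(\<Sum>k\<in>UNIV. t k * (\<Sum>j\<in>UNIV. vcol (branch z k) j * y j)) =
        (\<Sum>k\<in>UNIV. \<Sum>j\<in>UNIV. y j * (ev (branch z k) $ a * ehv (branch z k) $ j))"
      unfolding sum_distrib_left t_def vcol_eq[OF z] using generic_points(11)[OF z] by (intro sum.cong refl) (simp add: field_simps)
    also have "\<dots> = (\<Sum>j\<in>UNIV. y j * (if a = j then 1 else 0))"
      by (subst sum.swap) (simp only: sum_distrib_left[symmetric] generic_sums(1)[OF z])
    also have "\<dots> = y a" by (simp add: if_distrib[of "\<lambda>x. _ * x"] cong: if_cong)
    finally show ?thesis .
  qed
  have step: "has_curve_integral \<gamma> (\<lambda>s. \<Sum>j\<in>UNIV. vcol (branch z k) j * F s j) (\<Sum>j\<in>UNIV. vcol (branch z k) j * polyvec c z j)" for k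
    using right[of "branch z k" c] generic_points(2,3)[OF z, of k]
    unfolding right_pairing_iff[OF curves generic_points(2)[OF z] c] poly_colpoly_vcol[OF generic_points(2)[OF z]] F_def by simp
  have "has_curve_integral \<gamma> (\<lambda>s. \<Sum>k\<in>UNIV. t k * (\<Sum>j\<in>UNIV. vcol (branch z k) j * F s j)) (\<Sum>k\<in>UNIV. t k * (\<Sum>j\<in>UNIV. vcol (branch z k) j * polyvec c z j))"
    by (rule J.sum, rule J.cmult, rule step)
  then show "has_curve_integral \<gamma> (\<lambda>s. (matrix_kernel C z s ** W s ** P s) $ a $ b) (P z $ a $ b)"
    unfolding delta by (simp only: F_def c)
qed

text \<open>At regular points neither the eigenvectors nor \<open>f\<close> take a conventional value, so that the identity holds literally.\<close>

lemma kernel_value: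
  assumes "regular_point M \<phi> eh \<omega>" "regular_point M \<phi> e \<zeta>"
  shows "hh \<omega> * row_mat_col (ehv \<omega>) (matrix_kernel C (f \<omega>) (f \<zeta>)) (ev \<zeta>) * h \<zeta> = pullback_kernel C \<omega> \<zeta>"
proof -
  have r: "poly D \<omega> \<noteq> 0" "poly gh \<omega> \<noteq> 0" "poly qh \<omega> \<noteq> 0" "poly D \<zeta> \<noteq> 0" "poly g \<zeta> \<noteq> 0" "poly q \<zeta> \<noteq> 0"
    using assms Dz[of \<omega>] Dz[of \<zeta>] e_sing[of \<zeta>] eh_sing[of \<omega>] by (simp_all add: regular_point_def)
  have "hh \<omega> * row_mat_col (ehv \<omega>) (matrix_kernel C (f \<omega>) (f \<zeta>)) (ev \<zeta>) * h \<zeta> =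
      (\<Sum>i\<in>UNIV. \<Sum>j\<in>UNIV. (ehv \<omega> $ i * hh \<omega>) * matrix_kernel C (f \<omega>) (f \<zeta>) $ i $ j * (ev \<zeta> $ j * h \<zeta>))"
    unfolding row_mat_col_def sum_distrib_left sum_distrib_right by (intro sum.cong refl) (simp only: mult_ac)
  also have "\<dots> = (\<Sum>i\<in>UNIV. \<Sum>j\<in>UNIV. vcol \<omega> i * matrix_kernel C (f \<omega>) (f \<zeta>) $ i $ j * urow \<zeta> j)"
    by (simp only: e_h[OF r(5,6)] eh_hh[OF r(2,3)] urow_def vcol_def)
  also have "\<dots> = (\<Sum>i\<in>UNIV. polyvec (Kcol C \<zeta>) (f \<omega>) i * vcol \<omega> i)"
    unfolding polyvec_Kcol[OF r(4)] sum_distrib_right by (intro sum.cong refl) (simp only: mult_ac)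
  also have "\<dots> = pullback_kernel C \<omega> \<zeta>"
    unfolding pullback_kernel_colpoly poly_colpoly_vcol[OF r(1)] by (simp only: mult.commute)
  finally show ?thesis .
qed

end

section \<open>Decay of the scalar weight\<close>

lemma poly_over_power_tendsto:
  fixes p :: "complex poly"
  assumes "degree p \<le> m"
  shows "((\<lambda>x. poly p x / x ^ m) \<longlongrightarrow> coeff p m) at_infinity"
proof (cases "degree p = m")
  case True
  then show ?thesis using poly_divide_tendsto_aux[of p] by simp
next
  case False
  then have lt: "degree p < degree (monom (1 :: complex) m)" using assms by (simp add: degree_monom_eq)
  from poly_divide_tendsto_0_at_infinity[OF lt]
  have "((\<lambda>x. poly p x / x ^ m) \<longlongrightarrow> 0) at_infinity" by (simp add: poly_monom)
  then show ?thesis using False assms by (simp add: coeff_eq_0)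
qed

lemma eventually_at_infinity_notin_finite:
  assumes "finite S"
  shows "\<forall>\<^sub>F x :: complex in at_infinity. x \<notin> S"
proof -
  obtain B where "\<And>x. x \<in> S \<Longrightarrow> norm x \<le> B" using finite_imp_bounded[OF assms] by (auto simp: bounded_iff)
  then show ?thesis unfolding eventually_at_infinity by (intro exI[of _ "B + 1"]) force
qed

lemma poly_growth_lower:
  fixes p :: "complex poly"
  assumes "p \<noteq> 0"
  obtains b where "b > 0" "\<forall>\<^sub>F x in at_infinity. b * norm x ^ degree p \<le> norm (poly p x)"
proof -
  define l where "l = norm (lead_coeff p)"
  have l: "l > 0" using assms by (simp add: l_def)
  have "((\<lambda>x. norm (poly p x / x ^ degree p)) \<longlongrightarrow> l) at_infinity"
    unfolding l_def by (intro tendsto_norm poly_over_power_tendsto order_refl)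
  moreover have "l / 2 < l" using l by simp
  ultimately have "\<forall>\<^sub>F x in at_infinity. l / 2 < norm (poly p x / x ^ degree p)" by (rule order_tendstoD(1))
  moreover have "\<forall>\<^sub>F x :: complex in at_infinity. x \<noteq> 0"
    using eventually_at_infinity_notin_finite[of "{0}"] by simp
  ultimately have "\<forall>\<^sub>F x in at_infinity. l / 2 * norm x ^ degree p \<le> norm (poly p x)"
  proof eventually_elim
    case (elim x)
    then show ?case by (simp add: norm_divide norm_power pos_less_divide_eq less_imp_le)
  qed
  then show thesis using l by (intro that[of "l / 2"]) simp_all
qed

text \<open>Numerator and denominator are coprime, so a point that is not a pole is no zero of the denominator.\<close>

lemma rational_isCont:
  assumes W: "rational_matrix W" and np: "\<not> is_pole (\<lambda>z. W z $ i $ j) z0"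
  shows "isCont (\<lambda>z. W z $ i $ j) z0"
proof -
  obtain p q :: "complex poly" where pq: "q \<noteq> 0" "coprime p q" "\<And>z. W z $ i $ j = poly p z / poly q z"
    using W unfolding rational_matrix_def by blast
  have "poly q z0 \<noteq> 0"
  proof
    assume z: "poly q z0 = 0"
    then have pz: "poly p z0 \<noteq> 0" using pq(2) coprime_poly_0 by blast
    then have p0: "p \<noteq> 0" by auto
    have "order z0 p = 0" "order z0 q > 0" using pz z pq(1) by (simp_all add: order_root)
    then have "zorder (\<lambda>z. poly p z / poly q z) z0 < 0" by (simp add: zorder_rational p0 pq(1))
    moreover have "\<forall>\<^sub>F w in at z0. poly p w / poly q w \<noteq> 0"
      using poly_frequently_nz[OF p0, of z0] poly_frequently_nz[OF pq(1), of z0] by eventually_elim simp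
    moreover have "(\<lambda>w. poly p w / poly q w) meromorphic_on {z0}"
      by (intro meromorphic_intros meromorphic_poly)
    ultimately have "is_pole (\<lambda>w. poly p w / poly q w) z0" by (intro zorder_neg_imp_is_pole)
    then show False using np by (simp add: pq(3))
  qed
  then show ?thesis unfolding pq(3) by (intro continuous_intros)
qed

context eigen_space
begin

lemma A_minus_smult_D: "A - smult z D \<noteq> 0"
proof
  assume "A - smult z D = 0"
  then have A: "A = smult z D" by simp
  then have dA: "pderiv A = smult z (pderiv D)" by (metis pderiv_smult)
  have "pderiv A * D - A * pderiv D = smult z (pderiv D) * D - smult z D * pderiv D"
    using A dA by metis
  then have "Wr = 0" unfolding Wr_def by (simp add: mult.commute)
  then show False using Wr0 by simp
qed

lemma finite_not_generic_points: "finite {\<omega>. \<not> (poly D \<omega> \<noteq> 0 \<and> generic (f \<omega>))}"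
proof (rule finite_subset)
  show "{\<omega>. \<not> (poly D \<omega> \<noteq> 0 \<and> generic (f \<omega>))} \<subseteq> {\<omega>. poly D \<omega> = 0} \<union> (\<Union>z\<in>{z. \<not> generic z}. {\<omega>. poly (A - smult z D) \<omega> = 0})"
    using f_eq by force
  show "finite ({\<omega>. poly D \<omega> = 0} \<union> (\<Union>z\<in>{z. \<not> generic z}. {\<omega>. poly (A - smult z D) \<omega> = 0}))"
    by (intro finite_UnI finite_UN_I finite_not_generic poly_roots_finite D0 A_minus_smult_D)
qed

lemma generic_point_branch:
  assumes "poly D \<omega> \<noteq> 0" "generic (f \<omega>)"
  obtains k where "\<omega> = branch (f \<omega>) k"
proof -
  have "poly A \<omega> = f \<omega> * poly D \<omega>" using f_eq[OF assms(1)] assms(1) by simp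
  then have "\<omega> \<in> range (branch (f \<omega>))" using assms(2) unfolding generic_def by blast
  then show thesis using that by blast
qed

text \<open>The normalization \<open>eh e = 1\<close> expresses the scalar factors of the eigenvectors by the Wronskian, by duality on the diagonal.
  The Wronskian then cancels against the derivative of \<open>f\<close>.\<close>

lemma weight_eq:
  obtains k where "\<And>\<omega>. poly D \<omega> \<noteq> 0 \<Longrightarrow> generic (f \<omega>) \<Longrightarrow> w \<omega> = k * lamv \<omega> / poly D \<omega> ^ (2 * N)"
proof -
  obtain c H where c: "c \<noteq> 0" and diag: "\<And>x. (\<Sum>i\<in>UNIV. poly (u i) x * poly (v i) x) = c * poly Wr x"
    by (rule duality) blast
  show thesis
  proof (rule that)
    fix \<omega> assume D: "poly D \<omega> \<noteq> 0" and generic: "generic (f \<omega>)"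
    obtain k where k: "\<omega> = branch (f \<omega>) k" by (rule generic_point_branch[OF D generic])
    have gq: "poly g \<omega> \<noteq> 0" "poly q \<omega> \<noteq> 0" "poly gh \<omega> \<noteq> 0" "poly qh \<omega> \<noteq> 0" "deriv f \<omega> \<noteq> 0"
      using generic_points(4-8)[OF generic, of k] k by simp_all
    define G where "G = poly g \<omega> * poly gh \<omega> / (poly q \<omega> * poly qh \<omega>)"
    have "(\<Sum>i\<in>UNIV. ehv \<omega> $ i * ev \<omega> $ i) = 1"
      using generic_sums(2)[OF generic, of k k] k by simp
    moreover have "(\<Sum>i\<in>UNIV. ehv \<omega> $ i * ev \<omega> $ i) = G * (\<Sum>i\<in>UNIV. poly (u i) \<omega> * poly (v i) \<omega>)"
      unfolding sum_distrib_left by (intro sum.cong refl) (simp add: e_eq eh_eq gq G_def mult_ac)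
    ultimately have G: "G * (c * poly Wr \<omega>) = 1" by (simp add: diag)
    then have Wr: "poly Wr \<omega> \<noteq> 0" and G0: "G \<noteq> 0" by auto
    have hhG: "(h \<omega> * hh \<omega>) * G = \<kappa> * \<kappa>h * poly D \<omega> ^ (N - 1) * poly D \<omega> ^ (N - 1)"
      using gq by (simp add: h_eq hh_eq G_def mult_ac)
    have "(h \<omega> * hh \<omega>) * (G * (c * poly Wr \<omega>)) = ((h \<omega> * hh \<omega>) * G) * (c * poly Wr \<omega>)"
      by (simp only: mult.assoc)
    also have "\<dots> = \<kappa> * \<kappa>h * c * poly D \<omega> ^ (N - 1) * poly D \<omega> ^ (N - 1) * poly Wr \<omega>"
      unfolding hhG by (simp only: mult_ac)
    finally have hhh: "h \<omega> * hh \<omega> = \<kappa> * \<kappa>h * c * poly D \<omega> ^ (N - 1) * poly D \<omega> ^ (N - 1) * poly Wr \<omega>"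
      by (simp add: G)
    have pow: "poly D \<omega> ^ (2 * N) = poly D \<omega> ^ (N - 1) * poly D \<omega> ^ (N - 1) * poly D \<omega> ^ 2"
    proof -
      have "2 * N = (N - 1) + (N - 1) + 2" using N by simp
      then show ?thesis by (metis power_add)
    qed
    show "w \<omega> = (1 / (\<kappa> * \<kappa>h * c)) * lamv \<omega> / poly D \<omega> ^ (2 * N)"
      unfolding scalar_weight_def hhh deriv_f[OF D] pow using D Wr c \<kappa>0 by (simp add: field_simps)
  qed
qed

definition Wsize :: "complex \<Rightarrow> real" where "Wsize z = (\<Sum>i\<in>UNIV. \<Sum>j\<in>UNIV. norm (W z $ i $ j))"

text \<open>Compare the two sides of \<open>W e = \<lambda> e\<close> at the largest entry of \<open>e\<close>.\<close>

lemma eigenvalue_bound: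
  assumes z: "generic z"
  shows "norm (lamv (branch z k)) \<le> Wsize z"
proof -
  define m where "m = Max (range (\<lambda>i. norm (ev (branch z k) $ i)))"
  have m: "norm (ev (branch z k) $ i) \<le> m" for i unfolding m_def by (intro Max_ge) auto
  have "m \<in> range (\<lambda>i. norm (ev (branch z k) $ i))" unfolding m_def by (intro Max_in) auto
  then obtain i where i: "norm (ev (branch z k) $ i) = m" by auto
  have "m > 0"
  proof (rule ccontr)
    assume "\<not> m > 0"
    then have "ev (branch z k) $ j = 0" for j using m[of j] by (metis dual_order.trans norm_le_zero_iff not_less)
    then have "(\<Sum>j\<in>UNIV. ehv (branch z k) $ j * ev (branch z k) $ j) = 0" by simp
    then show False using generic_sums(2)[OF z, of k k] by simp
  qed
  have "(\<Sum>j\<in>UNIV. W z $ i $ j * ev (branch z k) $ j) =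
      (\<Sum>j\<in>UNIV. \<Sum>l\<in>UNIV. (ev (branch z l) $ i * lamv (branch z l)) * (ehv (branch z l) $ j * ev (branch z k) $ j))"
    unfolding generic_sums(3)[OF z] sum_distrib_right by (intro sum.cong refl) (simp only: mult_ac)
  also have "\<dots> = (\<Sum>l\<in>UNIV. (ev (branch z l) $ i * lamv (branch z l)) * (if l = k then 1 else 0))"
    by (subst sum.swap) (simp only: sum_distrib_left[symmetric] generic_sums(2)[OF z])
  also have "\<dots> = ev (branch z k) $ i * lamv (branch z k)"
    by (simp add: if_distrib[of "\<lambda>x. _ * x"] cong: if_cong)
  finally have "norm (lamv (branch z k)) * m = norm (\<Sum>j\<in>UNIV. W z $ i $ j * ev (branch z k) $ j)"
    using i by (simp add: norm_mult mult.commute)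
  also have "\<dots> \<le> (\<Sum>j\<in>UNIV. norm (W z $ i $ j) * m)"
    by (intro sum_norm_le) (simp add: norm_mult mult_left_mono m)
  also have "\<dots> = (\<Sum>j\<in>UNIV. norm (W z $ i $ j)) * m" by (simp add: sum_distrib_right)
  also have "\<dots> \<le> Wsize z * m"
    unfolding Wsize_def using \<open>m > 0\<close>
    by (intro mult_right_mono member_le_sum[of i UNIV "\<lambda>i. \<Sum>j\<in>UNIV. norm (W z $ i $ j)"]) (auto intro: sum_nonneg)
  finally show ?thesis using \<open>m > 0\<close> by simp
qed

lemma f_on_lifted_curve: "\<omega> \<in> lifted_curve M \<phi> \<gamma> \<Longrightarrow> f \<omega> \<in> curve_image \<gamma>"
proof -
  assume "\<omega> \<in> lifted_curve M \<phi> \<gamma>"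
  then obtain j z where z: "z \<in> curve_image \<gamma>" "\<phi> (Some \<omega>) = sheet M j (Some z)"
    unfolding lifted_curve_def by blast
  then have "f \<omega> = z" by (simp add: phi_proj_def)
  then show ?thesis using z by simp
qed

text \<open>An unbounded lifted curve contains points tending to infinity, and the value of \<open>f\<close> at infinity is then in the closure of the
  original curve on the sphere, and the curve is closed in the plane. If it is a point \<open>z0\<close> of the curve, \<open>W\<close> is bounded near \<open>z0\<close>, and \<open>D\<close> has the full degree \<open>r\<close>. If it is infinity, the curve
  is unbounded; then the decay of \<open>W\<close> applies and gives the factor \<open>1 / f^(2N)\<close>, in which \<open>A\<close> has the full degree.\<close>

lemma Wsize_growth:
  assumes curves: "\<forall>C\<in>set \<gamma>. piecewise_smooth_curve C"
    and rat: "rational_matrix W"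
    and no_pole: "\<forall>z\<in>curve_image \<gamma>. \<forall>i j. \<not> is_pole (\<lambda>z. W z $ i $ j) z"
    and decay: "\<not> bounded (curve_image \<gamma>) \<Longrightarrow> \<forall>i j. (\<lambda>z. W z $ i $ j) \<in> O[at_infinity](\<lambda>z. 1 / z ^ (2 * N))"
    and unb: "\<not> bounded (lifted_curve M \<phi> \<gamma>)"
  obtains b where "b \<ge> 0" "\<forall>\<^sub>F \<omega> in at_infinity. Wsize (f \<omega>) \<le> b * norm (poly D \<omega>) ^ (2 * N) / norm \<omega> ^ (2 * n)"
proof -
  have freq: "\<exists>\<^sub>F \<omega> in at_infinity. f \<omega> \<in> curve_image \<gamma>"
  proof (rule ccontr)
    assume "\<not> ?thesis"
    then have "\<forall>\<^sub>F \<omega> in at_infinity. f \<omega> \<notin> curve_image \<gamma>" by (simp add: frequently_def)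
    then obtain B where "\<And>\<omega>. norm \<omega> \<ge> B \<Longrightarrow> f \<omega> \<notin> curve_image \<gamma>" unfolding eventually_at_infinity by blast
    then have "norm \<omega> \<le> B" if "\<omega> \<in> lifted_curve M \<phi> \<gamma>" for \<omega>
      using f_on_lifted_curve[OF that] by (meson nle_le)
    then show False using unb by (auto simp: bounded_iff)
  qed
  have evD: "\<forall>\<^sub>F \<omega> in at_infinity. poly D \<omega> \<noteq> 0"
    using eventually_at_infinity_notin_finite[OF poly_roots_finite[OF D0]] by simp
  have ev0: "\<forall>\<^sub>F \<omega> :: complex in at_infinity. \<omega> \<noteq> 0"
    using eventually_at_infinity_notin_finite[of "{0}"] by simp
  have n2: "(norm \<omega> ^ CARD('r)) ^ (2 * N) = norm \<omega> ^ (2 * n)" for \<omega> :: complex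
    by (simp add: n_eq power_mult[symmetric] mult_ac)
  have Wnn: "Wsize z \<ge> 0" for z unfolding Wsize_def by (intro sum_nonneg) auto
  show thesis
  proof (cases "degree D = CARD('r)")
    case True
    define z0 where "z0 = coeff A CARD('r) / coeff D CARD('r)"
    have "coeff D CARD('r) \<noteq> 0" using True D0 by (metis leading_coeff_0_iff)
    then have "((\<lambda>\<omega>. (poly A \<omega> / \<omega> ^ CARD('r)) / (poly D \<omega> / \<omega> ^ CARD('r))) \<longlongrightarrow> z0) at_infinity"
      unfolding z0_def by (intro tendsto_divide poly_over_power_tendsto degA degD)
    moreover have "\<forall>\<^sub>F \<omega> in at_infinity. (poly A \<omega> / \<omega> ^ CARD('r)) / (poly D \<omega> / \<omega> ^ CARD('r)) = f \<omega>"
      using evD ev0 by eventually_elim (simp add: f_eq)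
    ultimately have lim: "(f \<longlongrightarrow> z0) at_infinity" by (rule Lim_transform_eventually)
    have z0: "z0 \<in> curve_image \<gamma>"
    proof (rule ccontr)
      assume "z0 \<notin> curve_image \<gamma>"
      then have "\<forall>\<^sub>F \<omega> in at_infinity. f \<omega> \<in> - curve_image \<gamma>"
        using closed_curve_image[OF curves] by (intro topological_tendstoD[OF lim]) auto
      then show False using freq by (simp add: frequently_def)
    qed
    have "((\<lambda>\<omega>. Wsize (f \<omega>)) \<longlongrightarrow> Wsize z0) at_infinity"
      unfolding Wsize_def
      by (intro tendsto_sum tendsto_norm isCont_tendsto_compose[OF rational_isCont[OF rat] lim]) (use no_pole z0 in blast)
    then have bd: "\<forall>\<^sub>F \<omega> in at_infinity. Wsize (f \<omega>) < Wsize z0 + 1" by (rule order_tendstoD(2)) simp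
    obtain m where m: "m > 0" "\<forall>\<^sub>F \<omega> in at_infinity. m * norm \<omega> ^ CARD('r) \<le> norm (poly D \<omega>)"
      using True by (rule_tac poly_growth_lower[OF D0]) simp
    show thesis
    proof (rule that[of "(Wsize z0 + 1) / m ^ (2 * N)"])
      show "(Wsize z0 + 1) / m ^ (2 * N) \<ge> 0" using m(1) Wnn[of z0] by simp
      show "\<forall>\<^sub>F \<omega> in at_infinity. Wsize (f \<omega>) \<le> (Wsize z0 + 1) / m ^ (2 * N) * norm (poly D \<omega>) ^ (2 * N) / norm \<omega> ^ (2 * n)"
        using bd m(2) ev0
      proof eventually_elim
        case (elim \<omega>)
        have "(m * norm \<omega> ^ CARD('r)) ^ (2 * N) \<le> norm (poly D \<omega>) ^ (2 * N)"
          using elim(2) m(1) by (intro power_mono) auto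
        then have "m ^ (2 * N) * norm \<omega> ^ (2 * n) \<le> norm (poly D \<omega>) ^ (2 * N)"
          by (simp only: power_mult_distrib n2)
        then have "1 \<le> norm (poly D \<omega>) ^ (2 * N) / (m ^ (2 * N) * norm \<omega> ^ (2 * n))"
          using m(1) elim(3) by (simp add: le_divide_eq)
        then have "(Wsize z0 + 1) * 1 \<le> (Wsize z0 + 1) * (norm (poly D \<omega>) ^ (2 * N) / (m ^ (2 * N) * norm \<omega> ^ (2 * n)))"
          using Wnn[of z0] by (intro mult_left_mono) auto
        then show ?case using elim(1) by simp
      qed
    qed
  next
    case False
    then have dA: "degree A = CARD('r)" and dD: "degree D < CARD('r)" using degAD degD by auto
    have A0: "A \<noteq> 0" using dA by auto
    have evA: "\<forall>\<^sub>F \<omega> in at_infinity. poly A \<omega> \<noteq> 0"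
      using eventually_at_infinity_notin_finite[OF poly_roots_finite[OF A0]] by simp
    have "((\<lambda>\<omega>. poly D \<omega> / poly A \<omega>) \<longlongrightarrow> 0) at_infinity"
      using dA dD by (intro poly_divide_tendsto_0_at_infinity) simp
    then have "filterlim (\<lambda>\<omega>. poly D \<omega> / poly A \<omega>) (at 0) at_infinity"
      unfolding filterlim_at using eventually_conj[OF evA evD] by (auto elim: eventually_mono)
    then have "filterlim (\<lambda>\<omega>. inverse (poly D \<omega> / poly A \<omega>)) at_infinity at_infinity"
      by (rule filterlim_compose[OF filterlim_inverse_at_infinity])
    moreover have evf: "\<forall>\<^sub>F \<omega> in at_infinity. inverse (poly D \<omega> / poly A \<omega>) = f \<omega>"
      using evD by eventually_elim (simp add: f_eq)
    ultimately have finf: "filterlim f at_infinity at_infinity"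
      by (rule filterlim_mono_eventually[OF _ order_refl order_refl])
    have "\<not> bounded (curve_image \<gamma>)"
    proof
      assume "bounded (curve_image \<gamma>)"
      then obtain B where B: "\<And>z. z \<in> curve_image \<gamma> \<Longrightarrow> norm z \<le> B" by (auto simp: bounded_iff)
      have "\<forall>\<^sub>F z :: complex in at_infinity. B + 1 \<le> norm z" unfolding eventually_at_infinity by blast
      then have "\<forall>\<^sub>F \<omega> in at_infinity. B + 1 \<le> norm (f \<omega>)" using finf by (rule eventually_compose_filterlim)
      then have "\<forall>\<^sub>F \<omega> in at_infinity. f \<omega> \<notin> curve_image \<gamma>" by eventually_elim (use B in force)
      then show False using freq by (simp add: frequently_def)
    qed
    then have dec: "(\<lambda>z. W z $ i $ j) \<in> O[at_infinity](\<lambda>z. 1 / z ^ (2 * N))" for i j using decay by blast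
    define B where "B i j a \<longleftrightarrow> a > 0 \<and> (\<forall>\<^sub>F z in at_infinity. norm (W z $ i $ j) \<le> a * norm (1 / z ^ (2 * N)))"
      for i j and a :: real
    define c where "c i j = (SOME a. B i j a)" for i j
    have "\<exists>a. B i j a" for i j
      unfolding B_def by (rule landau_o.bigE[OF dec[of i j]]) blast
    then have Bc: "B i j (c i j)" for i j unfolding c_def by (rule someI_ex)
    have c: "c i j > 0" "\<forall>\<^sub>F z in at_infinity. norm (W z $ i $ j) \<le> c i j * norm (1 / z ^ (2 * N))" for i j
      using Bc[of i j] unfolding B_def by (rule conjunct1, rule conjunct2)
    define b where "b = (\<Sum>i\<in>UNIV. \<Sum>j\<in>UNIV. c i j)"
    have b: "b \<ge> 0" unfolding b_def using c(1) by (intro sum_nonneg) (auto simp: less_imp_le)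
    have "\<forall>\<^sub>F z in at_infinity. \<forall>i\<in>UNIV. \<forall>j\<in>UNIV. norm (W z $ i $ j) \<le> c i j * norm (1 / z ^ (2 * N))"
      by (intro eventually_ball_finite ballI c(2)) auto
    then have "\<forall>\<^sub>F z in at_infinity. Wsize z \<le> b * norm (1 / z ^ (2 * N))"
    proof eventually_elim
      case (elim z)
      then show ?case unfolding Wsize_def b_def sum_distrib_right by (intro sum_mono) auto
    qed
    then have bd: "\<forall>\<^sub>F \<omega> in at_infinity. Wsize (f \<omega>) \<le> b * norm (1 / f \<omega> ^ (2 * N))"
      using finf by (rule eventually_compose_filterlim)
    obtain m where m: "m > 0" "\<forall>\<^sub>F \<omega> in at_infinity. m * norm \<omega> ^ CARD('r) \<le> norm (poly A \<omega>)"
      using dA by (rule_tac poly_growth_lower[OF A0]) simp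
    show thesis
    proof (rule that[of "b / m ^ (2 * N)"])
      show "b / m ^ (2 * N) \<ge> 0" using m(1) b by simp
      show "\<forall>\<^sub>F \<omega> in at_infinity. Wsize (f \<omega>) \<le> b / m ^ (2 * N) * norm (poly D \<omega>) ^ (2 * N) / norm \<omega> ^ (2 * n)"
        using bd m(2) evD evA ev0
      proof eventually_elim
        case (elim \<omega>)
        have "(m * norm \<omega> ^ CARD('r)) ^ (2 * N) \<le> norm (poly A \<omega>) ^ (2 * N)"
          using elim(2) m(1) by (intro power_mono) auto
        then have le: "m ^ (2 * N) * norm \<omega> ^ (2 * n) \<le> norm (poly A \<omega>) ^ (2 * N)"
          by (simp only: power_mult_distrib n2)
        have "norm (1 / f \<omega> ^ (2 * N)) = norm (poly D \<omega>) ^ (2 * N) / norm (poly A \<omega>) ^ (2 * N)"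
          using elim(3,4) by (simp add: f_eq norm_divide norm_power power_divide)
        also have "\<dots> \<le> norm (poly D \<omega>) ^ (2 * N) / (m ^ (2 * N) * norm \<omega> ^ (2 * n))"
          using le m(1) elim(4,5) by (intro divide_left_mono mult_pos_pos) auto
        finally have "b * norm (1 / f \<omega> ^ (2 * N)) \<le> b * (norm (poly D \<omega>) ^ (2 * N) / (m ^ (2 * N) * norm \<omega> ^ (2 * n)))"
          using b by (rule mult_left_mono)
        then show ?case using elim(1) by simp
      qed
    qed
  qed
qed

text \<open>The eigenvalue is bounded by the entries of \<open>W\<close>, and the denominator \<open>D^(2N)\<close> of the weight cancels the one in the growth
  estimate.\<close>

lemma weight_decay:
  assumes "\<forall>C\<in>set \<gamma>. piecewise_smooth_curve C" "rational_matrix W"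
    "\<forall>z\<in>curve_image \<gamma>. \<forall>i j. \<not> is_pole (\<lambda>z. W z $ i $ j) z"
    "\<not> bounded (curve_image \<gamma>) \<Longrightarrow> \<forall>i j. (\<lambda>z. W z $ i $ j) \<in> O[at_infinity](\<lambda>z. 1 / z ^ (2 * N))"
    "\<not> bounded (lifted_curve M \<phi> \<gamma>)"
  shows "w \<in> O[at_infinity](\<lambda>z. 1 / z ^ (2 * n))"
proof -
  obtain k where k: "\<And>\<omega>. poly D \<omega> \<noteq> 0 \<Longrightarrow> generic (f \<omega>) \<Longrightarrow> w \<omega> = k * lamv \<omega> / poly D \<omega> ^ (2 * N)"
    by (rule weight_eq) blast
  obtain b where b: "b \<ge> 0" "\<forall>\<^sub>F \<omega> in at_infinity. Wsize (f \<omega>) \<le> b * norm (poly D \<omega>) ^ (2 * N) / norm \<omega> ^ (2 * n)"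
    by (rule Wsize_growth[OF assms])
  have generic: "\<forall>\<^sub>F \<omega> in at_infinity. poly D \<omega> \<noteq> 0 \<and> generic (f \<omega>)"
    using eventually_at_infinity_notin_finite[OF finite_not_generic_points] by simp
  show ?thesis
  proof (rule bigoI)
    show "\<forall>\<^sub>F \<omega> in at_infinity. norm (w \<omega>) \<le> (norm k * b) * norm (1 / \<omega> ^ (2 * n))"
      using b(2) generic
    proof eventually_elim
      case (elim \<omega>)
      then have D: "poly D \<omega> \<noteq> 0" and g: "generic (f \<omega>)" by auto
      obtain j where j: "\<omega> = branch (f \<omega>) j" by (rule generic_point_branch[OF D g])
      have "norm (lamv \<omega>) \<le> Wsize (f \<omega>)" using eigenvalue_bound[OF g, of j] j by simp
      then have l: "norm (lamv \<omega>) \<le> b * norm (poly D \<omega>) ^ (2 * N) / norm \<omega> ^ (2 * n)" using elim(1) by simp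
      have "norm (w \<omega>) = norm k * norm (lamv \<omega>) / norm (poly D \<omega>) ^ (2 * N)"
        using k[OF D g] by (simp add: norm_mult norm_divide norm_power)
      also have "\<dots> \<le> norm k * (b * norm (poly D \<omega>) ^ (2 * N) / norm \<omega> ^ (2 * n)) / norm (poly D \<omega>) ^ (2 * N)"
        by (intro divide_right_mono mult_left_mono l) auto
      also have "\<dots> = (norm k * b) * norm (1 / \<omega> ^ (2 * n))"
        using D by (simp add: norm_divide norm_power)
      finally show ?case .
    qed
  qed
qed

end

section \<open>Identification of the kernels\<close>

lemma continuous_eq_off_finite:
  fixes F G :: "complex \<Rightarrow> complex"
  assumes "continuous_on UNIV F" "continuous_on UNIV G" "finite S" "\<And>x. x \<notin> S \<Longrightarrow> F x = G x"
  shows "F x = G x"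
proof -
  have "closed {x. F x = G x}" using assms(1,2) by (rule closed_Collect_eq)
  moreover have "- S \<subseteq> {x. F x = G x}" using assms(4) by blast
  ultimately have "closure (- S) \<subseteq> {x. F x = G x}" by (simp add: closure_minimal)
  moreover have "closure (- S) = UNIV"
    using assms(3) by (simp add: closure_complement empty_interior_finite)
  ultimately show ?thesis by blast
qed

text \<open>An open box disjoint from \<open>D\<close> would contain an infinite section over some \<open>\<omega>\<close> outside \<open>S\<close>.\<close>

lemma dense_if_cofinite_sections:
  fixes D :: "(complex \<times> complex) set"
  assumes "finite S" "\<And>\<omega>. \<omega> \<notin> S \<Longrightarrow> finite {\<zeta>. (\<omega>, \<zeta>) \<notin> D}"
  shows "closure D = UNIV"
proof -
  have "interior (- D) = {}"
  proof (rule ccontr)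
    assume "interior (- D) \<noteq> {}"
    then obtain p where "p \<in> interior (- D)" by blast
    then obtain U V where UV: "open U" "open V" "p \<in> U \<times> V" "U \<times> V \<subseteq> interior (- D)"
      by (rule open_prod_elim[OF open_interior]) blast
    then have "U \<noteq> {}" "V \<noteq> {}" by auto
    then have inf: "infinite U" "infinite V" using UV(1,2) finite_imp_not_open by blast+
    then obtain \<omega> where \<omega>: "\<omega> \<in> U" "\<omega> \<notin> S" using assms(1) by (meson finite_subset subsetI)
    have "V \<subseteq> {\<zeta>. (\<omega>, \<zeta>) \<notin> D}" using UV(4) \<omega>(1) interior_subset[of "- D"] by blast
    then show False using inf(2) assms(2)[OF \<omega>(2)] finite_subset by blast
  qed
  then have "- closure D = {}" by (simp only: interior_complement)
  then show ?thesis by blast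
qed

lemma continuous_mat_poly:
  assumes "P \<in> mat_polys m \<or> P \<in> monic_mat_polys m"
  shows "continuous_on UNIV (\<lambda>z. P z $ i $ j)"
proof -
  obtain C where "P = (\<lambda>z. \<Sum>l\<le>m. smult_mat (z ^ l) (C l))"
    using assms unfolding mat_polys_def monic_mat_polys_def by blast
  then show ?thesis by (simp, intro continuous_intros)
qed

lemma continuous_kernel_fun: "continuous_on UNIV (\<lambda>(\<omega>, \<zeta>). kernel_fun n C \<omega> \<zeta>)"
  unfolding kernel_fun_def split_def by (intro continuous_intros)

context eigen_space
begin

lemma degree_colpoly: "degree (colpoly c) < n"
  unfolding colpoly_def
  by (intro degree_sum_less_nat n_pos le_less_trans[OF degree_smult_le] degree_row_col_gen) simp

lemma regular_point_cofinite:
  "finite {\<zeta>. \<not> regular_point M \<phi> e \<zeta>}" "finite {\<omega>. \<not> regular_point M \<phi> eh \<omega>}"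
proof -
  have "{\<zeta>. \<not> regular_point M \<phi> e \<zeta>} = {\<zeta>. poly (D * g * q) \<zeta> = 0}"
    using Dz e_sing by (auto simp: regular_point_def)
  moreover have "{\<omega>. \<not> regular_point M \<phi> eh \<omega>} = {\<omega>. poly (D * gh * qh) \<omega> = 0}"
    using Dz eh_sing by (auto simp: regular_point_def)
  ultimately show "finite {\<zeta>. \<not> regular_point M \<phi> e \<zeta>}" "finite {\<omega>. \<not> regular_point M \<phi> eh \<omega>}"
    using D0 g0 q0 gh0 qh0 poly_roots_finite[of "D * g * q"] poly_roots_finite[of "D * gh * qh"] by simp_all
qed

text \<open>For fixed \<open>\<omega>\<close>, the points with \<open>f \<zeta> = f \<omega>\<close> are roots of a nonzero polynomial.\<close>

lemma regular_pairs_dense: "closure {(\<omega>, \<zeta>). regular_point M \<phi> eh \<omega> \<and> regular_point M \<phi> e \<zeta> \<and> f \<omega> \<noteq> f \<zeta>} = UNIV"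
proof (rule dense_if_cofinite_sections[OF regular_point_cofinite(2)])
  fix \<omega> assume \<omega>: "\<omega> \<notin> {\<omega>. \<not> regular_point M \<phi> eh \<omega>}"
  have "{\<zeta>. (\<omega>, \<zeta>) \<notin> {(\<omega>, \<zeta>). regular_point M \<phi> eh \<omega> \<and> regular_point M \<phi> e \<zeta> \<and> f \<omega> \<noteq> f \<zeta>}}
    \<subseteq> {\<zeta>. \<not> regular_point M \<phi> e \<zeta>} \<union> {\<zeta>. poly (A - smult (f \<omega>) D) \<zeta> = 0}"
  proof (intro subsetI, rule ccontr)
    fix \<zeta> assume out: "\<zeta> \<in> {\<zeta>. (\<omega>, \<zeta>) \<notin> {(\<omega>, \<zeta>). regular_point M \<phi> eh \<omega> \<and> regular_point M \<phi> e \<zeta> \<and> f \<omega> \<noteq> f \<zeta>}}"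
      "\<zeta> \<notin> {\<zeta>. \<not> regular_point M \<phi> e \<zeta>} \<union> {\<zeta>. poly (A - smult (f \<omega>) D) \<zeta> = 0}"
    then have reg: "regular_point M \<phi> e \<zeta>" and ne: "poly A \<zeta> \<noteq> f \<omega> * poly D \<zeta>" by simp_all
    have eq: "f \<omega> = f \<zeta>" using out(1) reg \<omega> by simp
    have "poly D \<zeta> \<noteq> 0" using reg Dz[of \<zeta>] by (simp add: regular_point_def)
    then show False using ne eq f_eq[of \<zeta>] by simp
  qed
  then show "finite {\<zeta>. (\<omega>, \<zeta>) \<notin> {(\<omega>, \<zeta>). regular_point M \<phi> eh \<omega> \<and> regular_point M \<phi> e \<zeta> \<and> f \<omega> \<noteq> f \<zeta>}}"
    by (rule finite_subset) (intro finite_UnI regular_point_cofinite poly_roots_finite A_minus_smult_D)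
qed

lemma off_diagonal_dense: "closure {(\<omega>, \<zeta>). \<omega> \<noteq> (\<zeta> :: complex)} = UNIV"
  by (rule dense_if_cofinite_sections[of "{}"]) simp_all

text \<open>Pull the given matrix kernel back, recognize it as the scalar kernel, and carry its two-sided reproducing property back to
  the matrices. The three expressions then agree with the pulled back kernel where they are meaningful.\<close>

lemma kernel_identities:
  fixes R :: "complex \<Rightarrow> complex \<Rightarrow> complex^'r^'r"
  assumes curves: "\<forall>C\<in>set \<gamma>. piecewise_smooth_curve C"
    and rat: "rational_matrix W"
    and no_pole: "\<forall>z\<in>curve_image \<gamma>. \<forall>i j. \<not> is_pole (\<lambda>z. W z $ i $ j) z"
    and kernel: "CD_kernel (has_curve_integral \<gamma>) (curve_image \<gamma>) W N R"
    and PL: "is_PL (has_curve_integral \<gamma>) W N PL" and PR: "is_PR (has_curve_integral \<gamma>) W N PR"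
    and QL: "is_QL (has_curve_integral \<gamma>) W N QL" and QR: "is_QR (has_curve_integral \<gamma>) W N QR"
    and convergence: "\<forall>p k. degree p \<le> n \<longrightarrow> k < n \<longrightarrow> (\<exists>v. has_lifted_integral M \<phi> \<gamma> (\<lambda>\<zeta>. poly p \<zeta> * w \<zeta> * \<zeta> ^ k) v)"
  defines "JC \<equiv> has_lifted_integral M \<phi> \<gamma>"
  shows "(\<exists>!p. is_scalar_p JC w n p) \<and>
         (\<exists>!q. is_scalar_q JC w n q) \<and>
         (\<exists>!K. scalar_CD_kernel JC (lifted_curve M \<phi> \<gamma>) w n K) \<and>
         (\<forall>p q K. is_scalar_p JC w n p \<longrightarrow> is_scalar_q JC w n q \<longrightarrow>
           scalar_CD_kernel JC (lifted_curve M \<phi> \<gamma>) w n K \<longrightarrow>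
           fills_in {(\<omega>, \<zeta>). regular_point M \<phi> eh \<omega> \<and> regular_point M \<phi> e \<zeta>}
             (\<lambda>\<omega> \<zeta>. hh \<omega> * row_mat_col (ehv \<omega>) (R (f \<omega>) (f \<zeta>)) (ev \<zeta>) * h \<zeta>) K \<and>
           fills_in {(\<omega>, \<zeta>). regular_point M \<phi> eh \<omega> \<and> regular_point M \<phi> e \<zeta> \<and> f \<omega> \<noteq> f \<zeta>}
             (\<lambda>\<omega> \<zeta>. hh \<omega> *
                row_mat_col (ehv \<omega>)
                  (smult_mat (1 / (f \<zeta> - f \<omega>)) (QR (f \<omega>) ** PL (f \<zeta>) - PR (f \<omega>) ** QL (f \<zeta>)))
                  (ev \<zeta>) * h \<zeta>) K \<and>
           fills_in {(\<omega>, \<zeta>). \<omega> \<noteq> \<zeta>}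
             (\<lambda>\<omega> \<zeta>. 1 / (\<zeta> - \<omega>) * (poly q \<omega> * poly p \<zeta> - poly p \<omega> * poly q \<zeta>)) K)"
proof -
  interpret J: linear_integral "has_curve_integral \<gamma>" by (rule linear_curve_integral)
  interpret MF: moment_functional JC w n
    unfolding JC_def using convergence
    by (intro moment_functional.intro linear_lifted_integral moment_functional_axioms.intro n_pos) blast
  have set: "{..N - 1} = {..<N}" using N by auto
  have "R \<in> bivariate_mat_polys (N - 1)" using kernel unfolding CD_kernel_def by (rule conjunct1)
  then obtain C where "R = (\<lambda>w z. \<Sum>k<N. \<Sum>l<N. smult_mat (w ^ k * z ^ l) (C k l))"
    unfolding bivariate_mat_polys_def set by blast
  then have R: "R = matrix_kernel C" by (simp add: matrix_kernel_def fun_eq_iff)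
  obtain c0 where K: "pullback_kernel C = kernel_fun n c0" using pullback_kernel_kernel_fun by blast
  consider (left) "\<forall>P\<in>mat_polys (N - 1). \<forall>z. mat_integral (has_curve_integral \<gamma>) (\<lambda>w. P w ** W w ** R w z) (P z)"
    | (right) "\<forall>P\<in>mat_polys (N - 1). \<forall>w. mat_integral (has_curve_integral \<gamma>) (\<lambda>z. R w z ** W z ** P z) (P w)"
    using kernel unfolding CD_kernel_def by (elim conjE disjE)
  \<comment> \<open>Whichever side is given, it holds in the other argument off the zeros of \<open>D\<close>, which suffices for polynomials.\<close>
  then have inverts: "MF.inverts_moments c0"
  proof cases
    case left
    show ?thesis
    proof (rule MF.left_reproducing_imp_inverts[OF poly_roots_finite[OF D0]])
      fix m \<zeta> assume m: "m < n" and \<zeta>: "\<zeta> \<notin> {x. poly D x = 0}"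
      then have D: "poly D \<zeta> \<noteq> 0" by simp
      have "degree (monom (1 :: complex) m) < n" using m by (simp add: degree_monom_eq)
      then obtain c where c: "monom 1 m = rowpoly c" using ex_rowpoly by blast
      have "JC (\<lambda>\<omega>. poly (rowpoly c) \<omega> * w \<omega> * pullback_kernel C \<omega> \<zeta>) (poly (rowpoly c) \<zeta>)"
        unfolding JC_def by (rule left_transfer[OF curves D]) (use left in \<open>simp add: R\<close>)
      then show "JC (\<lambda>\<omega>. \<omega> ^ m * w \<omega> * kernel_fun n c0 \<omega> \<zeta>) (\<zeta> ^ m)"
        by (simp add: c[symmetric] poly_monom K)
    qed
  next
    case right
    show ?thesis
    proof (rule MF.right_reproducing_imp_inverts[OF poly_roots_finite[OF D0]])
      fix m \<omega> assume m: "m < n" and \<omega>: "\<omega> \<notin> {x. poly D x = 0}"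
      then have D: "poly D \<omega> \<noteq> 0" by simp
      have "degree (monom (1 :: complex) m) < n" using m by (simp add: degree_monom_eq)
      then obtain c where c: "monom 1 m = colpoly c" using ex_colpoly by blast
      have "JC (\<lambda>\<zeta>. pullback_kernel C \<omega> \<zeta> * w \<zeta> * poly (colpoly c) \<zeta>) (poly (colpoly c) \<omega>)"
        unfolding JC_def by (rule right_transfer[OF curves D]) (use right in \<open>simp add: R\<close>)
      then show "JC (\<lambda>\<zeta>. kernel_fun n c0 \<omega> \<zeta> * w \<zeta> * \<zeta> ^ m) (\<omega> ^ m)"
        by (simp add: c[symmetric] poly_monom K)
    qed
  qed
  interpret MK: moment_kernel JC w n c0 by unfold_locales (rule inverts)
  have growth: "w \<in> O[at_infinity](\<lambda>z. 1 / z ^ (2 * n))" if "\<not> bounded (lifted_curve M \<phi> \<gamma>)"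
  proof (rule weight_decay[OF curves rat no_pole _ that])
    show "\<not> bounded (curve_image \<gamma>) \<Longrightarrow> \<forall>i j. (\<lambda>z. W z $ i $ j) \<in> O[at_infinity](\<lambda>z. 1 / z ^ (2 * N))"
      using kernel unfolding CD_kernel_def by blast
  qed
  have scalar_kernel: "scalar_CD_kernel JC (lifted_curve M \<phi> \<gamma>) w n K' \<longleftrightarrow> K' = pullback_kernel C" for K'
    unfolding K by (rule MK.scalar_CD_kernel_iff[OF growth])

  have left_rep: "has_lifted_integral M \<phi> \<gamma> (\<lambda>\<omega>. poly (rowpoly c) \<omega> * w \<omega> * pullback_kernel C \<omega> \<zeta>) (poly (rowpoly c) \<zeta>)" for c \<zeta>
  proof -
    have "degree (rowpoly c) + degree (MK.Kp \<zeta>) < 2 * n"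
      using degree_rowpoly[of c] degree_kernel_poly[OF n_pos, of c0 \<zeta>] by linarith
    from MF.L_product_iff[OF this] MK.reproducing[OF degree_rowpoly, of c \<zeta>]
    show ?thesis unfolding JC_def by (simp add: poly_kernel_poly K)
  qed
  have right_rep: "has_lifted_integral M \<phi> \<gamma> (\<lambda>\<zeta>. pullback_kernel C \<omega> \<zeta> * w \<zeta> * poly (colpoly c) \<zeta>) (poly (colpoly c) \<omega>)" for c \<omega>
  proof -
    have "degree (MK.Kp \<omega>) + degree (colpoly c) < 2 * n"
      using degree_colpoly[of c] degree_kernel_poly[OF n_pos, of c0 \<omega>] by linarith
    from MF.L_product_iff[OF this, of "poly (colpoly c) \<omega>"] MK.reproducing[OF degree_colpoly, of c \<omega>]
    have "JC (\<lambda>\<zeta>. poly (MK.Kp \<omega>) \<zeta> * w \<zeta> * poly (colpoly c) \<zeta>) (poly (colpoly c) \<omega>)"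
      by (simp add: mult.commute)
    moreover have "poly (MK.Kp \<omega>) \<zeta> = pullback_kernel C \<omega> \<zeta>" for \<zeta>
      unfolding poly_kernel_poly K by (rule MK.K_symmetric)
    ultimately show ?thesis unfolding JC_def by simp
  qed
  have cd_generic: "smult_mat (z - s) (matrix_kernel C s z) = QR s ** PL z - PR s ** QL z" if "generic s" "generic z" for s z
    by (rule J.matrix_christoffel_darboux[OF N matrix_kernel_def
          left_transfer_back[OF curves that(2) left_rep] right_transfer_back[OF curves that(1) right_rep] PL PR QL QR])
  have cont: "continuous_on UNIV (\<lambda>z. PL z $ i $ j)" "continuous_on UNIV (\<lambda>z. PR z $ i $ j)"
    "continuous_on UNIV (\<lambda>z. QL z $ i $ j)" "continuous_on UNIV (\<lambda>z. QR z $ i $ j)" for i j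
    using PL PR QL QR unfolding is_PL_def is_PR_def is_QL_def is_QR_def by (blast intro: continuous_mat_poly)+
  \<comment> \<open>Both sides are polynomials in \<open>s\<close> and in \<open>z\<close>, so the restriction to generic points can be dropped.\<close>
  have cd: "(z - s) * matrix_kernel C s z $ i $ j = (\<Sum>k\<in>UNIV. QR s $ i $ k * PL z $ k $ j) - (\<Sum>k\<in>UNIV. PR s $ i $ k * QL z $ k $ j)"
    for s z i j
  proof (rule continuous_eq_off_finite[OF _ _ finite_not_generic, of "\<lambda>s. (z - s) * matrix_kernel C s z $ i $ j"])
    show "continuous_on UNIV (\<lambda>s. (z - s) * matrix_kernel C s z $ i $ j)"
      unfolding matrix_kernel_component by (intro continuous_intros)
    show "continuous_on UNIV (\<lambda>s. (\<Sum>k\<in>UNIV. QR s $ i $ k * PL z $ k $ j) - (\<Sum>k\<in>UNIV. PR s $ i $ k * QL z $ k $ j))"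
      by (intro continuous_intros cont)
    fix s assume "s \<notin> {z. \<not> generic z}"
    then have s: "generic s" by simp
    show "(z - s) * matrix_kernel C s z $ i $ j = (\<Sum>k\<in>UNIV. QR s $ i $ k * PL z $ k $ j) - (\<Sum>k\<in>UNIV. PR s $ i $ k * QL z $ k $ j)"
    proof (rule continuous_eq_off_finite[OF _ _ finite_not_generic, of "\<lambda>z. (z - s) * matrix_kernel C s z $ i $ j"])
      show "continuous_on UNIV (\<lambda>z. (z - s) * matrix_kernel C s z $ i $ j)"
        unfolding matrix_kernel_component by (intro continuous_intros)
      show "continuous_on UNIV (\<lambda>z. (\<Sum>k\<in>UNIV. QR s $ i $ k * PL z $ k $ j) - (\<Sum>k\<in>UNIV. PR s $ i $ k * QL z $ k $ j))"
        by (intro continuous_intros cont)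
      fix z assume "z \<notin> {z. \<not> generic z}"
      then have "generic z" by simp
      from arg_cong[OF cd_generic[OF s this], of "\<lambda>A. A $ i $ j"]
      show "(z - s) * matrix_kernel C s z $ i $ j = (\<Sum>k\<in>UNIV. QR s $ i $ k * PL z $ k $ j) - (\<Sum>k\<in>UNIV. PR s $ i $ k * QL z $ k $ j)"
        by (simp add: matrix_matrix_mult_def)
    qed
  qed
  have quotient: "smult_mat (1 / (z - s)) (QR s ** PL z - PR s ** QL z) = matrix_kernel C s z" if "s \<noteq> z" for s z
    using that cd[of z s] by (simp add: vec_eq_iff matrix_matrix_mult_def flip: cd)

  have cont_K: "continuous_on UNIV (\<lambda>(\<omega>, \<zeta>). pullback_kernel C \<omega> \<zeta>)" unfolding K by (rule continuous_kernel_fun)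
  have fill1: "fills_in {(\<omega>, \<zeta>). regular_point M \<phi> eh \<omega> \<and> regular_point M \<phi> e \<zeta>}
             (\<lambda>\<omega> \<zeta>. hh \<omega> * row_mat_col (ehv \<omega>) (R (f \<omega>) (f \<zeta>)) (ev \<zeta>) * h \<zeta>) (pullback_kernel C)"
    unfolding fills_in_def R
  proof (intro conjI cont_K)
    have "closure {(\<omega>, \<zeta>). regular_point M \<phi> eh \<omega> \<and> regular_point M \<phi> e \<zeta> \<and> f \<omega> \<noteq> f \<zeta>}
        \<subseteq> closure {(\<omega>, \<zeta>). regular_point M \<phi> eh \<omega> \<and> regular_point M \<phi> e \<zeta>}"
      by (rule closure_mono) auto
    then show "closure {(\<omega>, \<zeta>). regular_point M \<phi> eh \<omega> \<and> regular_point M \<phi> e \<zeta>} = UNIV"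
      unfolding regular_pairs_dense by blast
    show "\<forall>(\<omega>, \<zeta>)\<in>{(\<omega>, \<zeta>). regular_point M \<phi> eh \<omega> \<and> regular_point M \<phi> e \<zeta>}.
        hh \<omega> * row_mat_col (ehv \<omega>) (matrix_kernel C (f \<omega>) (f \<zeta>)) (ev \<zeta>) * h \<zeta> = pullback_kernel C \<omega> \<zeta>"
      using kernel_value by blast
  qed
  have fill2: "fills_in {(\<omega>, \<zeta>). regular_point M \<phi> eh \<omega> \<and> regular_point M \<phi> e \<zeta> \<and> f \<omega> \<noteq> f \<zeta>}
             (\<lambda>\<omega> \<zeta>. hh \<omega> *
                row_mat_col (ehv \<omega>)
                  (smult_mat (1 / (f \<zeta> - f \<omega>)) (QR (f \<omega>) ** PL (f \<zeta>) - PR (f \<omega>) ** QL (f \<zeta>)))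
                  (ev \<zeta>) * h \<zeta>) (pullback_kernel C)"
    unfolding fills_in_def
  proof (intro conjI cont_K regular_pairs_dense ballI, clarify)
    fix \<omega> \<zeta> assume "regular_point M \<phi> eh \<omega>" "regular_point M \<phi> e \<zeta>" and ne: "f \<omega> \<noteq> f \<zeta>"
    then show "hh \<omega> * row_mat_col (ehv \<omega>)
                  (smult_mat (1 / (f \<zeta> - f \<omega>)) (QR (f \<omega>) ** PL (f \<zeta>) - PR (f \<omega>) ** QL (f \<zeta>)))
                  (ev \<zeta>) * h \<zeta> = pullback_kernel C \<omega> \<zeta>"
      unfolding quotient[OF ne] by (intro kernel_value)
  qed
  have fill3: "fills_in {(\<omega>, \<zeta>). \<omega> \<noteq> \<zeta>}
             (\<lambda>\<omega> \<zeta>. 1 / (\<zeta> - \<omega>) * (poly p \<omega> * poly q \<zeta> - poly q \<omega> * poly p \<zeta>)) (pullback_kernel C)"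
    if "is_scalar_p JC w n q" "is_scalar_q JC w n p" for p q
    unfolding fills_in_def
  proof (intro conjI cont_K off_diagonal_dense ballI, clarify)
    fix \<omega> \<zeta> :: complex assume "\<omega> \<noteq> \<zeta>"
    then show "1 / (\<zeta> - \<omega>) * (poly p \<omega> * poly q \<zeta> - poly q \<omega> * poly p \<zeta>) = pullback_kernel C \<omega> \<zeta>"
      unfolding K MK.christoffel_darboux[OF that, symmetric] by simp
  qed
  show ?thesis
  proof (intro conjI allI impI)
    show "\<exists>!p. is_scalar_p JC w n p" by (rule MK.ex1_scalar_p)
    show "\<exists>!q. is_scalar_q JC w n q" by (rule MK.ex1_scalar_q)
    show "\<exists>!K. scalar_CD_kernel JC (lifted_curve M \<phi> \<gamma>) w n K" unfolding scalar_kernel by simp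
  qed (simp_all only: scalar_kernel fill1 fill2 fill3)
qed

end

theorem theorem1p19:
  fixes N :: nat
    and \<gamma> :: "curve list"
    and W E :: "complex \<Rightarrow> complex^'r::finite^'r"
    and \<Lambda> :: "complex \<Rightarrow> complex^'r"
    and R :: "complex \<Rightarrow> complex \<Rightarrow> complex^'r^'r"
    and M :: "('m, 'r) covering"
    and lam :: "'m \<Rightarrow> complex"
    and e eh :: "'m \<Rightarrow> complex^'r"
    and \<phi> :: "complex option \<Rightarrow> 'm"
    and PL PR QL QR :: "complex \<Rightarrow> complex^'r^'r"
    and J JC :: integral_pred
    and n :: nat
    and h hh f w :: "complex \<Rightarrow> complex"
    and ev ehv :: "complex \<Rightarrow> complex^'r"
  defines "J \<equiv> has_curve_integral \<gamma>"
    and "JC \<equiv> has_lifted_integral M \<phi> \<gamma>"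
    and "n \<equiv> CARD('r) * N"
    and "h \<equiv> h_fun M \<phi> N e"
    and "hh \<equiv> h_fun M \<phi> N eh"
    and "f \<equiv> phi_proj M \<phi>"
    and "w \<equiv> scalar_weight M \<phi> N lam e eh"
    and "ev \<equiv> (\<lambda>\<zeta>. e (\<phi> (Some \<zeta>)))"
    and "ehv \<equiv> (\<lambda>\<omega>. eh (\<phi> (Some \<omega>)))"
  assumes N: "N > 0"
    and curves: "\<forall>C\<in>set \<gamma>. piecewise_smooth_curve C"
    and W_rational: "rational_matrix W"
    and W_no_pole: "\<forall>z\<in>curve_image \<gamma>. \<forall>i j. \<not> is_pole (\<lambda>z. W z $ i $ j) z"
    and diagonalization:
      "finite {z. \<not> (invertible (E z) \<and> W z = E z ** diag_mat (\<Lambda> z) ** matrix_inv (E z))}"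
    and kernel: "CD_kernel J (curve_image \<gamma>) W N R"
    and M: "riemann_surface M" "compact_space (space M)" "branched_covering M"
    and M_genus_0: "connected_space (space M)" "has_genus M 0"
    and meromorphic: "meromorphic_fun M lam" "meromorphic_vec M e" "meromorphic_vec M eh"
    and on_sheets:
      "finite {z. \<exists>k. \<not> (lam (sheet M k (Some z)) = \<Lambda> z $ k \<and>
                         e (sheet M k (Some z)) = column k (E z) \<and>
                         eh (sheet M k (Some z)) = row k (matrix_inv (E z)))}"
    and \<phi>: "conformal_bijection riemann_sphere M \<phi>"
    and orthogonal: "is_PL J W N PL" "is_PR J W N PR" "is_QL J W N QL" "is_QR J W N QR"
    and scalar_convergence:
      "\<forall>p k. degree p \<le> n \<longrightarrow> k < n \<longrightarrow> (\<exists>v. JC (\<lambda>\<zeta>. poly p \<zeta> * w \<zeta> * \<zeta> ^ k) v)"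
    and V: "V_space M \<phi> N e = {poly p | p. degree p \<le> n - 1}"
  shows "(\<exists>!p. is_scalar_p JC w n p) \<and>
         (\<exists>!q. is_scalar_q JC w n q) \<and>
         (\<exists>!K. scalar_CD_kernel JC (lifted_curve M \<phi> \<gamma>) w n K) \<and>
         (\<forall>p q K. is_scalar_p JC w n p \<longrightarrow> is_scalar_q JC w n q \<longrightarrow>
           scalar_CD_kernel JC (lifted_curve M \<phi> \<gamma>) w n K \<longrightarrow>
           fills_in {(\<omega>, \<zeta>). regular_point M \<phi> eh \<omega> \<and> regular_point M \<phi> e \<zeta>}
             (\<lambda>\<omega> \<zeta>. hh \<omega> * row_mat_col (ehv \<omega>) (R (f \<omega>) (f \<zeta>)) (ev \<zeta>) * h \<zeta>) K \<and>
           fills_in {(\<omega>, \<zeta>). regular_point M \<phi> eh \<omega> \<and> regular_point M \<phi> e \<zeta> \<and> f \<omega> \<noteq> f \<zeta>}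
             (\<lambda>\<omega> \<zeta>. hh \<omega> *
                row_mat_col (ehv \<omega>)
                  (smult_mat (1 / (f \<zeta> - f \<omega>)) (QR (f \<omega>) ** PL (f \<zeta>) - PR (f \<omega>) ** QL (f \<zeta>)))
                  (ev \<zeta>) * h \<zeta>) K \<and>
           fills_in {(\<omega>, \<zeta>). \<omega> \<noteq> \<zeta>}
             (\<lambda>\<omega> \<zeta>. 1 / (\<zeta> - \<omega>) * (poly q \<omega> * poly p \<zeta> - poly p \<omega> * poly q \<zeta>)) K)"
proof -
  interpret eigen_covering M \<phi> W E \<Lambda> lam e eh
    by unfold_locales (rule M(1) \<phi> M(3) diagonalization meromorphic on_sheets)+
  obtain A D g q gh qh u su v sh where "eigen_normal M \<phi> W E \<Lambda> lam e eh A D g q gh qh u su v sh"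
    by (rule ex_eigen_normal)
  then have "eigen_space M \<phi> W E \<Lambda> lam e eh A D g q gh qh u su v sh N n"
    by (rule eigen_space.intro) (use N V in \<open>unfold_locales, auto simp: n_def\<close>)
  from eigen_space.kernel_identities[OF this curves W_rational W_no_pole kernel[unfolded J_def] orthogonal[unfolded J_def]
      scalar_convergence[unfolded JC_def w_def]]
  show ?thesis unfolding JC_def w_def h_def hh_def f_def ev_def ehv_def .
qed

end
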